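(* Let $p$ be a prime and let $\Gamma$ be a $p$-rigid constraint language on a finite set $H$. Let $\Gamma^*=\Gamma\cup\{C_a\mid a\in H\}$, where $C_a=\{(a)\}$. Then $\#_p\mathsf{CSP}(\Gamma^* )$ is polynomial-time reducible to $\#_p\mathsf{CSP}(\Gamma)$.
   Context: A constraint language over $H$ is a set of relations on $H$. An instance of $\mathsf{CSP}(\Gamma)$ is a finite set $V$ of variables with a finite set of constraints $\langle (v_1,\dots,v_m),R\rangle$, $R\in\Gamma$ $m$-ary; a solution is $\varphi:V\to H$ with $(\varphi(v_1),\dots,\varphi(v_m))\in R$ for all constraints; $\#_p\mathsf{CSP}(\Gamma)$ asks for the number of solutions modulo $p$. $\Gamma$ is $p$-rigid if the relational structure with base set $H$ and the relations of $\Gamma$ has no automorphism of order $p$. *)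

theory Defs
  imports
    "HOL-Algebra.Bij"
    "HOL-Algebra.Multiplicative_Group"
    "HOL-Computational_Algebra.Primes"
    "HOL-Computational_Algebra.Polynomial"
begin

section \<open>Constraint languages and CSP instances\<close>

text \<open>
  A relation carries its arity, so that empty relations of different arities are distinct.
\<close>

type_synonym 'a relation = "nat \<times> 'a list set"

definition tuples :: "'a set \<Rightarrow> nat \<Rightarrow> 'a list set" where
  "tuples H m = {t. length t = m \<and> set t \<subseteq> H}"

definition constraint_language :: "'a set \<Rightarrow> 'a relation set \<Rightarrow> bool" where
  "constraint_language H \<Gamma> \<longleftrightarrow> (\<forall>(m, R) \<in> \<Gamma>. R \<subseteq> tuples H m)"

definition constant_relation :: "'a \<Rightarrow> 'a relation" where
  "constant_relation a = (1, {[a]})"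

definition automorphisms :: "'a set \<Rightarrow> 'a relation set \<Rightarrow> ('a \<Rightarrow> 'a) set" where
  "automorphisms H \<Gamma> =
     {f \<in> Bij H. \<forall>(m, R) \<in> \<Gamma>. \<forall>t \<in> tuples H m. t \<in> R \<longleftrightarrow> map f t \<in> R}"

definition p_rigid :: "nat \<Rightarrow> 'a set \<Rightarrow> 'a relation set \<Rightarrow> bool" where
  "p_rigid p H \<Gamma> \<longleftrightarrow> \<not> (\<exists>f \<in> automorphisms H \<Gamma>. group.ord (BijGroup H) f = p)"

type_synonym ('v, 'a) csp = "'v set \<times> ('v list \<times> 'a relation) set"

definition csp_instance :: "'a relation set \<Rightarrow> ('v, 'a) csp \<Rightarrow> bool" where
  "csp_instance \<Gamma> = (\<lambda>(V, C). finite V \<and> finite C \<and>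
     (\<forall>(s, (m, R)) \<in> C. (m, R) \<in> \<Gamma> \<and> length s = m \<and> set s \<subseteq> V))"

definition solutions :: "'a set \<Rightarrow> ('v, 'a) csp \<Rightarrow> ('v \<Rightarrow> 'a) set" where
  "solutions H = (\<lambda>(V, C). {\<phi> \<in> V \<rightarrow>\<^sub>E H. \<forall>(s, (m, R)) \<in> C. map \<phi> s \<in> R})"


section \<open>Polynomial-time Turing reductions\<close>

datatype letter = Zero | One | Lpar | Rpar

type_synonym word = "letter list"

text \<open>
  Deterministic multi-tape Turing machines with a function oracle. A tape is a pair of lists: the
  cells to the left of the head, nearest first, and the cells from the head onwards; all
  remaining cells are blank. Tape 0 holds the input at the start and the output at the end, tape 1
  is the oracle tape.
\<close>

datatype cell = Blank | Letter letter | Work nat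

datatype dir = Go_Left | Stay | Go_Right

type_synonym tape = "cell list \<times> cell list"

fun head :: "tape \<Rightarrow> cell" where
  "head (l, []) = Blank"
| "head (l, c # r) = c"

fun write_cell :: "cell \<Rightarrow> tape \<Rightarrow> tape" where
  "write_cell c (l, r) = (l, c # tl r)"

fun move_head :: "dir \<Rightarrow> tape \<Rightarrow> tape" where
  "move_head Stay t = t"
| "move_head Go_Left ([], r) = ([], Blank # r)"
| "move_head Go_Left (c # l, r) = (l, c # r)"
| "move_head Go_Right (l, []) = (Blank # l, [])"
| "move_head Go_Right (l, c # r) = (c # l, r)"

fun letters :: "cell list \<Rightarrow> word" where
  "letters (Letter a # r) = a # letters r"
| "letters _ = []"

text \<open>
  Words are read off a tape from the head cell up to the first cell that holds no letter.
\<close>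

definition word_at_head :: "tape \<Rightarrow> word" where
  "word_at_head t = letters (snd t)"

definition word_tape :: "word \<Rightarrow> tape" where
  "word_tape w = ([], map Letter w)"

record oracle_tm =
  num_tapes :: nat
  num_work_symbols :: nat
  num_states :: nat
  start_state :: nat
  halt_state :: nat
  query_state :: nat
  answer_state :: nat
  transition :: "nat \<Rightarrow> cell list \<Rightarrow> nat \<times> (cell \<times> dir) list"

definition tape_alphabet :: "oracle_tm \<Rightarrow> cell set" where
  "tape_alphabet M = {Blank} \<union> range Letter \<union> Work ` {..<num_work_symbols M}"

definition valid_tm :: "oracle_tm \<Rightarrow> bool" where
  "valid_tm M \<longleftrightarrow>
     num_tapes M \<ge> 2 \<and>
     {start_state M, halt_state M, query_state M, answer_state M} \<subseteq> {..<num_states M} \<and>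
     (\<forall>q < num_states M. \<forall>cs. length cs = num_tapes M \<and> set cs \<subseteq> tape_alphabet M \<longrightarrow>
        (case transition M q cs of (q', as) \<Rightarrow>
           q' < num_states M \<and> length as = num_tapes M \<and> fst ` set as \<subseteq> tape_alphabet M))"

type_synonym config = "nat \<times> tape list"

definition initial_config :: "oracle_tm \<Rightarrow> word \<Rightarrow> config" where
  "initial_config M w = (start_state M, word_tape w # replicate (num_tapes M - 1) (word_tape []))"

text \<open>
  In the query state, a single step replaces the contents of the oracle tape by the answer.
\<close>

definition tm_step :: "(word \<Rightarrow> word) \<Rightarrow> oracle_tm \<Rightarrow> config \<Rightarrow> config" where
  "tm_step f M = (\<lambda>(q, ts).
     if q = halt_state M then (q, ts)
     else if q = query_state M then
       (answer_state M, ts[1 := word_tape (f (word_at_head (ts ! 1)))])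
     else
       (case transition M q (map head ts) of (q', as) \<Rightarrow>
          (q', map2 (\<lambda>(c, d) t. move_head d (write_cell c t)) as ts)))"

definition outputs_within :: "(word \<Rightarrow> word) \<Rightarrow> oracle_tm \<Rightarrow> word \<Rightarrow> word \<Rightarrow> nat \<Rightarrow> bool" where
  "outputs_within f M x y n \<longleftrightarrow>
     (\<exists>k \<le> n. case (tm_step f M ^^ k) (initial_config M x) of (q, ts) \<Rightarrow>
        q = halt_state M \<and> word_at_head (ts ! 0) = y)"

text \<open>
  A function problem is the set of its (input, output) pairs; words that are not inputs are
  outside the promise. The oracle may answer arbitrarily there, and nothing is required of the
  reduction on such inputs.
\<close>

type_synonym problem = "(word \<times> word) set"

definition solves :: "(word \<Rightarrow> word) \<Rightarrow> problem \<Rightarrow> bool" where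
  "solves f A \<longleftrightarrow> (\<forall>(x, y) \<in> A. f x = y)"

definition poly_time_reducible :: "problem \<Rightarrow> problem \<Rightarrow> bool" where
  "poly_time_reducible A B \<longleftrightarrow>
     (\<exists>M (P :: nat poly). valid_tm M \<and>
        (\<forall>f. solves f B \<longrightarrow>
           (\<forall>(x, y) \<in> A. outputs_within f M x y (poly P (length x)))))"


section \<open>Counting CSPs modulo \<open>p\<close> as problems on words\<close>

text \<open>
  Variables are bit strings. An instance is presented by a list of its variables and a list of its
  constraints; the relation of a constraint is presented by a list of its tuples, its arity being
  the length of the scope. The lists present sets, so their order and repetitions are irrelevant.
\<close>

type_synonym 'a presentation = "bool list list \<times> (bool list list \<times> 'a list list) list"

definition presented :: "'a presentation \<Rightarrow> (bool list, 'a) csp" where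
  "presented = (\<lambda>(vs, cs). (set vs, (\<lambda>(s, ts). (s, (length s, set ts))) ` set cs))"

definition bits :: "bool list \<Rightarrow> word" where
  "bits bs = map (\<lambda>b. if b then One else Zero) bs"

definition encode_list :: "('b \<Rightarrow> word) \<Rightarrow> 'b list \<Rightarrow> word" where
  "encode_list e xs = Lpar # concat (map e xs) @ [Rpar]"

definition encode_string :: "bool list \<Rightarrow> word" where
  "encode_string bs = Lpar # bits bs @ [Rpar]"

definition encode_constraint ::
    "('a \<Rightarrow> bool list) \<Rightarrow> bool list list \<times> 'a list list \<Rightarrow> word" where
  "encode_constraint nm = (\<lambda>(s, ts).
     encode_list encode_string s @ encode_list (encode_list (\<lambda>a. encode_string (nm a))) ts)"

text \<open>
  The function \<open>nm\<close> assigns bit strings to the elements of the domain.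
\<close>

definition encode :: "('a \<Rightarrow> bool list) \<Rightarrow> 'a presentation \<Rightarrow> word" where
  "encode nm = (\<lambda>(vs, cs).
     encode_list encode_string vs @ encode_list (encode_constraint nm) cs)"

text \<open>Binary numerals, least significant bit first.\<close>

fun binary :: "nat \<Rightarrow> bool list" where
  "binary n = (if n = 0 then [] else odd n # binary (n div 2))"

declare binary.simps [simp del]

definition count_csp_mod ::
    "nat \<Rightarrow> ('a \<Rightarrow> bool list) \<Rightarrow> 'a set \<Rightarrow> 'a relation set \<Rightarrow> problem" where
  "count_csp_mod p nm H \<Gamma> =
     {(encode nm P, bits (binary (card (solutions H (presented P)) mod p))) | P.
        csp_instance \<Gamma> (presented P)}"


subsection \<open>The encoding is unambiguous\<close>

definition prefix_code :: "'b set \<Rightarrow> ('b \<Rightarrow> word) \<Rightarrow> bool" where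
  "prefix_code A e \<longleftrightarrow>
     (\<forall>x\<in>A. \<exists>u. e x = Lpar # u) \<and>
     (\<forall>x\<in>A. \<forall>y\<in>A. \<forall>u v. e x @ u = e y @ v \<longrightarrow> x = y \<and> u = v)"

lemma prefix_codeD:
  "prefix_code A e \<Longrightarrow> x \<in> A \<Longrightarrow> y \<in> A \<Longrightarrow> e x @ u = e y @ v \<Longrightarrow> x = y \<and> u = v"
  unfolding prefix_code_def by blast

lemma prefix_code_string: "prefix_code UNIV encode_string"
proof -
  have "xs = ys \<and> u = v" if "bits xs @ Rpar # u = bits ys @ Rpar # v" for xs ys u v
    using that
  proof (induction xs arbitrary: ys)
    case Nil
    then show ?case by (cases ys) (auto simp: bits_def split: if_splits)
  next
    case (Cons x xs)
    then show ?case by (cases ys) (auto simp: bits_def split: if_splits)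
  qed
  then show ?thesis by (auto simp: prefix_code_def encode_string_def)
qed

lemma prefix_code_list:
  assumes "prefix_code A e"
  shows "prefix_code (lists A) (encode_list e)"
proof -
  have body: "xs = ys \<and> u = v"
    if "xs \<in> lists A" "ys \<in> lists A"
      "concat (map e xs) @ Rpar # u = concat (map e ys) @ Rpar # v" for xs ys u v
    using that
  proof (induction xs arbitrary: ys rule: list.induct)
    case Nil
    then show ?case
    proof (cases ys)
      case (Cons y ys')
      then have "y \<in> A" using Nil.prems(2) by simp
      then obtain w where "e y = Lpar # w" using assms unfolding prefix_code_def by blast
      then show ?thesis using Nil.prems Cons by simp
    qed simp
  next
    case (Cons x xs)
    show ?case
    proof (cases ys)
      case Nil
      have "x \<in> A" using Cons.prems(1) by simp
      then obtain w where "e x = Lpar # w" using assms unfolding prefix_code_def by blast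
      then show ?thesis using Nil Cons.prems by simp
    next
      case (Cons y ys')
      then have "e x @ (concat (map e xs) @ Rpar # u) = e y @ (concat (map e ys') @ Rpar # v)"
        using Cons.prems by simp
      moreover have "x \<in> A" "y \<in> A" "xs \<in> lists A" "ys' \<in> lists A"
        using Cons.prems(1,2) Cons by simp_all
      ultimately have "x = y" "xs = ys' \<and> u = v"
        using prefix_codeD[OF assms] Cons.IH[of ys'] by blast+
      then show ?thesis using Cons by simp
    qed
  qed
  have "xs = ys \<and> u = v"
    if "xs \<in> lists A" "ys \<in> lists A" "encode_list e xs @ u = encode_list e ys @ v" for xs ys u v
  proof (rule body[OF that(1,2)])
    show "concat (map e xs) @ Rpar # u = concat (map e ys) @ Rpar # v"
      using that(3) by (simp add: encode_list_def)
  qed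
  moreover have "\<exists>u. encode_list e xs = Lpar # u" for xs
    by (simp add: encode_list_def)
  ultimately show ?thesis unfolding prefix_code_def by blast
qed

lemma encode_inj:
  assumes "inj_on nm H"
    and "\<And>s ts t. (s, ts) \<in> set (snd P) \<Longrightarrow> t \<in> set ts \<Longrightarrow> set t \<subseteq> H"
    and "\<And>s ts t. (s, ts) \<in> set (snd Q) \<Longrightarrow> t \<in> set ts \<Longrightarrow> set t \<subseteq> H"
    and "encode nm P = encode nm Q"
  shows "P = Q"
proof -
  have vars: "prefix_code UNIV (encode_list encode_string)"
    using prefix_code_list[OF prefix_code_string] by simp
  have "prefix_code H (\<lambda>a. encode_string (nm a))"
    using prefix_code_string assms(1) unfolding prefix_code_def inj_on_def by blast
  then have rels: "prefix_code (lists (lists H)) (encode_list (encode_list (\<lambda>a. encode_string (nm a))))"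
    by (intro prefix_code_list)
  have "prefix_code (UNIV \<times> lists (lists H)) (encode_constraint nm)"
    unfolding prefix_code_def
  proof (intro conjI ballI allI impI)
    fix c d u v
    assume c: "c \<in> UNIV \<times> lists (lists H)" and d: "d \<in> UNIV \<times> lists (lists H)"
      and eq: "encode_constraint nm c @ u = encode_constraint nm d @ v"
    obtain s ts s' ts' where cd: "c = (s, ts)" "d = (s', ts')" by (metis surj_pair)
    have "s = s' \<and> encode_list (encode_list (\<lambda>a. encode_string (nm a))) ts @ u =
        encode_list (encode_list (\<lambda>a. encode_string (nm a))) ts' @ v"
      by (rule prefix_codeD[OF vars]) (use eq cd in \<open>auto simp: encode_constraint_def\<close>)
    moreover from this have "ts = ts' \<and> u = v"
      by (intro prefix_codeD[OF rels]) (use c d cd in auto)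
    ultimately show "c = d" "u = v" using cd by auto
  qed (auto simp: encode_constraint_def encode_list_def)
  then have cons: "prefix_code (lists (UNIV \<times> lists (lists H))) (encode_list (encode_constraint nm))"
    by (rule prefix_code_list)
  obtain vs cs vs' cs' where PQ: "P = (vs, cs)" "Q = (vs', cs')" by (metis surj_pair)
  have "vs = vs' \<and> encode_list (encode_constraint nm) cs = encode_list (encode_constraint nm) cs'"
    by (rule prefix_codeD[OF vars]) (use assms(4) PQ in \<open>auto simp: encode_def\<close>)
  moreover have "cs \<in> lists (UNIV \<times> lists (lists H))" "cs' \<in> lists (UNIV \<times> lists (lists H))"
    using assms(2,3) PQ by (fastforce simp: in_lists_conv_set)+
  ultimately have "vs = vs'" "cs = cs'"
    using prefix_codeD[OF cons, of cs cs' "[]" "[]"] by auto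
  then show ?thesis using PQ by simp
qed

lemma single_valued_count_csp_mod:
  assumes "constraint_language H \<Gamma>" "inj_on nm H"
  shows "single_valued (count_csp_mod p nm H \<Gamma>)"
proof -
  have in_H: "set t \<subseteq> H"
    if "csp_instance \<Gamma> (presented P)" "(s, ts) \<in> set (snd P)" "t \<in> set ts" for P s ts t
  proof -
    have "(length s, set ts) \<in> \<Gamma>"
      using that(1,2) by (cases P) (force simp: csp_instance_def presented_def)
    then show ?thesis
      using assms(1) that(3) by (force simp: constraint_language_def tuples_def)
  qed
  have "P = Q" if "csp_instance \<Gamma> (presented P)" "csp_instance \<Gamma> (presented Q)"
    "encode nm P = encode nm Q" for P Q
    by (rule encode_inj[OF assms(2) _ _ that(3)]) (use in_H that in blast)+
  then show ?thesis
    unfolding single_valued_def count_csp_mod_def by blast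
qed

end

theory Submission
  imports Defs "HOL-Algebra.Sylow"
begin

text \<open>
  Add a variable for every element of \<open>H\<close>, constrained by the tuples of a finite sublanguage of
  \<open>\<Gamma>\<close> with the same automorphisms, and replace each variable pinned to \<open>a\<close> by the variable of
  \<open>a\<close>. A solution then restricts to an endomorphism of the sublanguage. Identifying the element
  variables along the pairs in a set \<open>S\<close> counts the solutions whose restriction agrees on each of
  these pairs, so inclusion and exclusion over \<open>S\<close> yields the number of solutions with an injective
  restriction, that is, an automorphism. Composition with the automorphism shows that this number is
  \<open>|Aut|\<close> times the number of solutions of the given instance, and by Cauchy's theorem
  \<open>p\<close>-rigidity makes \<open>|Aut|\<close> invertible modulo \<open>p\<close>. The answer is thus a fixed linear combination
  modulo \<open>p\<close> of boundedly many oracle answers.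

  The oracle machine is obtained from a machine with several stacks, each kept on a tape of its own
  with the top symbol under the head.
\<close>

section \<open>Automorphisms\<close>

text \<open>\<open>\<Gamma>\<close> cannot name the elements of \<open>H\<close>: constraints
  describe a copy of \<open>H\<close> at best up to an automorphism. This is why injective copies
  are counted rather than the identity copy, and why the number of automorphisms appears as a factor
  that must be cancelled. Constraints over \<open>\<Gamma>\<close> need not be able to express
  injectivity, but an equality can be imposed by sharing a variable; expanding the product of the
  factors 1 - [\<psi> x = \<psi> y] over all pairs reduces the one to the other, with sign (-1)^|S|.
  The number of queries is exponential in the number of pairs but constant, as \<open>H\<close>,
  \<open>\<Gamma>\<close> and \<open>p\<close> are fixed. The sublanguage, the representatives of
  the identified elements and the inverse of the number of automorphisms are built into the machine,
  so it is enough that they exist. An instance that pins a variable to two elements has no solution;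
  there the substitution makes no sense, and the machine outputs 0 without asking the oracle. Moving
  a word from one stack to another reverses it, so successive phases read the instance in
  alternating directions.\<close>

lemma finite_Bij: "finite H \<Longrightarrow> finite (Bij H)"
  by (rule finite_subset[OF _ finite_PiE[of H "\<lambda>_. H"]]) (auto simp: Bij_def PiE_def bij_betw_def)

lemma automorphismI:
  assumes "f \<in> Bij H" "\<And>m R t. (m, R) \<in> \<Gamma> \<Longrightarrow> t \<in> tuples H m \<Longrightarrow> t \<in> R \<longleftrightarrow> map f t \<in> R"
  shows "f \<in> automorphisms H \<Gamma>"
  using assms by (auto simp: automorphisms_def)

lemma automorphismD:
  assumes "f \<in> automorphisms H \<Gamma>"
  shows "f \<in> Bij H" "(m, R) \<in> \<Gamma> \<Longrightarrow> t \<in> tuples H m \<Longrightarrow> t \<in> R \<longleftrightarrow> map f t \<in> R"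
  using assms by (auto simp: automorphisms_def)

lemma map_Bij_tuples: "f \<in> Bij H \<Longrightarrow> t \<in> tuples H m \<Longrightarrow> map f t \<in> tuples H m"
  using Bij_imp_funcset[of f H] by (auto simp: tuples_def)

lemma subgroup_automorphisms: "subgroup (automorphisms H \<Gamma>) (BijGroup H)"
proof (rule group.subgroupI[OF group_BijGroup])
  show "automorphisms H \<Gamma> \<subseteq> carrier (BijGroup H)"
    by (auto simp: automorphisms_def BijGroup_def)
  have "(\<lambda>x \<in> H. x) \<in> automorphisms H \<Gamma>"
  proof (rule automorphismI[OF id_Bij])
    fix m R t assume "t \<in> tuples H m"
    then have "map (\<lambda>x \<in> H. x) t = t" by (intro map_idI) (auto simp: tuples_def)
    then show "t \<in> R \<longleftrightarrow> map (\<lambda>x \<in> H. x) t \<in> R" by simp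
  qed
  then show "automorphisms H \<Gamma> \<noteq> {}" by blast
next
  fix f assume f: "f \<in> automorphisms H \<Gamma>"
  note fB = automorphismD(1)[OF f]
  let ?g = "\<lambda>x \<in> H. inv_into H f x"
  have gB: "?g \<in> Bij H" by (rule restrict_inv_into_Bij[OF fB])
  have "?g \<in> automorphisms H \<Gamma>"
  proof (rule automorphismI[OF gB])
    fix m R t assume R: "(m, R) \<in> \<Gamma>" and t: "t \<in> tuples H m"
    have "map f (map ?g t) = t"
      using t fB by (auto simp: tuples_def Bij_def bij_betw_def f_inv_into_f intro!: map_idI)
    then show "t \<in> R \<longleftrightarrow> map ?g t \<in> R"
      using automorphismD(2)[OF f R map_Bij_tuples[OF gB t]] by simp
  qed
  then show "inv\<^bsub>BijGroup H\<^esub> f \<in> automorphisms H \<Gamma>" by (simp add: inv_BijGroup[OF fB])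
next
  fix f g assume f: "f \<in> automorphisms H \<Gamma>" and g: "g \<in> automorphisms H \<Gamma>"
  note fB = automorphismD(1)[OF f] and gB = automorphismD(1)[OF g]
  have "compose H f g \<in> automorphisms H \<Gamma>"
  proof (rule automorphismI[OF compose_Bij[OF fB gB]])
    fix m R t assume R: "(m, R) \<in> \<Gamma>" and t: "t \<in> tuples H m"
    have "map (compose H f g) t = map f (map g t)"
      using t by (auto simp: tuples_def compose_def)
    then show "t \<in> R \<longleftrightarrow> map (compose H f g) t \<in> R"
      using automorphismD(2)[OF g R t] automorphismD(2)[OF f R map_Bij_tuples[OF gB t]]
      by (simp del: map_map)
  qed
  then show "f \<otimes>\<^bsub>BijGroup H\<^esub> g \<in> automorphisms H \<Gamma>" using fB gB by (simp add: BijGroup_def)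
qed

text \<open>Sylow's theorem yields a subgroup of order \<open>p\<close>, and the order of each of
  its nontrivial elements divides the prime \<open>p\<close>. Orders are measured in the ambient
  group, as in the definition of \<open>p_rigid\<close>.\<close>

lemma (in group) Cauchy_subgroup:
  assumes "prime p" "subgroup K G" "finite K" "p dvd card K"
  shows "\<exists>x \<in> K. ord x = p"
proof -
  interpret K: group "G\<lparr>carrier := K\<rparr>" by (rule subgroup_imp_group[OF assms(2)])
  obtain m where "card K = p ^ 1 * m" using assms(4) by auto
  \<comment> \<open>With exponent 1 the remaining factor \<open>m\<close> may still be divisible by
    \<open>p\<close>.\<close>
  then obtain L where L: "subgroup L (G\<lparr>carrier := K\<rparr>)" "card L = p ^ 1"
    using sylow_thm[OF assms(1) K.is_group, of 1 m] assms(3) by (auto simp: Coset.order_def)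
  have sub: "subgroup L G" by (rule incl_subgroup[OF assms(2) L(1)])
  interpret L: group "G\<lparr>carrier := L\<rparr>" by (rule subgroup_imp_group[OF sub])
  have "card L > 1" using L(2) prime_gt_1_nat[OF assms(1)] by simp
  then obtain x where x: "x \<in> L" "x \<noteq> \<one>"
    by (metis card_le_Suc0_iff_eq card.infinite not_less One_nat_def zero_le_one)
  have xG: "x \<in> carrier G" using x(1) subgroup.subset[OF sub] by blast
  have "finite L" using L(2) assms(1) by (metis card.infinite not_prime_0 power_one_right)
  then have "x [^]\<^bsub>G\<lparr>carrier := L\<rparr>\<^esub> Coset.order (G\<lparr>carrier := L\<rparr>) = \<one>\<^bsub>G\<lparr>carrier := L\<rparr>\<^esub>"
    using x(1) by (intro L.pow_order_eq_1) simp
  then have "x [^] p = \<one>"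
    using L(2) by (simp add: Coset.order_def nat_pow_consistent[symmetric])
  then have "ord x dvd p" using pow_eq_id[OF xG] by simp
  moreover have "ord x \<noteq> 1" using ord_eq_1[OF xG] x(2) by simp
  ultimately have "ord x = p" using assms(1) by (metis prime_nat_iff)
  moreover have "x \<in> K" using x(1) subgroup.subset[OF L(1)] by auto
  ultimately show ?thesis by blast
qed

lemma p_rigid_not_dvd:
  assumes "prime p" "finite H" "p_rigid p H \<Gamma>"
  shows "\<not> p dvd card (automorphisms H \<Gamma>)"
proof
  assume "p dvd card (automorphisms H \<Gamma>)"
  moreover have "finite (automorphisms H \<Gamma>)"
    unfolding automorphisms_def using finite_Bij[OF assms(2)] by (rule finite_subset[rotated]) blast
  ultimately have "\<exists>x \<in> automorphisms H \<Gamma>. group.ord (BijGroup H) x = p"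
    by (intro group.Cauchy_subgroup[OF group_BijGroup assms(1) subgroup_automorphisms])
  then show False using assms(3) unfolding p_rigid_def by blast
qed

text \<open>Each of the finitely many bijections that is not an automorphism violates some relation;
  one such relation per bijection is enough. \<open>\<Gamma>\<close> itself may be infinite, whereas
  a query lists its constraints explicitly.\<close>

lemma ex_finite_sublanguage:
  assumes "finite H"
  shows "\<exists>\<Delta> \<subseteq> \<Gamma>. finite \<Delta> \<and> automorphisms H \<Delta> = automorphisms H \<Gamma>"
proof -
  let ?bad = "\<lambda>f c. c \<in> \<Gamma> \<and> \<not> (\<forall>t \<in> tuples H (fst c). t \<in> snd c \<longleftrightarrow> map f t \<in> snd c)"
  have "\<exists>c. ?bad f c" if "f \<in> Bij H - automorphisms H \<Gamma>" for f
  proof (rule ccontr)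
    assume "\<nexists>c. ?bad f c"
    then have "\<forall>c \<in> \<Gamma>. \<forall>t \<in> tuples H (fst c). t \<in> snd c \<longleftrightarrow> map f t \<in> snd c" by blast
    then have "f \<in> automorphisms H \<Gamma>" using that by (intro automorphismI) force+
    then show False using that by blast
  qed
  then obtain c where c: "\<And>f. f \<in> Bij H - automorphisms H \<Gamma> \<Longrightarrow> ?bad f (c f)" by metis
  let ?D = "c ` (Bij H - automorphisms H \<Gamma>)"
  have "?D \<subseteq> \<Gamma>" using c by blast
  moreover have "finite ?D" using finite_Bij[OF assms] by simp
  moreover have "automorphisms H ?D = automorphisms H \<Gamma>"
  proof
    show "automorphisms H \<Gamma> \<subseteq> automorphisms H ?D"
    proof
      fix f assume f: "f \<in> automorphisms H \<Gamma>"
      show "f \<in> automorphisms H ?D"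
        by (rule automorphismI[OF automorphismD(1)[OF f]])
           (rule automorphismD(2)[OF f], use \<open>?D \<subseteq> \<Gamma>\<close> in blast)
    qed
    show "automorphisms H ?D \<subseteq> automorphisms H \<Gamma>"
    proof (rule subsetI, rule ccontr)
      fix f assume f: "f \<in> automorphisms H ?D" and n: "f \<notin> automorphisms H \<Gamma>"
      then have fB: "f \<in> Bij H - automorphisms H \<Gamma>" using automorphismD(1) by blast
      then have "(fst (c f), snd (c f)) \<in> ?D" by simp
      then show False using automorphismD(2)[OF f] c[OF fB] by blast
    qed
  qed
  ultimately show ?thesis by blast
qed

section \<open>Injective endomorphisms of finite structures\<close>

lemma finite_tuples: "finite H \<Longrightarrow> finite (tuples H m)"
proof -
  assume "finite H"
  have "tuples H m = {xs. set xs \<subseteq> H \<and> length xs = m}" by (auto simp: tuples_def)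
  then show ?thesis using finite_lists_length_eq[OF \<open>finite H\<close>] by simp
qed

text \<open>Constraints can only force tuples of a relation to be mapped into it. On a finite set
  this suffices: an injective \<open>map f\<close> from \<open>R\<close> into \<open>R\<close> is
  onto, so no tuple outside \<open>R\<close> lands in \<open>R\<close>.\<close>

lemma injective_endomorphism_automorphism:
  assumes "finite H" "constraint_language H \<Gamma>" "f \<in> H \<rightarrow>\<^sub>E H" "inj_on f H"
    and "\<And>m R t. (m, R) \<in> \<Gamma> \<Longrightarrow> t \<in> R \<Longrightarrow> map f t \<in> R"
  shows "f \<in> automorphisms H \<Gamma>"
proof (rule automorphismI)
  have "f ` H = H" using assms(1,3,4) by (intro endo_inj_surj) (auto simp: PiE_def)
  then show "f \<in> Bij H" using assms(3,4) by (auto simp: Bij_def bij_betw_def PiE_def)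
  fix m R t assume R: "(m, R) \<in> \<Gamma>" and t: "t \<in> tuples H m"
  have RH: "R \<subseteq> tuples H m" using assms(2) R by (auto simp: constraint_language_def)
  have inj: "inj_on (map f) (tuples H m)"
    by (rule inj_on_mapI[OF inj_on_subset[OF assms(4)]]) (auto simp: tuples_def)
  have "map f ` R = R"
    using finite_subset[OF RH finite_tuples[OF assms(1)]] assms(5)[OF R] inj_on_subset[OF inj RH]
    by (intro endo_inj_surj) blast+
  then have "t \<in> R" if "map f t \<in> R"
    using that inj_on_image_mem_iff[OF inj t RH] by simp
  then show "t \<in> R \<longleftrightarrow> map f t \<in> R" using assms(5)[OF R] by blast
qed

section \<open>Inclusion and exclusion over identifications\<close>

text \<open>\<open>\<theta>\<close> picks a representative in each class of the equivalence relation
  generated by \<open>S\<close>. The classes are described through the maps that are constant on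
  them, the form in which solutions meet them; these maps are candidates for endomorphisms, hence
  their type.\<close>

definition collapses :: "'a set \<Rightarrow> ('a \<times> 'a) set \<Rightarrow> ('a \<Rightarrow> 'a) \<Rightarrow> bool" where
  "collapses H S \<theta> \<longleftrightarrow> \<theta> \<in> H \<rightarrow> H \<and> (\<forall>x \<in> H. \<theta> (\<theta> x) = \<theta> x) \<and>
    (\<forall>\<psi> :: 'a \<Rightarrow> 'a. (\<forall>(x, y) \<in> S. \<psi> x = \<psi> y) \<longleftrightarrow> (\<forall>x \<in> H. \<psi> (\<theta> x) = \<psi> x))"

text \<open>A new pair merges two classes: the class of its second element takes over the
  representative of the first.\<close>

lemma ex_collapse:
  assumes "finite S" "S \<subseteq> H \<times> H"
  shows "\<exists>\<theta>. collapses H S \<theta>"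
  unfolding collapses_def using assms
proof (induction S rule: finite_induct)
  case empty
  show ?case by (rule exI[of _ id]) auto
next
  case (insert z S)
  obtain a b where z: "z = (a, b)" by (cases z)
  have ab: "a \<in> H" "b \<in> H" using insert.prems z by auto
  obtain \<theta> where th: "\<theta> \<in> H \<rightarrow> H" "\<And>x. x \<in> H \<Longrightarrow> \<theta> (\<theta> x) = \<theta> x"
    and eq: "\<And>\<psi> :: 'a \<Rightarrow> 'a. (\<forall>(x, y) \<in> S. \<psi> x = \<psi> y) \<longleftrightarrow> (\<forall>x \<in> H. \<psi> (\<theta> x) = \<psi> x)"
    using insert.IH insert.prems by auto
  define \<theta>' where "\<theta>' x = (if \<theta> x = \<theta> b then \<theta> a else \<theta> x)" for x
  have "\<theta>' \<in> H \<rightarrow> H" using th(1) ab by (auto simp: \<theta>'_def)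
  moreover have "\<theta>' (\<theta>' x) = \<theta>' x" if "x \<in> H" for x
    using th(2) that ab by (auto simp: \<theta>'_def)
  moreover have "(\<forall>(x, y) \<in> insert z S. \<psi> x = \<psi> y) \<longleftrightarrow> (\<forall>x \<in> H. \<psi> (\<theta>' x) = \<psi> x)" for \<psi> :: "'a \<Rightarrow> 'a"
  proof
    assume l: "\<forall>(x, y) \<in> insert z S. \<psi> x = \<psi> y"
    then have "\<forall>x \<in> H. \<psi> (\<theta> x) = \<psi> x" "\<psi> a = \<psi> b" using eq z by auto
    then show "\<forall>x \<in> H. \<psi> (\<theta>' x) = \<psi> x" using ab by (metis \<theta>'_def)
  next
    assume r: "\<forall>x \<in> H. \<psi> (\<theta>' x) = \<psi> x"
    have "\<psi> (\<theta> x) = \<psi> x" if "x \<in> H" for x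
    proof -
      have "\<theta> x \<in> H" using th(1) that by auto
      \<comment> \<open>As \<open>\<theta>\<close> is idempotent, \<open>\<theta>'\<close> has the
        same value at \<open>x\<close> and at \<open>\<theta> x\<close>; the hypothesis at these two
        points then makes \<open>\<psi>\<close> agree there as well.\<close>
      then show ?thesis
        using r[rule_format, OF that] r[rule_format, of "\<theta> x"] th(2)[OF that]
        by (simp add: \<theta>'_def split: if_splits)
    qed
    moreover from this have "\<psi> a = \<psi> b"
      using r[rule_format, OF ab(2)] ab by (simp add: \<theta>'_def)
    ultimately show "\<forall>(x, y) \<in> insert z S. \<psi> x = \<psi> y" using eq z by blast
  qed
  ultimately show ?case by blast
qed

text \<open>Ordered pairs avoid choosing an order on \<open>H\<close>. Each unordered pair then
  contributes its factor twice, which is harmless since the factor is 0 or 1.\<close>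

definition distinct_pairs :: "'a set \<Rightarrow> ('a \<times> 'a) set" where
  "distinct_pairs H = {(x, y). x \<in> H \<and> y \<in> H \<and> x \<noteq> y}"

lemma finite_distinct_pairs: "finite H \<Longrightarrow> finite (distinct_pairs H)"
  by (rule finite_subset[of _ "H \<times> H"]) (auto simp: distinct_pairs_def)

text \<open>The left side expands the product of 1 - [\<psi> x = \<psi> y] over all pairs, and this
  product is 1 or 0 according to whether \<open>\<psi>\<close> is injective.\<close>

lemma sum_identifications:
  fixes \<psi> :: "'a \<Rightarrow> 'b"
  assumes "finite H"
  shows "(\<Sum>S \<in> Pow (distinct_pairs H). (- 1) ^ card S * of_bool (\<forall>(x, y) \<in> S. \<psi> x = \<psi> y)) =
    (of_bool (inj_on \<psi> H) :: int)"
proof -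
  let ?P = "distinct_pairs H" and ?e = "\<lambda>(x, y). of_bool (\<psi> x = \<psi> y) :: int"
  have fin: "finite ?P" by (rule finite_distinct_pairs[OF assms])
  have all: "(\<Prod>z \<in> S. ?e z) = of_bool (\<forall>(x, y) \<in> S. \<psi> x = \<psi> y)" if "finite S" for S
    using that by (induction S rule: finite_induct) (auto split: prod.splits)
  have "(\<Prod>z \<in> ?P. - ?e z + 1) = (\<Sum>S \<in> Pow ?P. (\<Prod>z \<in> S. - ?e z) * (\<Prod>z \<in> ?P - S. 1))"
    by (rule prod_add[OF fin])
  also have "\<dots> = (\<Sum>S \<in> Pow ?P. (- 1) ^ card S * of_bool (\<forall>(x, y) \<in> S. \<psi> x = \<psi> y))"
  proof (rule sum.cong[OF refl])
    fix S assume "S \<in> Pow ?P"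
    then have "finite S" using fin finite_subset by blast
    have "(\<Prod>z \<in> S. - ?e z) = (- 1) ^ card S * (\<Prod>z \<in> S. ?e z)"
      using \<open>finite S\<close> by (induction S rule: finite_induct) auto
    then show "(\<Prod>z \<in> S. - ?e z) * (\<Prod>z \<in> ?P - S. 1) = (- 1) ^ card S * of_bool (\<forall>(x, y) \<in> S. \<psi> x = \<psi> y)"
      by (simp only: all[OF \<open>finite S\<close>]) simp
  qed
  also have "(\<Prod>z \<in> ?P. - ?e z + 1) = of_bool (inj_on \<psi> H)"
  proof (cases "inj_on \<psi> H")
    case True
    then have "\<And>z. z \<in> ?P \<Longrightarrow> - ?e z + 1 = 1" by (auto simp: distinct_pairs_def inj_on_def)
    then show ?thesis using True by (simp add: prod.neutral)
  next
    case False
    then obtain x y where "(x, y) \<in> ?P" "\<psi> x = \<psi> y" by (auto simp: distinct_pairs_def inj_on_def)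
    then have "\<exists>z \<in> ?P. - ?e z + 1 = 0" by force
    then have "(\<Prod>z \<in> ?P. - ?e z + 1) = 0" by (rule prod_zero[OF fin])
    then show ?thesis using False by simp
  qed
  finally show ?thesis by simp
qed

text \<open>The identity for indicators is summed over \<open>A\<close>. The second component makes
  room for the values that a solution takes on the variables of the given instance.\<close>

lemma sum_card_identifications:
  fixes A :: "(('a \<Rightarrow> 'b) \<times> 'c) set"
  assumes "finite H" "finite A"
  shows "(\<Sum>S \<in> Pow (distinct_pairs H).
      (- 1) ^ card S * int (card {z \<in> A. \<forall>(x, y) \<in> S. fst z x = fst z y})) =
    int (card {z \<in> A. inj_on (fst z) H})"
proof -
  have count: "int (card {z \<in> A. P z}) = (\<Sum>z \<in> A. of_bool (P z))" for P
    using assms(2) by (simp add: sum.If_cases of_bool_def Int_def)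
  have "(\<Sum>S \<in> Pow (distinct_pairs H).
      (- 1) ^ card S * int (card {z \<in> A. \<forall>(x, y) \<in> S. fst z x = fst z y})) =
    (\<Sum>z \<in> A. \<Sum>S \<in> Pow (distinct_pairs H). (- 1) ^ card S * of_bool (\<forall>(x, y) \<in> S. fst z x = fst z y))"
    unfolding count sum_distrib_left by (rule sum.swap)
  then show ?thesis unfolding count sum_identifications[OF assms(1)] .
qed

section \<open>Instances with collapsed copies of the domain\<close>

text \<open>The leading bit \<open>False\<close>, against the \<open>True\<close> in
  \<open>subst_var\<close>, keeps the element variables apart from the variables of the given
  instance.\<close>

definition elem_var :: "('a \<Rightarrow> bool list) \<Rightarrow> 'a \<Rightarrow> bool list" where
  "elem_var nm x = False # nm x"

text \<open>Together these constraints say that the restriction of a solution to the element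
  variables preserves every listed relation. A relation is a list of its tuples because this is how
  it is written in a query.\<close>

definition copy_constraints ::
    "('a \<Rightarrow> bool list) \<Rightarrow> 'a list list list \<Rightarrow> ('a \<Rightarrow> 'a) \<Rightarrow> (bool list list \<times> 'a list list) list" where
  "copy_constraints nm rels \<theta> =
     concat (map (\<lambda>r. map (\<lambda>t. (map (\<lambda>x. elem_var nm (\<theta> x)) t, r)) r) rels)"

definition subst_var ::
    "('a \<Rightarrow> bool list) \<Rightarrow> (bool list \<Rightarrow> 'a option) \<Rightarrow> ('a \<Rightarrow> 'a) \<Rightarrow> bool list \<Rightarrow> bool list" where
  "subst_var nm K \<theta> w = (case K w of None \<Rightarrow> True # w | Some x \<Rightarrow> elem_var nm (\<theta> x))"

definition collapsed ::
    "('a \<Rightarrow> bool list) \<Rightarrow> 'a list \<Rightarrow> 'a list list list \<Rightarrow> (bool list \<Rightarrow> 'a option) \<Rightarrow>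
     'a presentation \<Rightarrow> ('a \<Rightarrow> 'a) \<Rightarrow> 'a presentation" where
  "collapsed nm hs rels K = (\<lambda>(vs, cs) \<theta>.
     (map (\<lambda>x. elem_var nm (\<theta> x)) hs @ map (subst_var nm K \<theta>) vs,
      copy_constraints nm rels \<theta> @ map (\<lambda>(s, ts). (map (subst_var nm K \<theta>) s, ts)) cs))"

lemma solutions_presented:
  "solutions H (presented (vs, cs)) = {\<phi> \<in> set vs \<rightarrow>\<^sub>E H. \<forall>(s, ts) \<in> set cs. map \<phi> s \<in> set ts}"
  by (auto simp: solutions_def presented_def)

text \<open>\<open>cs\<close> is what remains of an instance when its constant constraints have been
  turned into the pins \<open>K\<close>, hence its relations lie in \<open>\<Gamma>\<close>.
  \<open>rels\<close> lists the relations of the finite sublanguage; \<open>rels_auto\<close> is the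
  property for which it is chosen.\<close>

locale pinned_instance =
  fixes H :: "'a set" and nm :: "'a \<Rightarrow> bool list" and \<Gamma> :: "'a relation set"
    and hs :: "'a list" and rels :: "'a list list list" and K :: "bool list \<Rightarrow> 'a option"
    and vs :: "bool list list" and cs :: "(bool list list \<times> 'a list list) list"
  assumes finite_H: "finite H" and inj_nm: "inj_on nm H" and lang: "constraint_language H \<Gamma>"
    and hs: "set hs = H"
    and rels: "\<And>r. r \<in> set rels \<Longrightarrow> \<exists>m. (m, set r) \<in> \<Gamma>"
    and rels_auto: "\<And>f. f \<in> H \<rightarrow>\<^sub>E H \<Longrightarrow> inj_on f H \<Longrightarrow>
      (\<And>r t. r \<in> set rels \<Longrightarrow> t \<in> set r \<Longrightarrow> map f t \<in> set r) \<Longrightarrow> f \<in> automorphisms H \<Gamma>"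
    and cs: "\<And>s ts. (s, ts) \<in> set cs \<Longrightarrow> (length s, set ts) \<in> \<Gamma> \<and> set s \<subseteq> set vs"
    and K: "\<And>w x. w \<in> set vs \<Longrightarrow> K w = Some x \<Longrightarrow> x \<in> H"
begin

definition free_vars :: "bool list set" where
  "free_vars = {w \<in> set vs. K w = None}"

definition assignment :: "('a \<Rightarrow> 'a) \<Rightarrow> (bool list \<Rightarrow> 'a) \<Rightarrow> bool list \<Rightarrow> 'a" where
  "assignment \<psi> \<rho> w = (case K w of None \<Rightarrow> \<rho> w | Some x \<Rightarrow> \<psi> x)"

text \<open>These pairs correspond to the solutions of the instance without identifications, in
  coordinates that do not mention \<open>\<theta>\<close>. Every collapsed instance thus counts a
  subset of one common set, which is what inclusion and exclusion requires.\<close>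

definition copies :: "(('a \<Rightarrow> 'a) \<times> (bool list \<Rightarrow> 'a)) set" where
  "copies = {(\<psi>, \<rho>). \<psi> \<in> H \<rightarrow>\<^sub>E H \<and> \<rho> \<in> free_vars \<rightarrow>\<^sub>E H \<and>
     (\<forall>r \<in> set rels. \<forall>t \<in> set r. map \<psi> t \<in> set r) \<and>
     (\<forall>(s, ts) \<in> set cs. map (assignment \<psi> \<rho>) s \<in> set ts)}"

definition pinned_solutions :: "(bool list \<Rightarrow> 'a) set" where
  "pinned_solutions = {\<phi> \<in> set vs \<rightarrow>\<^sub>E H. (\<forall>(s, ts) \<in> set cs. map \<phi> s \<in> set ts) \<and>
     (\<forall>w \<in> set vs. \<forall>x. K w = Some x \<longrightarrow> \<phi> w = x)}"

lemma finite_copies: "finite copies"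
proof (rule finite_subset)
  show "copies \<subseteq> (H \<rightarrow>\<^sub>E H) \<times> (free_vars \<rightarrow>\<^sub>E H)" by (auto simp: copies_def)
  show "finite ((H \<rightarrow>\<^sub>E H) \<times> (free_vars \<rightarrow>\<^sub>E H))"
    using finite_H by (intro finite_cartesian_product finite_PiE) (auto simp: free_vars_def)
qed

lemma rels_tuples:
  assumes "r \<in> set rels" "t \<in> set r"
  shows "(length t, set r) \<in> \<Gamma>" "t \<in> tuples H (length t)" "set t \<subseteq> H"
proof -
  obtain m where m: "(m, set r) \<in> \<Gamma>" using rels assms(1) by blast
  then have "t \<in> tuples H m" using lang assms(2) by (fastforce simp: constraint_language_def)
  then show "(length t, set r) \<in> \<Gamma>" "t \<in> tuples H (length t)" "set t \<subseteq> H"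
    using m by (auto simp: tuples_def)
qed

lemma collapsed_instance:
  assumes "\<theta> \<in> H \<rightarrow> H"
  shows "csp_instance \<Gamma> (presented (collapsed nm hs rels K (vs, cs) \<theta>))"
proof -
  have 2: "elem_var nm (\<theta> x) \<in> (\<lambda>x. elem_var nm (\<theta> x)) ` H"
    if "r \<in> set rels" "t \<in> set r" "x \<in> set t" for r t x
    using rels_tuples(3)[OF that(1,2)] that(3) by blast
  have 3: "(length s, set ts) \<in> \<Gamma>" "set s \<subseteq> set vs" if "(s, ts) \<in> set cs" for s ts
    using cs[OF that] by auto
  show ?thesis
    unfolding csp_instance_def presented_def collapsed_def copy_constraints_def
    using rels_tuples(1) 2 3 hs by (fastforce simp: image_Un)
qed

text \<open>\<open>\<psi> x\<close> is read off at the variable of \<open>\<theta> x\<close>, so by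
  idempotence \<open>\<psi>\<close> is invariant under \<open>\<theta>\<close>; conversely,
  invariance makes the value at a shared variable independent of the element it is taken
  for.\<close>

lemma card_collapsed:
  assumes th: "\<theta> \<in> H \<rightarrow> H" "\<And>x. x \<in> H \<Longrightarrow> \<theta> (\<theta> x) = \<theta> x"
  shows "card (solutions H (presented (collapsed nm hs rels K (vs, cs) \<theta>))) =
    card {z \<in> copies. \<forall>x \<in> H. fst z (\<theta> x) = fst z x}"
proof -
  let ?V = "(\<lambda>x. elem_var nm (\<theta> x)) ` H \<union> subst_var nm K \<theta> ` set vs"
  let ?to = "\<lambda>\<phi>. (\<lambda>x \<in> H. \<phi> (elem_var nm (\<theta> x)), \<lambda>w \<in> free_vars. \<phi> (True # w))"
  \<comment> \<open>The leading bit tells a free variable from an element variable; inverting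
    \<open>nm\<close> recovers the element, which is already a representative.\<close>
  let ?from = "\<lambda>(\<psi>, \<rho>). \<lambda>z \<in> ?V. if hd z then \<rho> (tl z) else \<psi> (inv_into H nm (tl z))"
  have sol: "solutions H (presented (collapsed nm hs rels K (vs, cs) \<theta>)) = {\<phi> \<in> ?V \<rightarrow>\<^sub>E H.
      (\<forall>r \<in> set rels. \<forall>t \<in> set r. map \<phi> (map (\<lambda>x. elem_var nm (\<theta> x)) t) \<in> set r) \<and>
      (\<forall>(s, ts) \<in> set cs. map \<phi> (map (subst_var nm K \<theta>) s) \<in> set ts)}"
    unfolding collapsed_def prod.case solutions_presented
    by (simp add: copy_constraints_def hs ball_Un case_prod_beta del: map_map)
  have V: "z \<in> ?V \<longleftrightarrow> (\<exists>x \<in> H. z = elem_var nm (\<theta> x)) \<or> (\<exists>w \<in> free_vars. z = True # w)" for z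
    using K by (auto simp: subst_var_def free_vars_def split: option.splits) force+
  have inv: "inv_into H nm (nm x) = x" if "x \<in> H" for x
    using inj_nm that by simp
  have thH: "\<theta> x \<in> H" if "x \<in> H" for x using th(1) that by blast
  have agree: "map (assignment (\<lambda>x \<in> H. \<phi> (elem_var nm (\<theta> x))) (\<lambda>w \<in> free_vars. \<phi> (True # w))) s =
      map \<phi> (map (subst_var nm K \<theta>) s)" if "set s \<subseteq> set vs" for s \<phi>
    using that K by (auto simp: assignment_def subst_var_def free_vars_def split: option.splits)
  have copy: "map (\<lambda>x \<in> H. \<phi> (elem_var nm (\<theta> x))) t = map \<phi> (map (\<lambda>x. elem_var nm (\<theta> x)) t)"
    if "set t \<subseteq> H" for t \<phi>
    using that by auto
  have to: "?to \<phi> \<in> {z \<in> copies. \<forall>x \<in> H. fst z (\<theta> x) = fst z x}"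
    if "\<phi> \<in> solutions H (presented (collapsed nm hs rels K (vs, cs) \<theta>))" for \<phi>
  proof -
    have ph: "\<phi> \<in> ?V \<rightarrow>\<^sub>E H"
        "\<And>r t. r \<in> set rels \<Longrightarrow> t \<in> set r \<Longrightarrow> map \<phi> (map (\<lambda>x. elem_var nm (\<theta> x)) t) \<in> set r"
        "\<And>s ts. (s, ts) \<in> set cs \<Longrightarrow> map \<phi> (map (subst_var nm K \<theta>) s) \<in> set ts"
      using that unfolding sol by blast+
    have "\<phi> z \<in> H" if "z \<in> ?V" for z using ph(1) that by (rule PiE_mem)
    then have 1: "fst (?to \<phi>) \<in> H \<rightarrow>\<^sub>E H" "snd (?to \<phi>) \<in> free_vars \<rightarrow>\<^sub>E H"
      using V by auto
    have 2: "map (fst (?to \<phi>)) t \<in> set r" if "r \<in> set rels" "t \<in> set r" for r t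
      using ph(2)[OF that] unfolding fst_conv copy[OF rels_tuples(3)[OF that]] .
    have 3: "map (assignment (fst (?to \<phi>)) (snd (?to \<phi>))) s \<in> set ts" if "(s, ts) \<in> set cs" for s ts
      using ph(3)[OF that] unfolding fst_conv snd_conv agree[OF conjunct2[OF cs[OF that]]] .
    have 4: "fst (?to \<phi>) (\<theta> x) = fst (?to \<phi>) x" if "x \<in> H" for x
      using that thH th(2) by simp
    have "(fst (?to \<phi>), snd (?to \<phi>)) \<in> copies"
      using 1 2 3 unfolding copies_def by blast
    then show ?thesis using 4 by simp
  qed
  have from_to: "?from (?to \<phi>) = \<phi>"
    if "\<phi> \<in> solutions H (presented (collapsed nm hs rels K (vs, cs) \<theta>))" for \<phi>
  proof
    fix z
    have "\<phi> \<in> extensional ?V" using that unfolding sol by (auto simp: PiE_def)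
    then show "?from (?to \<phi>) z = \<phi> z"
    proof (cases "z \<in> ?V")
      case True
      then have R: "?from (?to \<phi>) z = (if hd z then (\<lambda>w \<in> free_vars. \<phi> (True # w)) (tl z)
          else (\<lambda>x \<in> H. \<phi> (elem_var nm (\<theta> x))) (inv_into H nm (tl z)))" by simp
      consider x where "x \<in> H" "z = elem_var nm (\<theta> x)" | w where "w \<in> free_vars" "z = True # w"
        using True V by blast
      then show ?thesis
        unfolding R by cases (simp_all add: elem_var_def inv thH th(2))
    next
      case False
      then show ?thesis using \<open>\<phi> \<in> extensional ?V\<close> by (simp add: extensional_def)
    qed
  qed
  have to_from: "?to (?from z) = z" if z: "z \<in> {z \<in> copies. \<forall>x \<in> H. fst z (\<theta> x) = fst z x}" for z
  proof -
    obtain \<psi> \<rho> where zz: "z = (\<psi>, \<rho>)" by (cases z)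
    have ext: "\<psi> \<in> extensional H" "\<rho> \<in> extensional free_vars"
      using z zz by (auto simp: copies_def PiE_def)
    have fixed: "\<psi> (\<theta> x) = \<psi> x" if "x \<in> H" for x
      using z zz that by simp
    have "?from z (elem_var nm (\<theta> x)) = \<psi> x" if x: "x \<in> H" for x
    proof -
      have "elem_var nm (\<theta> x) \<in> ?V" using x by blast
      then show ?thesis unfolding zz using fixed[OF x] inv[OF thH[OF x]] by (simp add: elem_var_def)
    qed
    moreover have "?from z (True # w) = \<rho> w" if "w \<in> free_vars" for w
    proof -
      have "True # w \<in> ?V" using V[of "True # w"] that by blast
      then show ?thesis unfolding zz by simp
    qed
    ultimately show ?thesis
      using ext zz by (auto simp: extensional_def restrict_def fun_eq_iff)
  qed
  have frm: "?from z \<in> solutions H (presented (collapsed nm hs rels K (vs, cs) \<theta>))"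
    if z: "z \<in> {z \<in> copies. \<forall>x \<in> H. fst z (\<theta> x) = fst z x}" for z
  proof -
    have zc: "fst z \<in> H \<rightarrow>\<^sub>E H" "snd z \<in> free_vars \<rightarrow>\<^sub>E H"
        "\<And>r t. r \<in> set rels \<Longrightarrow> t \<in> set r \<Longrightarrow> map (fst z) t \<in> set r"
        "\<And>s ts. (s, ts) \<in> set cs \<Longrightarrow> map (assignment (fst z) (snd z)) s \<in> set ts"
      using z by (auto simp: copies_def)
    define \<phi> where "\<phi> = ?from z"
    have "?to \<phi> = z" unfolding \<phi>_def by (rule to_from[OF z])
    from arg_cong[OF this[symmetric], of fst] arg_cong[OF this[symmetric], of snd]
    have eq: "fst z = (\<lambda>x \<in> H. \<phi> (elem_var nm (\<theta> x)))" "snd z = (\<lambda>w \<in> free_vars. \<phi> (True # w))"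
      unfolding fst_conv snd_conv .
    have "\<phi> y \<in> H" if y: "y \<in> ?V" for y
    proof -
      consider x where "x \<in> H" "y = elem_var nm (\<theta> x)" | w where "w \<in> free_vars" "y = True # w"
        using y V by blast
      then show ?thesis
      proof cases
        case 1
        then show ?thesis using PiE_mem[OF zc(1), of x] eq(1) by simp
      next
        case 2
        then show ?thesis using PiE_mem[OF zc(2), of w] eq(2) by simp
      qed
    qed
    then have "\<phi> \<in> ?V \<rightarrow>\<^sub>E H" by (auto simp: \<phi>_def split: prod.splits)
    moreover have "map \<phi> (map (\<lambda>x. elem_var nm (\<theta> x)) t) \<in> set r" if "r \<in> set rels" "t \<in> set r" for r t
      using zc(3)[OF that] unfolding eq(1) copy[OF rels_tuples(3)[OF that]] .
    moreover have "map \<phi> (map (subst_var nm K \<theta>) s) \<in> set ts" if "(s, ts) \<in> set cs" for s ts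
      using zc(4)[OF that] unfolding eq agree[OF conjunct2[OF cs[OF that]]] .
    ultimately show ?thesis unfolding sol \<phi>_def[symmetric] by blast
  qed
  have "bij_betw ?to (solutions H (presented (collapsed nm hs rels K (vs, cs) \<theta>)))
      {z \<in> copies. \<forall>x \<in> H. fst z (\<theta> x) = fst z x}"
    by (rule bij_betw_byWitness[where f' = ?from])
       (intro ballI image_subsetI from_to to_from to frm; assumption)+
  then show ?thesis by (rule bij_betw_same_card)
qed

text \<open>
  Composing a solution with an automorphism yields an injective copy, and every injective copy
  arises in this way exactly once.
\<close>

lemma card_injective_copies:
  "card {z \<in> copies. inj_on (fst z) H} = card (automorphisms H \<Gamma>) * card pinned_solutions"
proof -
  let ?to = "\<lambda>(\<alpha>, \<phi>). (\<alpha>, \<lambda>w \<in> free_vars. \<alpha> (\<phi> w))"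
  \<comment> \<open>Pinned variables regain their pins; on the free variables the automorphism is
    undone.\<close>
  let ?from = "\<lambda>(\<psi>, \<rho>). (\<psi>, \<lambda>w \<in> set vs. case K w of Some x \<Rightarrow> x | None \<Rightarrow> inv_into H \<psi> (\<rho> w))"
  have bij: "\<alpha> \<in> H \<rightarrow>\<^sub>E H" "inj_on \<alpha> H" "\<alpha> ` H = H" if "\<alpha> \<in> automorphisms H \<Gamma>" for \<alpha>
    using automorphismD(1)[OF that] by (auto simp: Bij_def bij_betw_def PiE_def)
  have scope: "map \<phi> s \<in> tuples H (length s)" if "\<phi> \<in> set vs \<rightarrow>\<^sub>E H" "(s, ts) \<in> set cs" for \<phi> s ts
    using that cs by (fastforce simp: tuples_def)
  have to: "?to (\<alpha>, \<phi>) \<in> {z \<in> copies. inj_on (fst z) H}"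
    and from_to: "?from (?to (\<alpha>, \<phi>)) = (\<alpha>, \<phi>)"
    if al: "\<alpha> \<in> automorphisms H \<Gamma>" and ph: "\<phi> \<in> pinned_solutions" for \<alpha> \<phi>
  proof -
    let ?\<rho> = "\<lambda>w \<in> free_vars. \<alpha> (\<phi> w)"
    have phi: "\<phi> \<in> set vs \<rightarrow>\<^sub>E H" "\<And>s ts. (s, ts) \<in> set cs \<Longrightarrow> map \<phi> s \<in> set ts"
        "\<And>w x. w \<in> set vs \<Longrightarrow> K w = Some x \<Longrightarrow> \<phi> w = x"
      using ph by (auto simp: pinned_solutions_def)
    have rho: "?\<rho> \<in> free_vars \<rightarrow>\<^sub>E H"
      using bij(1)[OF al] phi(1) by (auto simp: free_vars_def)
    have r: "map \<alpha> t \<in> set r" if "r \<in> set rels" "t \<in> set r" for r t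
      using automorphismD(2)[OF al rels_tuples(1,2)[OF that]] that(2) by blast
    have as: "assignment \<alpha> ?\<rho> w = \<alpha> (\<phi> w)" if "w \<in> set vs" for w
      using that phi(3)[OF that] by (auto simp: assignment_def free_vars_def split: option.splits)
    have c: "map (assignment \<alpha> ?\<rho>) s \<in> set ts" if "(s, ts) \<in> set cs" for s ts
    proof -
      have "map (assignment \<alpha> ?\<rho>) s = map \<alpha> (map \<phi> s)" using as cs[OF that] by auto
      moreover have "map \<alpha> (map \<phi> s) \<in> set ts"
        using automorphismD(2)[OF al _ scope[OF phi(1) that]] cs[OF that] phi(2)[OF that] by blast
      ultimately show ?thesis by (simp only:)
    qed
    have "(\<alpha>, ?\<rho>) \<in> copies" unfolding copies_def using bij(1)[OF al] rho r c by blast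
    then show "?to (\<alpha>, \<phi>) \<in> {z \<in> copies. inj_on (fst z) H}" using bij(2)[OF al] by simp
    have "(case K w of Some x \<Rightarrow> x | None \<Rightarrow> inv_into H \<alpha> (?\<rho> w)) = \<phi> w" if "w \<in> set vs" for w
    proof (cases "K w")
      case None
      have "\<phi> w \<in> H" using PiE_mem[OF phi(1) that] .
      then show ?thesis using None that bij(2)[OF al] by (simp add: free_vars_def)
    next
      case (Some x)
      then show ?thesis using phi(3)[OF that] by simp
    qed
    then have "(\<lambda>w \<in> set vs. case K w of Some x \<Rightarrow> x | None \<Rightarrow> inv_into H \<alpha> (?\<rho> w)) = restrict \<phi> (set vs)"
      by (rule restrict_ext)
    then show "?from (?to (\<alpha>, \<phi>)) = (\<alpha>, \<phi>)" using PiE_restrict[OF phi(1)] by simp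
  qed
  have frm: "?from (\<psi>, \<rho>) \<in> automorphisms H \<Gamma> \<times> pinned_solutions"
    and to_from: "?to (?from (\<psi>, \<rho>)) = (\<psi>, \<rho>)"
    if z: "(\<psi>, \<rho>) \<in> copies" and inj: "inj_on \<psi> H" for \<psi> \<rho>
  proof -
    let ?\<phi> = "\<lambda>w \<in> set vs. case K w of Some x \<Rightarrow> x | None \<Rightarrow> inv_into H \<psi> (\<rho> w)"
    have zc: "\<psi> \<in> H \<rightarrow>\<^sub>E H" "\<rho> \<in> free_vars \<rightarrow>\<^sub>E H"
        "\<And>r t. r \<in> set rels \<Longrightarrow> t \<in> set r \<Longrightarrow> map \<psi> t \<in> set r"
        "\<And>s ts. (s, ts) \<in> set cs \<Longrightarrow> map (assignment \<psi> \<rho>) s \<in> set ts"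
      using z by (auto simp: copies_def)
    \<comment> \<open>Here preservation of the listed relations, together with injectivity, yields
      an automorphism of all of \<open>\<Gamma>\<close>.\<close>
    have al: "\<psi> \<in> automorphisms H \<Gamma>" by (rule rels_auto[OF zc(1) inj zc(3)])
    have inv: "inv_into H \<psi> y \<in> H" "\<psi> (inv_into H \<psi> y) = y" if "y \<in> H" for y
      using that bij(3)[OF al] by (auto intro: inv_into_into f_inv_into_f)
    have rho: "\<rho> w \<in> H" if "w \<in> free_vars" for w using PiE_mem[OF zc(2) that] .
    have phi: "?\<phi> w \<in> H" "\<psi> (?\<phi> w) = assignment \<psi> \<rho> w" if "w \<in> set vs" for w
      using that K[OF that] inv[OF rho[of w]]
      by (auto simp: assignment_def free_vars_def split: option.splits)
    have c: "map ?\<phi> s \<in> set ts" if "(s, ts) \<in> set cs" for s ts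
    proof -
      have "map (assignment \<psi> \<rho>) s = map \<psi> (map ?\<phi> s)" using phi(2) cs[OF that] by auto
      then have "map \<psi> (map ?\<phi> s) \<in> set ts" using zc(4)[OF that] by (simp only:)
      moreover have "map ?\<phi> s \<in> tuples H (length s)"
        using phi(1) cs[OF that] by (intro scope[OF _ that]) auto
      \<comment> \<open>The converse half of the automorphism condition strips \<open>\<psi>\<close>
        off the constraint again.\<close>
      ultimately show ?thesis using automorphismD(2)[OF al] cs[OF that] by blast
    qed
    have "?\<phi> \<in> pinned_solutions"
      unfolding pinned_solutions_def using phi(1) c by auto
    then show "?from (\<psi>, \<rho>) \<in> automorphisms H \<Gamma> \<times> pinned_solutions" using al by simp
    have "\<psi> (?\<phi> w) = \<rho> w" if "w \<in> free_vars" for w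
      using phi(2)[of w] that by (simp add: free_vars_def assignment_def)
    then have "(\<lambda>w \<in> free_vars. \<psi> (?\<phi> w)) = restrict \<rho> free_vars" by (rule restrict_ext)
    then show "?to (?from (\<psi>, \<rho>)) = (\<psi>, \<rho>)" using PiE_restrict[OF zc(2)] by simp
  qed
  have "bij_betw ?to (automorphisms H \<Gamma> \<times> pinned_solutions) {z \<in> copies. inj_on (fst z) H}"
  proof (rule bij_betw_byWitness[where f' = ?from])
    show "\<forall>z \<in> automorphisms H \<Gamma> \<times> pinned_solutions. ?from (?to z) = z"
    proof
      fix z assume "z \<in> automorphisms H \<Gamma> \<times> pinned_solutions"
      then show "?from (?to z) = z" using from_to[of "fst z" "snd z"] by (cases z) simp
    qed
    show "?to ` (automorphisms H \<Gamma> \<times> pinned_solutions) \<subseteq> {z \<in> copies. inj_on (fst z) H}"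
    proof (rule image_subsetI)
      fix z assume "z \<in> automorphisms H \<Gamma> \<times> pinned_solutions"
      then show "?to z \<in> {z \<in> copies. inj_on (fst z) H}" using to[of "fst z" "snd z"] by (cases z) simp
    qed
    show "\<forall>z \<in> {z \<in> copies. inj_on (fst z) H}. ?to (?from z) = z"
    proof
      fix z assume "z \<in> {z \<in> copies. inj_on (fst z) H}"
      then show "?to (?from z) = z" using to_from[of "fst z" "snd z"] by (cases z) simp
    qed
    show "?from ` {z \<in> copies. inj_on (fst z) H} \<subseteq> automorphisms H \<Gamma> \<times> pinned_solutions"
    proof (rule image_subsetI)
      fix z assume "z \<in> {z \<in> copies. inj_on (fst z) H}"
      then show "?from z \<in> automorphisms H \<Gamma> \<times> pinned_solutions"
        using frm[of "fst z" "snd z"] by (cases z) simp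
    qed
  qed
  then show ?thesis using bij_betw_same_card by (fastforce simp: card_cartesian_product)
qed

text \<open>The identity holds in the integers; it is only the division by the number of
  automorphisms that takes place modulo \<open>p\<close>.\<close>

lemma sum_collapsed:
  assumes "\<And>S. S \<in> Pow (distinct_pairs H) \<Longrightarrow> collapses H S (\<theta> S)"
  shows "(\<Sum>S \<in> Pow (distinct_pairs H). (- 1) ^ card S *
      int (card (solutions H (presented (collapsed nm hs rels K (vs, cs) (\<theta> S)))))) =
    int (card (automorphisms H \<Gamma>)) * int (card pinned_solutions)"
proof -
  have "card (solutions H (presented (collapsed nm hs rels K (vs, cs) (\<theta> S)))) =
      card {z \<in> copies. \<forall>(x, y) \<in> S. fst z x = fst z y}" if "S \<in> Pow (distinct_pairs H)" for S
  proof -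
    have "\<theta> S \<in> H \<rightarrow> H" "\<And>x. x \<in> H \<Longrightarrow> \<theta> S (\<theta> S x) = \<theta> S x"
      and eq: "\<And>\<psi> :: 'a \<Rightarrow> 'a. (\<forall>(x, y) \<in> S. \<psi> x = \<psi> y) \<longleftrightarrow> (\<forall>x \<in> H. \<psi> (\<theta> S x) = \<psi> x)"
      using assms[OF that] by (simp_all add: collapses_def)
    then show ?thesis unfolding eq by (intro card_collapsed)
  qed
  then have "(\<Sum>S \<in> Pow (distinct_pairs H). (- 1) ^ card S *
      int (card (solutions H (presented (collapsed nm hs rels K (vs, cs) (\<theta> S)))))) =
    (\<Sum>S \<in> Pow (distinct_pairs H). (- 1) ^ card S *
      int (card {z \<in> copies. \<forall>(x, y) \<in> S. fst z x = fst z y}))"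
    by (intro sum.cong) simp_all
  then show ?thesis
    by (simp add: sum_card_identifications[OF finite_H finite_copies] card_injective_copies)
qed

end

section \<open>Multi-stack machines\<close>

definition top_symbol :: "'b list \<Rightarrow> 'b option" where
  "top_symbol s = (case s of [] \<Rightarrow> None | x # _ \<Rightarrow> Some x)"

lemma top_symbol_simps [simp]:
  "top_symbol [] = None" "top_symbol (x # s) = Some x"
  by (simp_all add: top_symbol_def)

text \<open>Mirrors the convention by which oracle queries and outputs are read off a tape, up to
  the first cell without a letter.\<close>

definition stack_word :: "(letter + 'g) list \<Rightarrow> word" where
  "stack_word s = map projl (takeWhile isl s)"

lemma stack_word_map_Inl [simp]: "stack_word (map Inl w) = w"
  by (induction w) (simp_all add: stack_word_def)

text \<open>
  A step replaces the top symbol of every stack by a word, as in a pushdown automaton; the empty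
  word pops.
\<close>

definition stack_step ::
    "'s \<Rightarrow> 's \<Rightarrow> 's \<Rightarrow> ('s \<Rightarrow> (letter + 'g) option list \<Rightarrow> 's \<times> (letter + 'g) list list) \<Rightarrow>
     (word \<Rightarrow> word) \<Rightarrow> 's \<times> (letter + 'g) list list \<Rightarrow> 's \<times> (letter + 'g) list list" where
  "stack_step halt query answer delta f = (\<lambda>(q, ss).
     if q = halt then (q, ss)
     else if q = query then (answer, ss[1 := map Inl (f (stack_word (ss ! 1)))])
     else (case delta q (map top_symbol ss) of (q', ws) \<Rightarrow> (q', map2 (\<lambda>w s. w @ tl s) ws ss)))"

lemma finite_letter: "finite (UNIV :: letter set)"
proof -
  have "UNIV = {Zero, One, Lpar, Rpar}"
    using letter.exhaust by blast
  then show ?thesis by (metis finite.emptyI finite.insertI)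
qed

abbreviation symbols :: "'g set \<Rightarrow> (letter + 'g) set" where
  "symbols G \<equiv> Sum_Type.Plus UNIV G"

locale stack_machine =
  fixes k :: nat and Q :: "'s set" and G :: "'g set"
    and start halt query answer :: 's
    and delta :: "'s \<Rightarrow> (letter + 'g) option list \<Rightarrow> 's \<times> (letter + 'g) list list"
  assumes two_stacks: "2 \<le> k"
    and finite_Q: "finite Q"
    and finite_G: "finite G"
    and special_states: "{start, halt, query, answer} \<subseteq> Q"
    and delta_closed: "\<And>q cs q' ws. q \<in> Q \<Longrightarrow> length cs = k \<Longrightarrow>
      set cs \<subseteq> insert None (Some ` symbols G) \<Longrightarrow> delta q cs = (q', ws) \<Longrightarrow>
      q' \<in> Q \<and> length ws = k \<and> (\<forall>w \<in> set ws. set w \<subseteq> symbols G)"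
begin

abbreviation syms :: "(letter + 'g) set" where
  "syms \<equiv> symbols G"

lemma finite_syms: "finite syms"
  using finite_letter finite_G by simp

abbreviation inputs :: "(letter + 'g) option list set" where
  "inputs \<equiv> {cs. set cs \<subseteq> insert None (Some ` syms) \<and> length cs = k}"

lemma finite_inputs: "finite inputs"
  using finite_syms by (intro finite_lists_length_eq) simp

lemma ex_word_bound:
  "\<exists>b. \<forall>q \<in> Q. \<forall>cs \<in> inputs. \<forall>w \<in> set (snd (delta q cs)). length w \<le> b"
proof -
  define L where "L = length ` (\<Union>(q, cs) \<in> Q \<times> inputs. set (snd (delta q cs)))"
  have "finite L"
    unfolding L_def using finite_Q finite_inputs
    by (intro finite_imageI finite_UN_I finite_cartesian_product) auto
  then have "length w \<le> Max L" if "q \<in> Q" "cs \<in> inputs" "w \<in> set (snd (delta q cs))" for q cs w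
    using that by (intro Max_ge) (auto simp: L_def)
  then show ?thesis by blast
qed

text \<open>Finitely many states and top symbols bound the number of symbols pushed in a step. The
  bound limits the pending words, which keeps the states of the Turing machine finite in number, and
  the slowdown of the simulation.\<close>

definition word_bound :: nat where
  "word_bound = (SOME b. \<forall>q \<in> Q. \<forall>cs \<in> inputs. \<forall>w \<in> set (snd (delta q cs)). length w \<le> b)"

lemma word_bound:
  "q \<in> Q \<Longrightarrow> cs \<in> inputs \<Longrightarrow> w \<in> set (snd (delta q cs)) \<Longrightarrow> length w \<le> word_bound"
  using someI_ex[OF ex_word_bound] unfolding word_bound_def by blast

definition sym_index :: "'g \<Rightarrow> nat" where
  "sym_index = (SOME h. bij_betw h G {0..<card G})"

lemma sym_index: "bij_betw sym_index G {0..<card G}"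
  unfolding sym_index_def by (rule someI_ex[OF ex_bij_betw_finite_nat[OF finite_G]])

fun sym_cell :: "letter + 'g \<Rightarrow> cell" where
  "sym_cell (Inl l) = Letter l"
| "sym_cell (Inr g) = Work (sym_index g)"

fun cell_sym :: "cell \<Rightarrow> (letter + 'g) option" where
  "cell_sym Blank = None"
| "cell_sym (Letter l) = Some (Inl l)"
| "cell_sym (Work n) = Some (Inr (inv_into G sym_index n))"

lemma cell_sym_sym_cell: "s \<in> syms \<Longrightarrow> cell_sym (sym_cell s) = Some s"
  using sym_index by (auto simp: bij_betw_def)

text \<open>
  A machine state carries, for every stack, the symbols that are still to be pushed onto it.
\<close>

definition pending :: "(letter + 'g) list list set" where
  "pending = {us. set us \<subseteq> {u. set u \<subseteq> syms \<and> length u \<le> word_bound} \<and> length us = k}"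

abbreviation idle :: "(letter + 'g) list list" where
  "idle \<equiv> replicate k []"

lemma finite_pending: "finite pending"
  unfolding pending_def
  by (intro finite_lists_length_eq finite_lists_length_le finite_syms)

lemma idle_pending: "idle \<in> pending"
  by (auto simp: pending_def)

lemma finite_states: "finite (Q \<times> pending)"
  using finite_Q finite_pending by blast

definition state_index :: "'s \<times> (letter + 'g) list list \<Rightarrow> nat" where
  "state_index = (SOME h. bij_betw h (Q \<times> pending) {0..<card (Q \<times> pending)})"

lemma state_index: "bij_betw state_index (Q \<times> pending) {0..<card (Q \<times> pending)}"
  unfolding state_index_def by (rule someI_ex[OF ex_bij_betw_finite_nat[OF finite_states]])

definition state_of :: "nat \<Rightarrow> 's \<times> (letter + 'g) list list" where
  "state_of = inv_into (Q \<times> pending) state_index"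

lemma state_of_index: "z \<in> Q \<times> pending \<Longrightarrow> state_of (state_index z) = z"
  using state_index by (simp add: state_of_def bij_betw_def)

lemma state_index_less: "z \<in> Q \<times> pending \<Longrightarrow> state_index z < card (Q \<times> pending)"
  using state_index by (fastforce simp: bij_betw_def)

lemma state_of_mem: "n < card (Q \<times> pending) \<Longrightarrow> state_of n \<in> Q \<times> pending"
  unfolding state_of_def using state_index by (intro inv_into_into) (simp add: bij_betw_def)

text \<open>The head stands on the cell meant for the deepest pending symbol. Stacks grow to the
  left, so the head moves left to make room, unless this symbol completes the word.\<close>

definition put :: "(letter + 'g) list \<Rightarrow> cell \<times> dir" where
  "put u = (sym_cell (last u), if length u = 1 then Stay else Go_Left)"

text \<open>The first symbol written overwrites the popped top, so popping and pushing share a move.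
  Popping an empty stack merely takes the head further into the blanks.\<close>

definition replace_action :: "(letter + 'g) list \<Rightarrow> cell \<times> dir" where
  "replace_action u = (if u = [] then (Blank, Go_Right) else put u)"

definition push_action :: "(letter + 'g) list \<Rightarrow> cell \<Rightarrow> cell \<times> dir" where
  "push_action u c = (if u = [] then (c, Stay) else put u)"

text \<open>An idle state starts a step of the stack machine; any other state writes one pending
  symbol on every tape that still has one, without consulting \<open>delta\<close>.\<close>

definition tm_transition :: "nat \<Rightarrow> cell list \<Rightarrow> nat \<times> (cell \<times> dir) list" where
  "tm_transition n cs = (case state_of n of (q, us) \<Rightarrow>
     if us = idle then
       (case delta q (map cell_sym cs) of (q', ws) \<Rightarrow>
         (state_index (q', map butlast ws), map replace_action ws))
     else (state_index (q, map butlast us), map2 push_action us cs))"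

definition tm :: oracle_tm where
  "tm = \<lparr>num_tapes = k, num_work_symbols = card G, num_states = card (Q \<times> pending),
     start_state = state_index (start, idle), halt_state = state_index (halt, idle),
     query_state = state_index (query, idle), answer_state = state_index (answer, idle),
     transition = tm_transition\<rparr>"

lemma tm_simps [simp]:
  "num_tapes tm = k" "num_work_symbols tm = card G" "num_states tm = card (Q \<times> pending)"
  "start_state tm = state_index (start, idle)" "halt_state tm = state_index (halt, idle)"
  "query_state tm = state_index (query, idle)" "answer_state tm = state_index (answer, idle)"
  "transition tm = tm_transition"
  by (simp_all add: tm_def)

lemma sym_cell_alphabet: "s \<in> syms \<Longrightarrow> sym_cell s \<in> tape_alphabet tm"
  using sym_index by (fastforce simp: tape_alphabet_def bij_betw_def)

lemma cell_sym_alphabet: "c \<in> tape_alphabet tm \<Longrightarrow> cell_sym c \<in> insert None (Some ` syms)"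
proof -
  have "inv_into G sym_index n \<in> G" if "n < card G" for n
    using sym_index that by (intro inv_into_into) (simp add: bij_betw_def)
  then show "c \<in> tape_alphabet tm \<Longrightarrow> cell_sym c \<in> insert None (Some ` syms)"
    by (auto simp: tape_alphabet_def)
qed

lemma butlast_pending:
  assumes "us \<in> pending"
  shows "map butlast us \<in> pending"
proof -
  have "set (butlast u) \<subseteq> syms" "length (butlast u) \<le> word_bound" if "u \<in> set us" for u
  proof -
    have "set u \<subseteq> syms" "length u \<le> word_bound"
      using assms that unfolding pending_def by blast+
    then show "set (butlast u) \<subseteq> syms" "length (butlast u) \<le> word_bound"
      by (auto dest: in_set_butlastD)
  qed
  moreover have "length us = k" using assms by (simp add: pending_def)
  ultimately show ?thesis by (simp add: pending_def image_subset_iff)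
qed

lemma delta_pending:
  assumes "q \<in> Q" "cs \<in> inputs" "delta q cs = (q', ws)"
  shows "q' \<in> Q" "ws \<in> pending"
  using delta_closed[of q cs q' ws] word_bound[of q cs] assms by (auto simp: pending_def)

lemma put_alphabet: "set u \<subseteq> syms \<Longrightarrow> u \<noteq> [] \<Longrightarrow> fst (put u) \<in> tape_alphabet tm"
  using sym_cell_alphabet[of "last u"] last_in_set[of u] by (simp add: put_def subset_iff)

lemma valid_tm: "valid_tm tm"
  unfolding valid_tm_def
proof (intro conjI allI impI)
  show "2 \<le> num_tapes tm" using two_stacks by simp
  show "{start_state tm, halt_state tm, query_state tm, answer_state tm} \<subseteq> {..<num_states tm}"
    using special_states idle_pending by (auto intro!: state_index_less simp del: card_cartesian_product)
  fix n cs
  assume n: "n < num_states tm" and cs: "length cs = num_tapes tm \<and> set cs \<subseteq> tape_alphabet tm"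
  obtain q us where z: "state_of n = (q, us)" by (cases "state_of n")
  have mem: "q \<in> Q" "us \<in> pending"
    using state_of_mem[of n] n z by (auto simp del: card_cartesian_product)
  obtain q' ws where d: "delta q (map cell_sym cs) = (q', ws)" by (cases "delta q (map cell_sym cs)")
  have inp: "map cell_sym cs \<in> inputs"
    using cs cell_sym_alphabet by auto
  note dp = delta_pending[OF mem(1) inp d]
  have blank: "Blank \<in> tape_alphabet tm" by (simp add: tape_alphabet_def)
  show "case transition tm n cs of (q', as) \<Rightarrow> q' < num_states tm \<and>
      length as = num_tapes tm \<and> fst ` set as \<subseteq> tape_alphabet tm"
  proof (cases "us = idle")
    case True
    have "fst (replace_action u) \<in> tape_alphabet tm" if "u \<in> set ws" for u
      using put_alphabet[of u] dp(2) that blank by (auto simp: replace_action_def pending_def)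
    moreover have "length ws = k" using dp(2) by (simp add: pending_def)
    ultimately show ?thesis
      using True z d dp butlast_pending[OF dp(2)] state_index_less[of "(q', map butlast ws)"]
      by (auto simp: tm_transition_def simp del: card_cartesian_product)
  next
    case False
    have "fst (push_action u c) \<in> tape_alphabet tm" if "u \<in> set us" "c \<in> set cs" for u c
      using put_alphabet[of u] mem(2) that cs by (auto simp: push_action_def pending_def)
    then have "fst ` set (map2 push_action us cs) \<subseteq> tape_alphabet tm"
      unfolding set_map image_image
      by (intro image_subsetI) (metis case_prod_unfold in_set_zipE prod.collapse)
    moreover have "length us = k" using mem(2) by (simp add: pending_def)
    ultimately show ?thesis
      using False z mem cs butlast_pending[OF mem(2)] state_index_less[of "(q, map butlast us)"]
      by (simp add: tm_transition_def del: card_cartesian_product)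
  qed
qed

section \<open>Stacks on tapes and the simulation\<close>

definition holds :: "tape \<Rightarrow> (letter + 'g) list \<Rightarrow> bool" where
  "holds t s \<longleftrightarrow> set s \<subseteq> syms \<and> (\<exists>j. snd t = map sym_cell s @ replicate j Blank)"

text \<open>\<open>s\<close> is the stack to be reached. While \<open>u\<close> is pending, the cell
  under the head is scratch and only the cells to its right are specified. The cells to the left are
  never constrained, as they are overwritten before they count.\<close>

definition awaits :: "(letter + 'g) list \<Rightarrow> tape \<Rightarrow> (letter + 'g) list \<Rightarrow> bool" where
  "awaits u t s \<longleftrightarrow> (if u = [] then holds t s else
     set s \<subseteq> syms \<and> (\<exists>s' j. s = u @ s' \<and> tl (snd t) = map sym_cell s' @ replicate j Blank))"

lemma cell_sym_head: "holds t s \<Longrightarrow> cell_sym (head t) = top_symbol s"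
proof (cases t)
  case (Pair l r)
  then show "holds t s \<Longrightarrow> cell_sym (head t) = top_symbol s"
    by (cases s; cases r) (auto simp: holds_def cell_sym_sym_cell Cons_replicate_eq)
qed

lemma put_awaits:
  assumes "awaits u t s" "u \<noteq> []"
  shows "awaits (butlast u) ((\<lambda>(c, d) t. move_head d (write_cell c t)) (put u) t) s"
proof -
  obtain l r where t: "t = (l, r)" by (cases t)
  obtain v c where u: "u = v @ [c]" using assms(2) by (metis append_butlast_last_id)
  obtain s' j where s: "set s \<subseteq> syms" "s = v @ c # s'" "tl r = map sym_cell s' @ replicate j Blank"
    using assms t u by (auto simp: awaits_def)
  show ?thesis
  proof (cases "v = []")
    case True
    then show ?thesis using s t u by (auto simp: awaits_def put_def holds_def)
  next
    case False
    have "tl (snd (move_head Go_Left (l, sym_cell c # tl r))) = sym_cell c # tl r"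
      by (cases l) auto
    then show ?thesis using False s t u
      by (auto simp: awaits_def put_def intro!: exI[of _ "c # s'"])
  qed
qed

lemma push_awaits:
  assumes "awaits u t s"
  shows "awaits (butlast u) ((\<lambda>(c, d) t. move_head d (write_cell c t)) (push_action u (head t)) t) s"
proof (cases "u = []")
  case True
  obtain l r where t: "t = (l, r)" by (cases t)
  have "\<exists>j. head (l, r) # tl r = map sym_cell s @ replicate j Blank"
    if "r = map sym_cell s @ replicate j Blank" for j
  proof (cases r)
    case Nil
    \<comment> \<open>Writing back the blank that was read creates an explicit blank cell, which the
      trailing blanks in \<open>holds\<close> absorb.\<close>
    then show ?thesis using that by (auto intro!: exI[of _ 1])
  next
    case (Cons c r')
    then have "head (l, r) # tl r = r" by simp
    then show ?thesis using that by metis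
  qed
  then show ?thesis using True assms t by (auto simp: awaits_def push_action_def holds_def)
next
  case False
  then show ?thesis using put_awaits[OF assms] by (simp add: push_action_def)
qed

lemma replace_awaits:
  assumes "holds t s" "set u \<subseteq> syms"
  shows "awaits (butlast u) ((\<lambda>(c, d) t. move_head d (write_cell c t)) (replace_action u) t) (u @ tl s)"
proof -
  obtain l r where t: "t = (l, r)" by (cases t)
  obtain j where r: "r = map sym_cell s @ replicate j Blank" "set s \<subseteq> syms"
    using assms(1) t by (auto simp: holds_def)
  have tl: "\<exists>j. tl r = map sym_cell (tl s) @ replicate j Blank"
    using r by (cases s) auto
  have sub: "set (u @ tl s) \<subseteq> syms"
    using assms(2) r(2) by (cases s) auto
  show ?thesis
  proof (cases "u = []")
    case True
    then show ?thesis using tl sub t by (simp add: awaits_def replace_action_def holds_def)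
  next
    case False
    then have "awaits u t (u @ tl s)" using tl sub t by (auto simp: awaits_def)
    then show ?thesis using put_awaits[OF _ False] False by (simp add: replace_action_def)
  qed
qed

abbreviation sstep where
  "sstep \<equiv> stack_step halt query answer delta"

text \<open>Every step shortens all nonempty pending words at once, so the longest of them
  determines the time.\<close>

lemma pending_run:
  assumes "q \<in> Q" "us \<in> pending" "list_all2 (\<lambda>(u, t) s. awaits u t s) (zip us ts) ss"
    "length ts = k" "\<forall>u \<in> set us. length u \<le> m"
  shows "\<exists>n \<le> m. \<exists>ts'. (tm_step f tm ^^ n) (state_index (q, us), ts) = (state_index (q, idle), ts') \<and>
    list_all2 holds ts' ss"
  using assms
proof (induction m arbitrary: us ts)
  case 0
  then have "us = idle"
    by (simp add: pending_def replicate_eqI)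
  then have "list_all2 holds ts ss"
    using 0(3,4) by (auto simp: list_all2_conv_all_nth awaits_def)
  then show ?case using \<open>us = idle\<close> by auto
next
  case (Suc m)
  have len: "length us = k" using Suc.prems(2) by (simp add: pending_def)
  show ?case
  proof (cases "us = idle")
    case True
    then have "list_all2 holds ts ss"
      using Suc.prems(3,4) by (auto simp: list_all2_conv_all_nth awaits_def)
    then show ?thesis using True by (intro exI[of _ 0]) auto
  next
    case False
    define ts1 where "ts1 = map2 (\<lambda>(c, d) t. move_head d (write_cell c t)) (map2 push_action us (map head ts)) ts"
    \<comment> \<open>The halting and query states of the Turing machine are idle, so neither can be
      met while symbols are pending, even if \<open>q\<close> is \<open>halt\<close> or
      \<open>query\<close>.\<close>
    have neq: "state_index (q, us) \<noteq> state_index (q', idle)" if "q' \<in> Q" for q'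
      using state_of_index[of "(q, us)"] state_of_index[of "(q', idle)"] Suc.prems(1,2) False idle_pending that
      by auto
    have step: "tm_step f tm (state_index (q, us), ts) = (state_index (q, map butlast us), ts1)"
      using neq[of halt] neq[of query] special_states False state_of_index[of "(q, us)"] Suc.prems(1,2)
      by (simp add: tm_step_def tm_transition_def ts1_def)
    have aw: "list_all2 (\<lambda>(u, t) s. awaits u t s) (zip (map butlast us) ts1) ss"
    proof -
      have "awaits (butlast (us ! i)) (ts1 ! i) (ss ! i)" if "i < k" for i
        using that push_awaits[of "us ! i" "ts ! i" "ss ! i"] Suc.prems(3,4) len
        by (simp add: ts1_def list_all2_conv_all_nth)
      then show ?thesis using Suc.prems(3,4) len by (simp add: list_all2_conv_all_nth ts1_def)
    qed
    have "\<exists>n \<le> m. \<exists>ts'. (tm_step f tm ^^ n) (state_index (q, map butlast us), ts1)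
        = (state_index (q, idle), ts') \<and> list_all2 holds ts' ss"
    proof (rule Suc.IH[OF Suc.prems(1) butlast_pending[OF Suc.prems(2)] aw])
      show "length ts1 = k" using Suc.prems(4) len by (simp add: ts1_def)
      show "\<forall>u \<in> set (map butlast us). length u \<le> m" using Suc.prems(5) by auto
    qed
    then obtain n ts' where n: "n \<le> m" "(tm_step f tm ^^ n) (state_index (q, map butlast us), ts1)
        = (state_index (q, idle), ts')" "list_all2 holds ts' ss" by blast
    then have "(tm_step f tm ^^ Suc n) (state_index (q, us), ts) = (state_index (q, idle), ts')"
      using step by (simp only: funpow_Suc_right o_apply)
    then show ?thesis using n by (intro exI[of _ "Suc n"]) auto
  qed
qed

lemma letters_map_sym_cell:
  "letters (map sym_cell s @ replicate j Blank) = stack_word s"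
proof (induction s)
  case Nil
  then show ?case by (cases j) (simp_all add: stack_word_def)
next
  case (Cons x s)
  then show ?case by (cases x) (simp_all add: stack_word_def)
qed

lemma word_at_head_holds: "holds t s \<Longrightarrow> word_at_head t = stack_word s"
  by (auto simp: holds_def word_at_head_def letters_map_sym_cell)

lemma holds_word_tape: "holds (word_tape w) (map Inl w)"
  by (auto simp: holds_def word_tape_def intro: exI[of _ 0])

text \<open>One step pops and writes the first symbols, and at most \<open>word_bound\<close>
  further steps complete the words. A query takes a single step on both sides.\<close>

lemma simulate_step:
  assumes "q \<in> Q" "list_all2 holds ts ss" "length ss = k" "sstep f (q, ss) = (q', ss')"
  shows "\<exists>n \<le> Suc word_bound. \<exists>ts'. (tm_step f tm ^^ n) (state_index (q, idle), ts) =
      (state_index (q', idle), ts') \<and> list_all2 holds ts' ss' \<and> q' \<in> Q \<and> length ss' = k"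
proof -
  have len: "length ts = k" using assms(2,3) by (simp add: list_all2_lengthD)
  have eq_iff: "state_index (q, idle) = state_index (r, idle) \<longleftrightarrow> q = r" if "r \<in> Q" for r
    using inj_on_eq_iff[OF bij_betw_imp_inj_on[OF state_index], of "(q, idle)" "(r, idle)"]
      assms(1) idle_pending that by simp
  show ?thesis
  proof (cases "q = halt")
    case True
    then have "sstep f (q, ss) = (q, ss)" by (simp add: stack_step_def)
    then have "q' = q" "ss' = ss" using assms(4) by auto
    then show ?thesis using assms(1-3) by (intro exI[of _ 0]) simp
  next
    case nh: False
    show ?thesis
    proof (cases "q = query")
      case True
      have k1: "1 < k" using two_stacks by simp
      have w: "word_at_head (ts ! 1) = stack_word (ss ! 1)"
        using assms(2) k1 len by (intro word_at_head_holds) (simp add: list_all2_nthD)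
      have "tm_step f tm (state_index (q, idle), ts) =
          (state_index (answer, idle), ts[1 := word_tape (f (stack_word (ss ! 1)))])"
        using True nh eq_iff[of halt] special_states w by (simp add: tm_step_def)
      moreover have "list_all2 holds (ts[1 := word_tape (f (stack_word (ss ! 1)))])
          (ss[1 := map Inl (f (stack_word (ss ! 1)))])"
        using assms(2) holds_word_tape by (intro list_all2_update_cong) auto
      moreover have "sstep f (q, ss) = (answer, ss[1 := map Inl (f (stack_word (ss ! 1)))])"
        using True nh by (simp add: stack_step_def)
      then have "q' = answer" "ss' = ss[1 := map Inl (f (stack_word (ss ! 1)))]"
        using assms(4) by auto
      ultimately show ?thesis
        using assms(3) special_states by (intro exI[of _ 1] conjI) simp_all
    next
      case nq: False
      have sets: "set s \<subseteq> syms" if s: "s \<in> set ss" for s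
      proof -
        obtain i where "i < length ss" "s = ss ! i" using s by (metis in_set_conv_nth)
        then have "holds (ts ! i) s" using assms(2) by (simp add: list_all2_conv_all_nth)
        then show ?thesis by (simp add: holds_def)
      qed
      have tops: "map cell_sym (map head ts) = map top_symbol ss"
      proof (rule nth_equalityI)
        show "length (map cell_sym (map head ts)) = length (map top_symbol ss)"
          using len assms(3) by simp
        fix i assume "i < length (map cell_sym (map head ts))"
        then show "map cell_sym (map head ts) ! i = map top_symbol ss ! i"
          using assms(2,3) len cell_sym_head[of "ts ! i" "ss ! i"] by (simp add: list_all2_conv_all_nth)
      qed
      have inp: "map top_symbol ss \<in> inputs"
      proof -
        have "top_symbol s \<in> insert None (Some ` syms)" if "s \<in> set ss" for s
          using sets[OF that] by (cases s) auto
        then show ?thesis using assms(3) by auto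
      qed
      obtain ws where d: "delta q (map top_symbol ss) = (q', ws)" and ss': "ss' = map2 (\<lambda>w s. w @ tl s) ws ss"
        using assms(4) nh nq by (auto simp: stack_step_def split: prod.splits)
      note dp = delta_pending[OF assms(1) inp d]
      have lw: "length ws = k" using dp(2) by (simp add: pending_def)
      define ts1 where "ts1 = map2 (\<lambda>(c, d) t. move_head d (write_cell c t)) (map replace_action ws) ts"
      have step: "tm_step f tm (state_index (q, idle), ts) = (state_index (q', map butlast ws), ts1)"
        using nh nq eq_iff[of halt] eq_iff[of query] special_states state_of_index[of "(q, idle)"]
          assms(1) idle_pending d tops
        by (simp add: tm_step_def tm_transition_def ts1_def)
      have aw: "list_all2 (\<lambda>(u, t) s. awaits u t s) (zip (map butlast ws) ts1) ss'"
      proof -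
        have "awaits (butlast (ws ! i)) (ts1 ! i) (ss' ! i)" if "i < k" for i
        proof -
          have "ws ! i \<in> set ws" using that lw by simp
          then have "set (ws ! i) \<subseteq> syms" using dp(2) unfolding pending_def by blast
          then show ?thesis
            using that replace_awaits[of "ts ! i" "ss ! i" "ws ! i"] assms(2,3) lw len
            by (simp add: ts1_def ss' list_all2_conv_all_nth)
        qed
        then show ?thesis using lw len assms(3)
          by (simp add: list_all2_conv_all_nth ts1_def ss')
      qed
      have "\<exists>n \<le> word_bound. \<exists>ts'. (tm_step f tm ^^ n) (state_index (q', map butlast ws), ts1)
          = (state_index (q', idle), ts') \<and> list_all2 holds ts' ss'"
      proof (rule pending_run[OF dp(1) butlast_pending[OF dp(2)] aw])
        show "length ts1 = k" using len lw by (simp add: ts1_def)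
        show "\<forall>u \<in> set (map butlast ws). length u \<le> word_bound"
          using butlast_pending[OF dp(2)] unfolding pending_def by blast
      qed
      then obtain n ts' where n: "n \<le> word_bound" "(tm_step f tm ^^ n) (state_index (q', map butlast ws), ts1)
          = (state_index (q', idle), ts')" "list_all2 holds ts' ss'" by blast
      then have "(tm_step f tm ^^ Suc n) (state_index (q, idle), ts) = (state_index (q', idle), ts')"
        using step by (simp only: funpow_Suc_right o_apply)
      moreover have "length ss' = k" using lw assms(3) by (simp add: ss')
      ultimately show ?thesis using n dp(1) by (intro exI[of _ "Suc n"] conjI) auto
    qed
  qed
qed

lemma simulate_run:
  assumes "q \<in> Q" "list_all2 holds ts ss" "length ss = k" "(sstep f ^^ m) (q, ss) = (q', ss')"
  shows "\<exists>n \<le> Suc word_bound * m. \<exists>ts'. (tm_step f tm ^^ n) (state_index (q, idle), ts) =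
      (state_index (q', idle), ts') \<and> list_all2 holds ts' ss' \<and> length ss' = k"
  using assms
proof (induction m arbitrary: q ts ss)
  case 0
  then show ?case by auto
next
  case (Suc m)
  obtain q1 ss1 where s1: "sstep f (q, ss) = (q1, ss1)" by (cases "sstep f (q, ss)")
  from simulate_step[OF Suc.prems(1-3) s1] obtain n1 ts1 where 1: "n1 \<le> Suc word_bound"
    "(tm_step f tm ^^ n1) (state_index (q, idle), ts) = (state_index (q1, idle), ts1)"
    "list_all2 holds ts1 ss1" "q1 \<in> Q" "length ss1 = k" by blast
  have "(sstep f ^^ m) (q1, ss1) = (q', ss')"
    using Suc.prems(4) s1 by (simp only: funpow_Suc_right o_apply)
  from Suc.IH[OF 1(4,3,5) this] obtain n2 ts2 where 2: "n2 \<le> Suc word_bound * m"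
    "(tm_step f tm ^^ n2) (state_index (q1, idle), ts1) = (state_index (q', idle), ts2)"
    "list_all2 holds ts2 ss'" "length ss' = k" by blast
  have "(tm_step f tm ^^ (n2 + n1)) (state_index (q, idle), ts) = (state_index (q', idle), ts2)"
    using 1(2) 2(2) by (simp add: funpow_add)
  moreover have "n2 + n1 \<le> Suc word_bound * Suc m" using 1(1) 2(1) by simp
  ultimately show ?case using 2(3,4) by blast
qed

text \<open>The slowdown is the constant factor \<open>Suc word_bound\<close>, so a polynomial bound
  for the stack machine suffices.\<close>

theorem poly_time_reducible_stack:
  fixes P :: "nat poly"
  assumes "\<And>f x y. solves f B \<Longrightarrow> (x, y) \<in> A \<Longrightarrow>
    \<exists>n \<le> poly P (length x). \<exists>ss. (sstep f ^^ n) (start, map Inl x # replicate (k - 1) []) = (halt, ss) \<and>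
      stack_word (ss ! 0) = y"
  shows "poly_time_reducible A B"
  unfolding poly_time_reducible_def
proof (intro exI conjI allI impI ballI)
  show "valid_tm tm" by (rule valid_tm)
  fix f z
  assume f: "solves f B" and "z \<in> A"
  then obtain x y where z: "z = (x, y)" "(x, y) \<in> A" by (cases z) auto
  obtain n ss where n: "n \<le> poly P (length x)"
    "(sstep f ^^ n) (start, map Inl x # replicate (k - 1) []) = (halt, ss)" "stack_word (ss ! 0) = y"
    using assms[OF f z(2)] by blast
  have hold: "list_all2 holds (word_tape x # replicate (k - 1) (word_tape [])) (map Inl x # replicate (k - 1) [])"
    using holds_word_tape[of x] holds_word_tape[of "[]"]
    by (simp add: list_all2_conv_all_nth[of _ "replicate _ _"])
  have "length (map Inl x # replicate (k - 1) []) = k" using two_stacks by simp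
  moreover have "start \<in> Q" using special_states by simp
  ultimately obtain m ts where m: "m \<le> Suc word_bound * n"
    "(tm_step f tm ^^ m) (initial_config tm x) = (state_index (halt, idle), ts)" "list_all2 holds ts ss" "length ss = k"
    using simulate_run[OF _ hold _ n(2)] unfolding initial_config_def tm_simps by blast
  have "0 < length ts" "0 < length ss"
    using m(3,4) two_stacks by (simp_all add: list_all2_lengthD)
  then have out: "word_at_head (ts ! 0) = y"
    using word_at_head_holds[of "ts ! 0" "ss ! 0"] m(3) n(3) by (simp add: list_all2_nthD)
  have "m \<le> poly (smult (Suc word_bound) P) (length x)"
    using m(1) mult_le_mono2[OF n(1), of "Suc word_bound"] by simp
  then show "case z of (x, y) \<Rightarrow> outputs_within f tm x y (poly (smult (Suc word_bound) P) (length x))"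
    unfolding z(1) outputs_within_def prod.case
    by (intro exI[of _ m] conjI) (simp_all add: m(2) out)
qed

end

section \<open>The reduction as a stack machine\<close>

text \<open>Variables get brackets and bits of their own, since later phases must tell them from the
  letters of relations. A \<open>Key\<close> starts an entry of the table of pins, a
  \<open>Const\<close> replaces a pinned variable, and the \<open>Fixed\<close> tokens mark where a
  query inserts the element variables and their constraints. The answer state is the same after
  every query, so the loop counter and the accumulated sum have to survive in a
  \<open>Register\<close> on a stack.\<close>

datatype 'a token =
    VarOpen | VarClose | VarBit bool | ScopeOpen | Mark "'a option" | Key 'a | Const 'a
  | FixedVars | FixedConstraints | Register nat nat

type_synonym 'a sym = "letter + 'a token"

datatype 'a parse_state =
    Vars_Start | Vars | Var_String | Cons_Start | Cons_List | Scope nat | Scope_String nat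
  | Rel_Start bool | Rel bool "'a set" | Tuple bool "'a set" | Name bool "'a set" "bool list"

datatype 'a control =
    Parse "'a parse_state" | Unmark "'a option" | Read | Read_Var | Rewind
  | Compare bool "'a set" | Restore "'a set" | Emit | Emit_Bits | Clear 'a
  | Ask nat nat | Query | Answer | Answer_Bits nat nat nat | Put_Back nat nat | Halt

fun keep :: "'b option \<Rightarrow> 'b list" where
  "keep None = []"
| "keep (Some x) = [x]"

lemma keep_top [simp]: "keep (top_symbol s) @ tl s = s"
  by (cases s) auto

text \<open>For tuples of length 1, a single occurring element means that the relation is the
  corresponding constant. A constant that already belongs to \<open>\<Gamma>\<close> is marked too,
  and treating it as a pin is equally correct.\<close>

definition mark :: "bool \<Rightarrow> 'a set \<Rightarrow> 'a option" where
  "mark un S = (if un \<and> is_singleton S then Some (the_elem S) else None)"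

text \<open>The tokens arrive in reverse, so the mark of a constraint comes before its body and
  \<open>ScopeOpen\<close> after it. An unmarked constraint is copied and gets back its opening
  bracket; a marked one is dropped, except that its variable becomes an entry of the table.\<close>

fun unmark :: "'a option \<Rightarrow> 'a sym \<Rightarrow> 'a option \<times> 'a sym list \<times> 'a sym list" where
  "unmark None (Inr (Mark m)) = (m, [], [])"
| "unmark None (Inr ScopeOpen) = (None, [Inl Lpar], [])"
| "unmark None c = (None, [c], [])"
| "unmark (Some a) (Inr ScopeOpen) = (None, [], [])"
| "unmark (Some a) (Inr VarOpen) = (Some a, [], [Inr (Key a)])"
| "unmark (Some a) (Inr (VarBit b)) = (Some a, [], [Inr (VarBit b)])"
| "unmark (Some a) c = (Some a, [], [])"

fun emitted :: "'a sym \<Rightarrow> 'a sym" where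
  "emitted (Inr (VarBit b)) = Inl (if b then One else Zero)"
| "emitted c = c"

text \<open>All \<open>n\<close> queries share one prepared instance: query \<open>i\<close> is its
  image under \<open>h i\<close>, symbol by symbol, and the answer enters the result with weight
  \<open>coef i\<close>. The bound \<open>M\<close> allows the finite control to store a name while
  it is being read.\<close>

locale reduction_machine =
  fixes H :: "'a set" and nm :: "'a \<Rightarrow> bool list" and M p n :: nat
    and h :: "nat \<Rightarrow> 'a sym \<Rightarrow> word" and coef :: "nat \<Rightarrow> nat"
  assumes finite_H: "finite H" and inj_nm: "inj_on nm H"
    and name_length: "\<And>a. a \<in> H \<Longrightarrow> length (nm a) \<le> M"
    and p_pos: "0 < p"
begin

text \<open>
  Brackets determine the position in the encoding: \<open>Scope k\<close> counts the variables of a scope up to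
  2, and \<open>Rel un S\<close> collects in \<open>S\<close> all the elements that occur in the tuples of a relation, the
  flag recording that it is unary. A mark after each constraint tells whether its relation is a
  constant.
\<close>

fun parse :: "'a parse_state \<Rightarrow> letter \<Rightarrow> 'a parse_state \<times> 'a sym list" where
  "parse Vars_Start Lpar = (Vars, [Inl Lpar, Inr FixedVars])"
| "parse Vars Lpar = (Var_String, [Inr VarOpen])"
| "parse Vars Rpar = (Cons_Start, [Inl Rpar])"
| "parse Var_String Zero = (Var_String, [Inr (VarBit False)])"
| "parse Var_String One = (Var_String, [Inr (VarBit True)])"
| "parse Var_String Rpar = (Vars, [Inr VarClose])"
| "parse Cons_Start Lpar = (Cons_List, [Inl Lpar, Inr FixedConstraints])"
| "parse Cons_List Lpar = (Scope 0, [Inr ScopeOpen])"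
| "parse Cons_List Rpar = (Cons_List, [Inl Rpar])"
| "parse (Scope k) Lpar = (Scope_String k, [Inr VarOpen])"
| "parse (Scope k) Rpar = (Rel_Start (k = 1), [Inl Rpar])"
| "parse (Scope_String k) Zero = (Scope_String k, [Inr (VarBit False)])"
| "parse (Scope_String k) One = (Scope_String k, [Inr (VarBit True)])"
| "parse (Scope_String k) Rpar = (Scope (min 2 (Suc k)), [Inr VarClose])"
| "parse (Rel_Start un) Lpar = (Rel un {}, [Inl Lpar])"
| "parse (Rel un S) Lpar = (Tuple un S, [Inl Lpar])"
| "parse (Rel un S) Rpar = (Cons_List, [Inl Rpar, Inr (Mark (mark un S))])"
| "parse (Tuple un S) Lpar = (Name un S [], [Inl Lpar])"
| "parse (Tuple un S) Rpar = (Rel un S, [Inl Rpar])"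
| "parse (Name un S u) Zero = (Name un S (take M (u @ [False])), [Inl Zero])"
| "parse (Name un S u) One = (Name un S (take M (u @ [True])), [Inl One])"
| "parse (Name un S u) Rpar = (Tuple un (S \<union> {a \<in> H. nm a = u}), [Inl Rpar])"
| "parse s c = (s, [])"

text \<open>
  Stack 0 holds the input, later the loop counter during a query and the output. Stack 1 is the
  oracle stack and serves as scratch space for table lookups. Stacks 2 and 3 hold the instance in
  its various stages, alternately reversed, stack 4 the table of pinned variables, stacks 5 and 6
  the variable being looked up. \<open>Compare ok S\<close> collects in \<open>S\<close> the constants found for it.
\<close>

fun control_step :: "'a control \<Rightarrow> 'a sym option \<Rightarrow> 'a sym option \<Rightarrow> 'a sym option \<Rightarrow> 'a sym option \<Rightarrow>
    'a sym option \<Rightarrow> 'a sym option \<Rightarrow> 'a sym option \<Rightarrow> 'a control \<times> 'a sym list list" where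
  "control_step (Parse s) a o' d e t w v = (case a of
     Some (Inl c) \<Rightarrow> (case parse s c of (s', u) \<Rightarrow>
       (Parse s', [[], keep o', rev u @ keep d, keep e, keep t, keep w, keep v]))
   | _ \<Rightarrow> (Unmark None, [keep a, keep o', keep d, keep e, keep t, keep w, keep v]))"
| "control_step (Unmark m) a o' d e t w v = (case d of
     Some c \<Rightarrow> (case unmark m c of (m', es, ts) \<Rightarrow>
       (Unmark m', [keep a, keep o', [], es @ keep e, ts @ keep t, keep w, keep v]))
   | None \<Rightarrow> (Read, [keep a, keep o', keep d, keep e, keep t, keep w, keep v]))"
| "control_step Read a o' d e t w v = (case e of
     Some c \<Rightarrow> (if c = Inr VarOpen
       then (Read_Var, [keep a, keep o', keep d, [], keep t, keep w, keep v])
       else (Read, [keep a, keep o', c # keep d, [], keep t, keep w, keep v]))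
   | None \<Rightarrow> (Ask 0 0, [keep a, keep o', keep d, keep e, keep t, keep w, keep v]))"
| "control_step Read_Var a o' d e t w v = (case e of
     Some c \<Rightarrow> (if c = Inr VarClose
       then (Rewind, [keep a, keep o', keep d, [], keep t, keep w, keep v])
       else (Read_Var, [keep a, keep o', keep d, [], keep t, c # keep w, keep v]))
   | None \<Rightarrow> (Halt, [keep a, keep o', keep d, keep e, keep t, keep w, keep v]))"
| "control_step Rewind a o' d e t w v = (case t of
     Some c \<Rightarrow> (Rewind, [keep a, c # keep o', keep d, keep e, [], keep w, keep v])
   | None \<Rightarrow> (Compare True {}, [keep a, keep o', keep d, keep e, keep t, keep w, keep v]))"
| "control_step (Compare ok S) a o' d e t w v = (case o' of
     None \<Rightarrow> (if S = {} then Emit else if is_singleton S then Clear (the_elem S) else Halt,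
       [keep a, keep o', keep d, keep e, keep t, keep w, keep v])
   | Some c \<Rightarrow> (case c of
       Inr (Key x) \<Rightarrow> (Restore (if ok \<and> w = None then insert x S else S),
         [keep a, [], keep d, keep e, c # keep t, keep w, keep v])
     | _ \<Rightarrow> if ok \<and> w = Some c
         then (Compare True S, [keep a, [], keep d, keep e, c # keep t, [], c # keep v])
         else (Compare False S, [keep a, [], keep d, keep e, c # keep t, keep w, keep v])))"
| "control_step (Restore S) a o' d e t w v = (case v of
     Some c \<Rightarrow> (Restore S, [keep a, keep o', keep d, keep e, keep t, c # keep w, []])
   | None \<Rightarrow> (Compare True S, [keep a, keep o', keep d, keep e, keep t, keep w, keep v]))"
| "control_step Emit a o' d e t w v = (case w of
     Some c \<Rightarrow> (Emit, [keep a, keep o', keep d, keep e, keep t, [], c # keep v])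
   | None \<Rightarrow> (Emit_Bits, [keep a, keep o', Inl One # Inl Lpar # keep d, keep e, keep t, keep w, keep v]))"
| "control_step Emit_Bits a o' d e t w v = (case v of
     Some c \<Rightarrow> (Emit_Bits, [keep a, keep o', emitted c # keep d, keep e, keep t, keep w, []])
   | None \<Rightarrow> (Read, [keep a, keep o', Inl Rpar # keep d, keep e, keep t, keep w, keep v]))"
| "control_step (Clear x) a o' d e t w v = (case w of
     Some c \<Rightarrow> (Clear x, [keep a, keep o', keep d, keep e, keep t, [], keep v])
   | None \<Rightarrow> (Read, [keep a, keep o', Inr (Const x) # keep d, keep e, keep t, keep w, keep v]))"
| "control_step (Ask i acc) a o' d e t w v = (if n \<le> i
     then (Halt, [map Inl (bits (binary acc)) @ keep a, keep o', keep d, keep e, keep t, keep w, keep v])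
     else (case d of
       Some c \<Rightarrow> (Ask i acc, [keep a, map Inl (h i c) @ keep o', [], c # keep e, keep t, keep w, keep v])
     | None \<Rightarrow> (Query, [Inr (Register i acc) # keep a, keep o', keep d, keep e, keep t, keep w, keep v])))"
| "control_step Answer a o' d e t w v = (case a of
     Some (Inr (Register i acc)) \<Rightarrow>
       (Answer_Bits i acc (coef i mod p), [[], keep o', keep d, keep e, keep t, keep w, keep v])
   | _ \<Rightarrow> (Halt, [keep a, keep o', keep d, keep e, keep t, keep w, keep v]))"
| "control_step (Answer_Bits i acc wt) a o' d e t w v = (case o' of
     Some c \<Rightarrow> (Answer_Bits i (if c = Inl One then (acc + wt) mod p else acc) (2 * wt mod p),
       [keep a, [], keep d, keep e, keep t, keep w, keep v])
   | None \<Rightarrow> (Put_Back i acc, [keep a, keep o', keep d, keep e, keep t, keep w, keep v]))"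
| "control_step (Put_Back i acc) a o' d e t w v = (case e of
     Some c \<Rightarrow> (Put_Back i acc, [keep a, keep o', c # keep d, [], keep t, keep w, keep v])
   | None \<Rightarrow> (Ask (Suc i) acc, [keep a, keep o', keep d, keep e, keep t, keep w, keep v]))"
| "control_step q a o' d e t w v = (q, [keep a, keep o', keep d, keep e, keep t, keep w, keep v])"

definition delta :: "'a control \<Rightarrow> 'a sym option list \<Rightarrow> 'a control \<times> 'a sym list list" where
  "delta q cs = control_step q (cs ! 0) (cs ! 1) (cs ! 2) (cs ! 3) (cs ! 4) (cs ! 5) (cs ! 6)"

definition parse_states :: "'a parse_state set" where
  "parse_states = {Vars_Start, Vars, Var_String, Cons_Start, Cons_List} \<union>
     (\<Union>k \<in> {..2}. {Scope k, Scope_String k}) \<union>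
     (\<Union>b \<in> UNIV. {Rel_Start b} \<union> (\<Union>S \<in> Pow H. {Rel b S, Tuple b S} \<union>
       (\<Union>u \<in> {u. set u \<subseteq> UNIV \<and> length u \<le> M}. {Name b S u})))"

definition controls :: "'a control set" where
  "controls = {Read, Read_Var, Rewind, Emit, Emit_Bits, Query, Answer, Halt} \<union>
     (\<Union>s \<in> parse_states. {Parse s}) \<union> (\<Union>m \<in> insert None (Some ` H). {Unmark m}) \<union>
     (\<Union>S \<in> Pow H. {Restore S, Compare True S, Compare False S}) \<union> (\<Union>x \<in> H. {Clear x}) \<union>
     (\<Union>i \<in> {..n}. \<Union>x \<in> {..<p}. {Ask i x}) \<union>
     (\<Union>i \<in> {..<n}. \<Union>x \<in> {..<p}. {Put_Back i x} \<union> (\<Union>w \<in> {..<p}. {Answer_Bits i x w}))"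

definition tokens :: "'a token set" where
  "tokens = {VarOpen, VarClose, ScopeOpen, FixedVars, FixedConstraints, VarBit True, VarBit False,
     Mark None} \<union> (\<Union>x \<in> H. {Mark (Some x), Key x, Const x}) \<union>
     (\<Union>i \<in> {..<n}. \<Union>x \<in> {..<p}. {Register i x})"

lemma finite_controls: "finite controls"
proof -
  have "finite {u :: bool list. set u \<subseteq> UNIV \<and> length u \<le> M}"
    by (rule finite_lists_length_le) simp
  then have "finite parse_states"
    unfolding parse_states_def using finite_H by simp
  then show ?thesis
    unfolding controls_def using finite_H by simp
qed

lemma finite_tokens: "finite tokens"
  unfolding tokens_def using finite_H by simp

lemma parse_states_iff:
  "Vars_Start \<in> parse_states" "Vars \<in> parse_states" "Var_String \<in> parse_states"
  "Cons_Start \<in> parse_states" "Cons_List \<in> parse_states"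
  "Scope k \<in> parse_states \<longleftrightarrow> k \<le> 2" "Scope_String k \<in> parse_states \<longleftrightarrow> k \<le> 2"
  "Rel_Start b \<in> parse_states" "Rel b S \<in> parse_states \<longleftrightarrow> S \<subseteq> H"
  "Tuple b S \<in> parse_states \<longleftrightarrow> S \<subseteq> H"
  "Name b S u \<in> parse_states \<longleftrightarrow> S \<subseteq> H \<and> length u \<le> M"
  by (simp_all add: parse_states_def)

lemma controls_iff:
  "Parse s \<in> controls \<longleftrightarrow> s \<in> parse_states" "Unmark m \<in> controls \<longleftrightarrow> set_option m \<subseteq> H"
  "Read \<in> controls" "Read_Var \<in> controls" "Rewind \<in> controls" "Emit \<in> controls"
  "Emit_Bits \<in> controls" "Query \<in> controls" "Answer \<in> controls" "Halt \<in> controls"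
  "Compare b S \<in> controls \<longleftrightarrow> S \<subseteq> H" "Restore S \<in> controls \<longleftrightarrow> S \<subseteq> H"
  "Clear x \<in> controls \<longleftrightarrow> x \<in> H" "Ask i acc \<in> controls \<longleftrightarrow> i \<le> n \<and> acc < p"
  "Answer_Bits i acc wt \<in> controls \<longleftrightarrow> i < n \<and> acc < p \<and> wt < p"
  "Put_Back i acc \<in> controls \<longleftrightarrow> i < n \<and> acc < p"
  by (cases m; cases b; simp add: controls_def image_iff)+

lemma tokens_iff:
  "VarOpen \<in> tokens" "VarClose \<in> tokens" "ScopeOpen \<in> tokens" "FixedVars \<in> tokens"
  "FixedConstraints \<in> tokens" "VarBit b \<in> tokens" "Mark m \<in> tokens \<longleftrightarrow> set_option m \<subseteq> H"
  "Key x \<in> tokens \<longleftrightarrow> x \<in> H" "Const x \<in> tokens \<longleftrightarrow> x \<in> H"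
  "Register i acc \<in> tokens \<longleftrightarrow> i < n \<and> acc < p"
  by (cases m; cases b; simp add: tokens_def)+

lemma mark_closed: "S \<subseteq> H \<Longrightarrow> set_option (mark un S) \<subseteq> H"
  by (auto simp: mark_def is_singleton_def)

lemma symbols_iff: "Inl l \<in> symbols G" "Inr c \<in> symbols G \<longleftrightarrow> c \<in> G"
  by auto

lemma parse_closed:
  assumes "s \<in> parse_states"
  shows "fst (parse s c) \<in> parse_states \<and> set (snd (parse s c)) \<subseteq> symbols tokens"
proof (cases s)
  case (Name b S u)
  have "{a \<in> H. nm a = u} \<subseteq> H" by blast
  then show ?thesis using Name assms
    by (cases c; auto simp: parse_states_iff symbols_iff min_def)
qed (use assms in \<open>cases c; simp add: parse_states_iff tokens_iff symbols_iff mark_closed\<close>)+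

lemma unmark_closed:
  assumes "set_option m \<subseteq> H" "c \<in> symbols tokens"
  shows "set_option (fst (unmark m c)) \<subseteq> H \<and> set (fst (snd (unmark m c))) \<subseteq> symbols tokens \<and>
    set (snd (snd (unmark m c))) \<subseteq> symbols tokens"
  by (cases "(m, c)" rule: unmark.cases; use assms in \<open>simp add: tokens_iff symbols_iff\<close>)


lemma set_keep [simp]: "set (keep x) = set_option x"
  by (cases x) auto

lemma control_step_closed:
  assumes "q \<in> controls"
    "set_option a \<subseteq> symbols tokens" "set_option o' \<subseteq> symbols tokens" "set_option d \<subseteq> symbols tokens"
    "set_option e \<subseteq> symbols tokens" "set_option t \<subseteq> symbols tokens" "set_option w \<subseteq> symbols tokens"
    "set_option v \<subseteq> symbols tokens"
  shows "fst (control_step q a o' d e t w v) \<in> controls \<and>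
    length (snd (control_step q a o' d e t w v)) = 7 \<and>
    (\<forall>w \<in> set (snd (control_step q a o' d e t w v)). set w \<subseteq> symbols tokens)"
proof (cases q)
  case (Parse s)
  then show ?thesis
  proof (cases a)
    case None
    then show ?thesis using assms Parse by (simp add: controls_iff)
  next
    case (Some c)
    then show ?thesis
      using assms Parse parse_closed[of s] by (cases c; simp add: controls_iff case_prod_beta)
  qed
next
  case (Unmark m)
  then show ?thesis
  proof (cases d)
    case None
    then show ?thesis using assms Unmark by (simp add: controls_iff)
  next
    case (Some c)
    then show ?thesis
      using assms Unmark unmark_closed[of m c] by (simp add: controls_iff case_prod_beta)
  qed
next
  case (Compare ok S)
  have S: "S \<subseteq> H" using assms(1) Compare by (simp add: controls_iff)
  show ?thesis
  proof (cases o')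
    case None
    have "the_elem S \<in> H" if "is_singleton S" using that S by (auto simp: is_singleton_def)
    then show ?thesis using assms None Compare S by (simp add: controls_iff)
  next
    case (Some c)
    show ?thesis
    proof (cases c)
      case (Inl l)
      then show ?thesis using assms Some Compare S by (simp add: controls_iff)
    next
      case (Inr g)
      then show ?thesis using assms Some Compare S
        by (cases g) (simp_all add: controls_iff tokens_iff symbols_iff)
    qed
  qed
next
  case (Ask i acc)
  then show ?thesis using assms
    by (cases d) (auto simp: controls_iff tokens_iff symbols_iff)
next
  case Answer
  show ?thesis
  proof (cases a)
    case None
    then show ?thesis using assms Answer by (simp add: controls_iff)
  next
    case (Some c)
    show ?thesis
    proof (cases c)
      case (Inl l)
      then show ?thesis using assms Some Answer by (simp add: controls_iff)
    next
      case (Inr g)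
      then show ?thesis using assms Some Answer p_pos
        by (cases g) (simp_all add: controls_iff tokens_iff symbols_iff)
    qed
  qed
next
  case Emit_Bits
  show ?thesis
  proof (cases v)
    case None
    then show ?thesis using assms Emit_Bits by (simp add: controls_iff symbols_iff)
  next
    case (Some c)
    have "emitted c \<in> symbols tokens"
      using assms Some by (cases c rule: emitted.cases) auto
    then show ?thesis using assms Some Emit_Bits by (simp add: controls_iff symbols_iff)
  qed
next
  case Read
  then show ?thesis using assms p_pos by (cases e) (simp_all add: controls_iff)
next
  case Read_Var
  then show ?thesis using assms by (cases e) (simp_all add: controls_iff)
next
  case Rewind
  then show ?thesis using assms by (cases t) (simp_all add: controls_iff)
next
  case (Restore S)
  then show ?thesis using assms by (cases v) (simp_all add: controls_iff)
next
  case Emit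
  then show ?thesis using assms by (cases w) (simp_all add: controls_iff symbols_iff)
next
  case (Clear x)
  then show ?thesis using assms by (cases w) (simp_all add: controls_iff symbols_iff tokens_iff)
next
  case (Answer_Bits i acc wt)
  then show ?thesis using assms p_pos by (cases o') (simp_all add: controls_iff)
next
  case (Put_Back i acc)
  then show ?thesis using assms by (cases e) (auto simp: controls_iff)
qed (use assms in \<open>simp_all add: controls_iff\<close>)

sublocale stack_machine 7 controls tokens "Parse Vars_Start" Halt Query Answer delta
proof
  fix q cs q' ws
  assume q: "q \<in> controls" and cs: "length cs = 7" "set cs \<subseteq> insert None (Some ` symbols tokens)"
    and d: "delta q cs = (q', ws)"
  have opt: "set_option (cs ! i) \<subseteq> symbols tokens" if "i < 7" for i
  proof -
    have "cs ! i \<in> set cs" using cs(1) that by simp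
    then have "cs ! i \<in> insert None (Some ` symbols tokens)" using cs(2) by (rule set_mp[rotated])
    then show ?thesis by auto
  qed
  have "fst (delta q cs) \<in> controls \<and> length (snd (delta q cs)) = 7 \<and>
      (\<forall>w \<in> set (snd (delta q cs)). set w \<subseteq> symbols tokens)"
    unfolding delta_def by (rule control_step_closed[OF q]) (rule opt, simp)+
  then show "q' \<in> controls \<and> length ws = 7 \<and> (\<forall>w \<in> set ws. set w \<subseteq> symbols tokens)"
    by (simp add: d)
qed (simp_all add: finite_controls finite_tokens controls_iff parse_states_iff)

section \<open>Running times of the single phases\<close>

definition reaches :: "(word \<Rightarrow> word) \<Rightarrow> 'a control \<times> 'a sym list list \<Rightarrow> nat \<Rightarrow>
    'a control \<times> 'a sym list list \<Rightarrow> bool" where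
  "reaches f c N c' \<longleftrightarrow> (\<exists>m \<le> N. (sstep f ^^ m) c = c')"

lemma reaches_refl: "reaches f c N c"
  unfolding reaches_def by (intro exI[of _ 0]) simp

lemma reaches_trans:
  assumes "reaches f c N c'" "reaches f c' N' c''" "N + N' \<le> N''"
  shows "reaches f c N'' c''"
proof -
  obtain m m' where "m \<le> N" "m' \<le> N'" "(sstep f ^^ m) c = c'" "(sstep f ^^ m') c' = c''"
    using assms(1,2) by (auto simp: reaches_def)
  then show ?thesis
    unfolding reaches_def using assms(3) by (intro exI[of _ "m' + m"]) (simp add: funpow_add)
qed

lemma reaches_step: "sstep f c = c' \<Longrightarrow> reaches f c' N c'' \<Longrightarrow> reaches f c (Suc N) c''"
  by (rule reaches_trans[of _ _ 1]) (auto simp: reaches_def intro!: exI[of _ 1])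

lemma reaches_mono: "reaches f c N c' \<Longrightarrow> N \<le> N' \<Longrightarrow> reaches f c N' c'"
  unfolding reaches_def using order_trans by blast

lemma sstep_control:
  assumes "q \<noteq> Halt" "q \<noteq> Query"
  shows "sstep f (q, [a, o', d, e, t, w, v]) =
    (case control_step q (top_symbol a) (top_symbol o') (top_symbol d) (top_symbol e) (top_symbol t)
        (top_symbol w) (top_symbol v) of
      (q', ws) \<Rightarrow> (q', map2 (\<lambda>w s. w @ tl s) ws [a, o', d, e, t, w, v]))"
  using assms by (simp add: stack_step_def delta_def)

fun parses :: "'a parse_state \<Rightarrow> word \<Rightarrow> 'a parse_state \<times> 'a sym list" where
  "parses s [] = (s, [])"
| "parses s (c # x) =
    (fst (parses (fst (parse s c)) x), snd (parse s c) @ snd (parses (fst (parse s c)) x))"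

lemma run_Parse:
  "reaches f (Parse s, [map Inl x, o', d, e, t, w, v]) (Suc (length x))
    (Unmark None, [[], o', rev (snd (parses s x)) @ d, e, t, w, v])"
proof (induction x arbitrary: s d)
  case Nil
  show ?case by (rule reaches_step[OF _ reaches_refl]) (simp add: sstep_control)
next
  case (Cons c x)
  have "sstep f (Parse s, [map Inl (c # x), o', d, e, t, w, v]) =
      (Parse (fst (parse s c)), [map Inl x, o', rev (snd (parse s c)) @ d, e, t, w, v])"
    by (simp add: sstep_control case_prod_beta)
  from reaches_step[OF this Cons.IH] show ?case by simp
qed

fun unmarks :: "'a option \<Rightarrow> 'a sym list \<Rightarrow> 'a option \<times> 'a sym list \<times> 'a sym list" where
  "unmarks m [] = (m, [], [])"
| "unmarks m (c # x) = (case unmark m c of (m', es, ts) \<Rightarrow>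
     case unmarks m' x of (m'', es', ts') \<Rightarrow> (m'', es' @ es, ts' @ ts))"

lemma run_Unmark:
  assumes "unmarks m d = (m', es, ts)"
  shows "reaches f (Unmark m, [a, o', d, e, t, w, v]) (Suc (length d))
    (Read, [a, o', [], es @ e, ts @ t, w, v])"
  using assms
proof (induction d arbitrary: m es ts e t)
  case Nil
  then show ?case by (intro reaches_step[OF _ reaches_refl]) (simp add: sstep_control)
next
  case (Cons c d)
  obtain m1 es1 ts1 where 1: "unmark m c = (m1, es1, ts1)" by (cases "unmark m c")
  obtain m2 es2 ts2 where 2: "unmarks m1 d = (m2, es2, ts2)" by (cases "unmarks m1 d")
  have "sstep f (Unmark m, [a, o', c # d, e, t, w, v]) =
      (Unmark m1, [a, o', d, es1 @ e, ts1 @ t, w, v])"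
    by (simp add: sstep_control 1)
  moreover have "m2 = m'" "es = es2 @ es1" "ts = ts2 @ ts1"
    using Cons.prems 1 2 by simp_all
  ultimately show ?case
    using reaches_step[OF _ Cons.IH[of m1 es2 ts2 "es1 @ e" "ts1 @ t"]] 2 by simp
qed

abbreviation var_bits :: "bool list \<Rightarrow> 'a sym list" where
  "var_bits w \<equiv> map (\<lambda>b. Inr (VarBit b)) w"

definition var_tokens :: "bool list \<Rightarrow> 'a sym list" where
  "var_tokens w = Inr VarOpen # var_bits w @ [Inr VarClose]"

text \<open>The key precedes the bits, so in the reversed table that \<open>Compare\<close> reads it
  follows them and ends the comparison with the entry.\<close>

definition entry_tokens :: "'a \<times> bool list \<Rightarrow> 'a sym list" where
  "entry_tokens = (\<lambda>(x, u). Inr (Key x) # var_bits u)"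

definition keys :: "('a \<times> bool list) list \<Rightarrow> bool list \<Rightarrow> 'a set" where
  "keys E w = {x. (x, w) \<in> set E}"

lemma run_Read_Var:
  "reaches f (Read_Var, [a, o', d, var_bits u @ Inr VarClose # e, t, w, v]) (Suc (length u))
    (Rewind, [a, o', d, e, t, rev (var_bits u) @ w, v])"
proof (induction u arbitrary: w)
  case Nil
  show ?case by (rule reaches_step[OF _ reaches_refl]) (simp add: sstep_control)
next
  case (Cons b u)
  have "sstep f (Read_Var, [a, o', d, var_bits (b # u) @ Inr VarClose # e, t, w, v]) =
      (Read_Var, [a, o', d, var_bits u @ Inr VarClose # e, t, Inr (VarBit b) # w, v])"
    by (simp add: sstep_control)
  from reaches_step[OF this Cons.IH] show ?case by simp
qed

lemma run_Rewind:
  "reaches f (Rewind, [a, o', d, e, t, w, v]) (Suc (length t))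
    (Compare True {}, [a, rev t @ o', d, e, [], w, v])"
proof (induction t arbitrary: o')
  case Nil
  show ?case by (rule reaches_step[OF _ reaches_refl]) (simp add: sstep_control)
next
  case (Cons c t)
  have "sstep f (Rewind, [a, o', d, e, c # t, w, v]) = (Rewind, [a, c # o', d, e, t, w, v])"
    by (simp add: sstep_control)
  from reaches_step[OF this Cons.IH] show ?case by simp
qed

text \<open>Matched bits move from stack 5 to stack 6 up to the first mismatch, after which the
  variable stays put. How it is split then depends on the entry; the invariant
  \<open>rev v' @ w'\<close> is all that is needed to restore it.\<close>

lemma run_Compare_bits:
  "\<exists>w' v'. rev v' @ w' = rev v @ var_bits u \<and>
    reaches f (Compare ok S, [a, var_bits z @ Inr (Key x) # o', d, e, t, var_bits u, v]) (Suc (length z))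
      (Restore (if ok \<and> z = u then insert x S else S),
        [a, o', d, e, Inr (Key x) # rev (var_bits z) @ t, w', v'])"
proof (induction z arbitrary: ok u v t)
  case Nil
  have "sstep f (Compare ok S, [a, Inr (Key x) # o', d, e, t, var_bits u, v]) =
      (Restore (if ok \<and> [] = u then insert x S else S), [a, o', d, e, Inr (Key x) # t, var_bits u, v])"
    by (cases u) (simp_all add: sstep_control)
  from reaches_step[OF this reaches_refl] show ?case
    by - (rule exI[of _ "var_bits u"], rule exI[of _ v], simp)
next
  case (Cons b z)
  show ?case
  proof (cases "ok \<and> (\<exists>u'. u = b # u')")
    case True
    then obtain u' where u: "ok" "u = b # u'" by blast
    have "sstep f (Compare ok S, [a, var_bits (b # z) @ Inr (Key x) # o', d, e, t, var_bits u, v]) =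
        (Compare True S, [a, var_bits z @ Inr (Key x) # o', d, e, Inr (VarBit b) # t, var_bits u',
          Inr (VarBit b) # v])"
      using u by (simp add: sstep_control)
    note step = reaches_step[OF this]
    obtain w' v' where "rev v' @ w' = rev (Inr (VarBit b) # v) @ var_bits u'"
      "reaches f (Compare True S, [a, var_bits z @ Inr (Key x) # o', d, e, Inr (VarBit b) # t,
          var_bits u', Inr (VarBit b) # v]) (Suc (length z))
        (Restore (if True \<and> z = u' then insert x S else S),
          [a, o', d, e, Inr (Key x) # rev (var_bits z) @ Inr (VarBit b) # t, w', v'])"
      using Cons.IH by blast
    then show ?thesis
      using step u by - (rule exI[of _ w'], rule exI[of _ v'], simp)
  next
    case False
    have "\<not> (ok \<and> top_symbol (var_bits u) = Some (Inr (VarBit b)))"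
      using False by (cases u) auto
    then have "sstep f (Compare ok S, [a, var_bits (b # z) @ Inr (Key x) # o', d, e, t, var_bits u, v]) =
        (Compare False S, [a, var_bits z @ Inr (Key x) # o', d, e, Inr (VarBit b) # t, var_bits u, v])"
      by (simp add: sstep_control)
    note step = reaches_step[OF this]
    obtain w' v' where "rev v' @ w' = rev v @ var_bits u"
      "reaches f (Compare False S, [a, var_bits z @ Inr (Key x) # o', d, e, Inr (VarBit b) # t,
          var_bits u, v]) (Suc (length z))
        (Restore (if False \<and> z = u then insert x S else S),
          [a, o', d, e, Inr (Key x) # rev (var_bits z) @ Inr (VarBit b) # t, w', v'])"
      using Cons.IH by blast
    moreover have "(if ok \<and> b # z = u then insert x S else S) = S" using False by auto
    ultimately show ?thesis
      unfolding \<open>(if ok \<and> b # z = u then insert x S else S) = S\<close> using step by - (rule exI[of _ w'], rule exI[of _ v'], simp)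
  qed
qed

lemma run_Restore:
  "reaches f (Restore S, [a, o', d, e, t, w, v]) (Suc (length v))
    (Compare True S, [a, o', d, e, t, rev v @ w, []])"
proof (induction v arbitrary: w)
  case Nil
  show ?case by (rule reaches_step[OF _ reaches_refl]) (simp add: sstep_control)
next
  case (Cons c v)
  have "sstep f (Restore S, [a, o', d, e, t, w, c # v]) = (Restore S, [a, o', d, e, t, c # w, v])"
    by (simp add: sstep_control)
  from reaches_step[OF this Cons.IH] show ?case by simp
qed

text \<open>The reversed table exposes its last entry, hence the induction from the end; the table
  is rebuilt on stack 4 for the next lookup. An entry costs its bits plus one pass over the
  variable, at most \<open>length u + 2\<close> for each of its tokens.\<close>

lemma run_Compare:
  "reaches f (Compare True S, [a, rev (concat (map entry_tokens E)), d, e, t, var_bits (rev u), []])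
      (length (concat (map entry_tokens E)) * (length u + 2))
    (Compare True (S \<union> keys E u), [a, [], d, e, concat (map entry_tokens E) @ t, var_bits (rev u), []])"
proof (induction E arbitrary: S t rule: rev_induct)
  case Nil
  show ?case by (simp add: reaches_refl keys_def)
next
  case (snoc y E)
  obtain x z where y: "y = (x, z)" by (cases y)
  let ?T = "rev (concat (map entry_tokens E))"
  let ?S = "if rev z = rev u then insert x S else S"
  obtain w' v' where wv: "rev v' @ w' = var_bits (rev u)"
    and r: "reaches f (Compare True S, [a, var_bits (rev z) @ Inr (Key x) # ?T, d, e, t, var_bits (rev u), []])
      (Suc (length (rev z)))
      (Restore ?S, [a, ?T, d, e, Inr (Key x) # rev (var_bits (rev z)) @ t, w', v'])"
    using run_Compare_bits[of "[]" "rev u" f True S a "rev z" x ?T d e t] by auto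
  have len: "length v' \<le> length u"
    using arg_cong[OF wv, of length] by simp
  have r2: "reaches f (Restore ?S, [a, ?T, d, e, Inr (Key x) # rev (var_bits (rev z)) @ t, w', v'])
      (Suc (length u)) (Compare True ?S, [a, ?T, d, e, entry_tokens y @ t, var_bits (rev u), []])"
    using reaches_mono[OF run_Restore[of f ?S a ?T d e "Inr (Key x) # rev (var_bits (rev z)) @ t" w' v']]
      len wv y by (simp add: entry_tokens_def rev_map)
  have S: "?S \<union> keys E u = S \<union> keys (E @ [y]) u"
    by (auto simp: keys_def y)
  have r3: "reaches f (Compare True S, [a, var_bits (rev z) @ Inr (Key x) # ?T, d, e, t, var_bits (rev u), []])
      (length z + length u + 2 + length (concat (map entry_tokens E)) * (length u + 2))
      (Compare True (S \<union> keys (E @ [y]) u),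
        [a, [], d, e, concat (map entry_tokens E) @ entry_tokens y @ t, var_bits (rev u), []])"
    unfolding S[symmetric]
    by (rule reaches_trans[OF reaches_trans[OF r r2 order_refl] snoc.IH]) simp
  have T: "rev (concat (map entry_tokens (E @ [y]))) = var_bits (rev z) @ Inr (Key x) # ?T"
    by (simp add: y entry_tokens_def rev_map)
  have "length z + length u + 2 + length (concat (map entry_tokens E)) * (length u + 2) \<le>
      length (concat (map entry_tokens (E @ [y]))) * (length u + 2)"
    by (simp add: y entry_tokens_def algebra_simps)
  from reaches_mono[OF r3 this] show ?case unfolding T by simp
qed

text \<open>The extra \<open>One\<close> is the bit \<open>True\<close> that
  \<open>subst_var\<close> puts in front of a free variable. The variable was read in reverse and is
  turned around here before its bits are written.\<close>

lemma run_Emit: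
  "reaches f (Emit, [a, o', d, e, t, w, v]) (Suc (length w))
    (Emit_Bits, [a, o', Inl One # Inl Lpar # d, e, t, [], rev w @ v])"
proof (induction w arbitrary: v)
  case Nil
  show ?case by (rule reaches_step[OF _ reaches_refl]) (simp add: sstep_control)
next
  case (Cons c w)
  have "sstep f (Emit, [a, o', d, e, t, c # w, v]) = (Emit, [a, o', d, e, t, w, c # v])"
    by (simp add: sstep_control)
  from reaches_step[OF this Cons.IH] show ?case by simp
qed

lemma run_Emit_Bits:
  "reaches f (Emit_Bits, [a, o', d, e, t, w, var_bits u]) (Suc (length u))
    (Read, [a, o', Inl Rpar # rev (map Inl (bits u)) @ d, e, t, w, []])"
proof (induction u arbitrary: d)
  case Nil
  show ?case by (rule reaches_step[OF _ reaches_refl]) (simp add: sstep_control bits_def)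
next
  case (Cons b u)
  have "sstep f (Emit_Bits, [a, o', d, e, t, w, var_bits (b # u)]) =
      (Emit_Bits, [a, o', Inl (if b then One else Zero) # d, e, t, w, var_bits u])"
    by (simp add: sstep_control)
  from reaches_step[OF this Cons.IH] show ?case by (simp add: bits_def)
qed

lemma run_Clear:
  "reaches f (Clear x, [a, o', d, e, t, w, v]) (Suc (length w))
    (Read, [a, o', Inr (Const x) # d, e, t, [], v])"
proof (induction w)
  case Nil
  show ?case by (rule reaches_step[OF _ reaches_refl]) (simp add: sstep_control)
next
  case (Cons c w)
  have "sstep f (Clear x, [a, o', d, e, t, c # w, v]) = (Clear x, [a, o', d, e, t, w, v])"
    by (simp add: sstep_control)
  from reaches_step[OF this Cons.IH] show ?case by simp
qed

end

section \<open>Values and lengths of binary numerals\<close>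

fun bit_value :: "bool list \<Rightarrow> nat" where
  "bit_value [] = 0"
| "bit_value (b # bs) = of_bool b + 2 * bit_value bs"

lemma bit_value_binary: "bit_value (binary m) = m"
proof (induction m rule: less_induct)
  case (less m)
  show ?case
  proof (cases "m = 0")
    case True
    then show ?thesis by (simp add: binary.simps)
  next
    case False
    then have "bit_value (binary (m div 2)) = m div 2" by (intro less.IH) simp
    then show ?thesis using False by (subst binary.simps) (auto elim!: oddE)
  qed
qed

text \<open>A linear bound is good enough, since the numerals read from the oracle are residues
  below the fixed \<open>p\<close>.\<close>

lemma length_binary: "length (binary m) \<le> m"
proof (induction m rule: less_induct)
  case (less m)
  show ?case
  proof (cases "m = 0")
    case True
    then show ?thesis by (simp add: binary.simps)
  next
    case False
    then have "length (binary (m div 2)) \<le> m div 2" by (intro less.IH) simp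
    then show ?thesis using False by (subst binary.simps) auto
  qed
qed

context reduction_machine
begin

text \<open>An item is either a symbol that \<open>Read\<close> copies or a whole variable that it
  looks up. \<open>item_tokens\<close> and \<open>out_tokens\<close> give the tokens before and
  after this phase.\<close>

definition item_tokens :: "'a sym + bool list \<Rightarrow> 'a sym list" where
  "item_tokens = case_sum (\<lambda>c. [c]) var_tokens"

definition subst_tokens :: "('a \<times> bool list) list \<Rightarrow> bool list \<Rightarrow> 'a sym list" where
  "subst_tokens E w = (if keys E w = {} then map Inl (encode_string (True # w))
     else [Inr (Const (the_elem (keys E w)))])"

definition out_tokens :: "('a \<times> bool list) list \<Rightarrow> 'a sym + bool list \<Rightarrow> 'a sym list" where
  "out_tokens E = case_sum (\<lambda>c. [c]) (subst_tokens E)"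

text \<open>For the table of an instance, failure means that \<open>w\<close> is pinned to two
  different elements, so that there is no solution.\<close>

definition functional_at :: "('a \<times> bool list) list \<Rightarrow> bool list \<Rightarrow> bool" where
  "functional_at E w \<longleftrightarrow> keys E w = {} \<or> is_singleton (keys E w)"

lemma run_lookup:
  fixes E :: "('a \<times> bool list) list"
  defines "T \<equiv> concat (map entry_tokens E)"
  shows "reaches f (Read, [a, [], d, var_tokens u @ e, T, [], []]) (length T * (length u + 3) + length u + 3)
    (Compare True (keys E u), [a, [], d, e, T, var_bits (rev u), []])"
proof -
  have 1: "sstep f (Read, [a, [], d, var_tokens u @ e, T, [], []]) =
      (Read_Var, [a, [], d, var_bits u @ Inr VarClose # e, T, [], []])"
    by (simp add: sstep_control var_tokens_def)
  have 2: "reaches f (Read_Var, [a, [], d, var_bits u @ Inr VarClose # e, T, [], []]) (Suc (length u))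
      (Rewind, [a, [], d, e, T, var_bits (rev u), []])"
    using run_Read_Var[of f a "[]" d u e T "[]" "[]"] by (simp add: rev_map)
  have 3: "reaches f (Rewind, [a, [], d, e, T, var_bits (rev u), []]) (Suc (length T))
      (Compare True {}, [a, rev T, d, e, [], var_bits (rev u), []])"
    using run_Rewind[of f a "[]" d e T "var_bits (rev u)" "[]"] by simp
  have 4: "reaches f (Compare True {}, [a, rev T, d, e, [], var_bits (rev u), []])
      (length T * (length u + 2)) (Compare True (keys E u), [a, [], d, e, T, var_bits (rev u), []])"
    using run_Compare[of f "{}" a E d e "[]" u] by (simp add: T_def)
  show ?thesis
    by (rule reaches_mono[OF reaches_step[OF 1 reaches_trans[OF reaches_trans[OF 2 3 order_refl] 4 order_refl]]])
       (simp add: algebra_simps)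
qed

lemma run_Read_var:
  fixes E :: "('a \<times> bool list) list"
  defines "T \<equiv> concat (map entry_tokens E)"
  assumes "functional_at E u"
  shows "reaches f (Read, [a, [], d, var_tokens u @ e, T, [], []]) ((length T + 3) * (length u + 3))
    (Read, [a, [], rev (subst_tokens E u) @ d, e, T, [], []])"
proof (cases "keys E u = {}")
  case True
  have 1: "sstep f (Compare True (keys E u), [a, [], d, e, T, var_bits (rev u), []]) =
      (Emit, [a, [], d, e, T, var_bits (rev u), []])"
    using True by (simp add: sstep_control)
  have 2: "reaches f (Emit, [a, [], d, e, T, var_bits (rev u), []]) (Suc (length u))
      (Emit_Bits, [a, [], Inl One # Inl Lpar # d, e, T, [], var_bits u])"
    using run_Emit[of f a "[]" d e T "var_bits (rev u)" "[]"] by (simp add: rev_map)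
  have 3: "reaches f (Emit_Bits, [a, [], Inl One # Inl Lpar # d, e, T, [], var_bits u]) (Suc (length u))
      (Read, [a, [], rev (subst_tokens E u) @ d, e, T, [], []])"
    using run_Emit_Bits[of f a "[]" "Inl One # Inl Lpar # d" e T "[]" u] True
    by (simp add: subst_tokens_def encode_string_def bits_def)
  show ?thesis
    by (rule reaches_trans[OF run_lookup[of f a d u e E, folded T_def]
          reaches_step[OF 1 reaches_trans[OF 2 3 order_refl]]])
       (simp add: algebra_simps)
next
  case False
  then have s: "is_singleton (keys E u)" using assms(2) by (simp add: functional_at_def)
  have 1: "sstep f (Compare True (keys E u), [a, [], d, e, T, var_bits (rev u), []]) =
      (Clear (the_elem (keys E u)), [a, [], d, e, T, var_bits (rev u), []])"
    using s False by (simp add: sstep_control)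
  have 2: "reaches f (Clear (the_elem (keys E u)), [a, [], d, e, T, var_bits (rev u), []]) (Suc (length u))
      (Read, [a, [], rev (subst_tokens E u) @ d, e, T, [], []])"
    using run_Clear[of f "the_elem (keys E u)" a "[]" d e T "var_bits (rev u)" "[]"] False
    by (simp add: subst_tokens_def)
  show ?thesis
    by (rule reaches_trans[OF run_lookup[of f a d u e E, folded T_def] reaches_step[OF 1 2]])
       (simp add: algebra_simps)
qed

text \<open>Stack 0 is left as it is: in the complete run it is empty at this point, and the empty
  word is the numeral of 0.\<close>

lemma run_Read_conflict:
  fixes E :: "('a \<times> bool list) list"
  defines "T \<equiv> concat (map entry_tokens E)"
  assumes "\<not> functional_at E u"
  shows "\<exists>ss. reaches f (Read, [a, [], d, var_tokens u @ e, T, [], []]) ((length T + 3) * (length u + 3))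
    (Halt, a # ss)"
proof -
  have 1: "sstep f (Compare True (keys E u), [a, [], d, e, T, var_bits (rev u), []]) =
      (Halt, [a, [], d, e, T, var_bits (rev u), []])"
    using assms(2) by (simp add: sstep_control functional_at_def)
  have "reaches f (Read, [a, [], d, var_tokens u @ e, T, [], []]) ((length T + 3) * (length u + 3))
      (Halt, [a, [], d, e, T, var_bits (rev u), []])"
    by (rule reaches_trans[OF run_lookup[of f a d u e E, folded T_def] reaches_step[OF 1 reaches_refl[of _ _ 0]]])
       (simp add: algebra_simps)
  then show ?thesis by blast
qed

lemma run_Read_sym:
  "c \<noteq> Inr VarOpen \<Longrightarrow> sstep f (Read, [a, [], d, c # e, T, [], []]) = (Read, [a, [], c # d, e, T, [], []])"
  by (simp add: sstep_control)

text \<open>The cost of a lookup is charged to the tokens of the variable, so that the costs of all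
  items add up to a multiple of the length of the instance.\<close>

lemma item_cost:
  "(\<tau> + 3) * (length u + 3) \<le> 2 * (\<tau> + 3) * length (var_tokens u)" for \<tau> :: nat
proof -
  have "(\<tau> + 3) * (length u + 3) \<le> (\<tau> + 3) * (2 * length (var_tokens u))"
    by (intro mult_le_mono2) (simp add: var_tokens_def)
  then show ?thesis by (simp add: algebra_simps)
qed

lemma run_Read:
  fixes E :: "('a \<times> bool list) list"
  defines "T \<equiv> concat (map entry_tokens E)"
  assumes "Inl (Inr VarOpen) \<notin> set its" "\<And>u. Inr u \<in> set its \<Longrightarrow> functional_at E u"
  shows "reaches f (Read, [a, [], d, concat (map item_tokens its), T, [], []])
      (Suc (2 * (length T + 3) * length (concat (map item_tokens its))))
    (Ask 0 0, [a, [], rev (concat (map (out_tokens E) its)) @ d, [], T, [], []])"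
  using assms(2,3)
proof (induction its arbitrary: d)
  case Nil
  show ?case by (rule reaches_step[OF _ reaches_refl]) (simp add: sstep_control)
next
  case (Cons it its)
  note IH = Cons.IH[OF _ Cons.prems(2)]
  show ?case
  proof (cases it)
    case (Inl c)
    then have c: "c \<noteq> Inr VarOpen" and n: "Inl (Inr VarOpen) \<notin> set its" using Cons.prems(1) by auto
    have "reaches f (Read, [a, [], d, c # concat (map item_tokens its), T, [], []])
        (Suc (Suc (2 * (length T + 3) * length (concat (map item_tokens its)))))
      (Ask 0 0, [a, [], rev (concat (map (out_tokens E) its)) @ c # d, [], T, [], []])"
      by (rule reaches_step[OF run_Read_sym[OF c] IH[OF n]]) simp
    from reaches_mono[OF this, of "Suc (2 * (length T + 3) * length (concat (map item_tokens (it # its))))"]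
    show ?thesis using Inl by (simp add: item_tokens_def out_tokens_def algebra_simps)
  next
    case (Inr u)
    then have n: "Inl (Inr VarOpen) \<notin> set its" "functional_at E u" using Cons.prems by auto
    have "reaches f (Read, [a, [], d, var_tokens u @ concat (map item_tokens its), T, [], []])
        ((length T + 3) * (length u + 3) + Suc (2 * (length T + 3) * length (concat (map item_tokens its))))
      (Ask 0 0, [a, [], rev (concat (map (out_tokens E) its)) @ rev (subst_tokens E u) @ d, [], T, [], []])"
      by (rule reaches_trans[OF run_Read_var[OF n(2), folded T_def] IH[OF n(1)]]) simp_all
    from reaches_mono[OF this, of "Suc (2 * (length T + 3) * length (concat (map item_tokens (it # its))))"]
    show ?thesis using Inr item_cost[of "length T" u] by (simp add: item_tokens_def out_tokens_def add_mult_distrib2)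
  qed
qed

text \<open>The run ends at the first conflicting variable, which need not be \<open>u\<close>; the
  items before it are processed as in a successful run.\<close>

lemma run_Read_fail:
  fixes E :: "('a \<times> bool list) list"
  defines "T \<equiv> concat (map entry_tokens E)"
  assumes "Inl (Inr VarOpen) \<notin> set its" "Inr u \<in> set its" "\<not> functional_at E u"
  shows "\<exists>ss. reaches f (Read, [a, [], d, concat (map item_tokens its), T, [], []])
      (Suc (2 * (length T + 3) * length (concat (map item_tokens its)))) (Halt, a # ss)"
  using assms(2,3)
proof (induction its arbitrary: d)
  case Nil
  then show ?case by simp
next
  case (Cons it its)
  show ?case
  proof (cases it)
    case (Inl c)
    then have c: "c \<noteq> Inr VarOpen" and n: "Inl (Inr VarOpen) \<notin> set its" "Inr u \<in> set its"
      using Cons.prems by auto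
    obtain ss where "reaches f (Read, [a, [], c # d, concat (map item_tokens its), T, [], []])
        (Suc (2 * (length T + 3) * length (concat (map item_tokens its)))) (Halt, a # ss)"
      using Cons.IH[OF n] by blast
    from reaches_mono[OF reaches_step[OF run_Read_sym[OF c] this],
        of "Suc (2 * (length T + 3) * length (concat (map item_tokens (it # its))))"]
    have "reaches f (Read, [a, [], d, concat (map item_tokens (it # its)), T, [], []])
        (Suc (2 * (length T + 3) * length (concat (map item_tokens (it # its))))) (Halt, a # ss)"
      using Inl by (simp add: item_tokens_def algebra_simps)
    then show ?thesis by blast
  next
    case (Inr z)
    let ?N = "Suc (2 * (length T + 3) * length (concat (map item_tokens (it # its))))"
    have le: "(length T + 3) * (length z + 3) + Suc (2 * (length T + 3) * length (concat (map item_tokens its))) \<le> ?N"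
      using Inr item_cost[of "length T" z] by (simp add: item_tokens_def add_mult_distrib2)
    show ?thesis
    proof (cases "functional_at E z")
      case True
      then have n: "Inl (Inr VarOpen) \<notin> set its" "Inr u \<in> set its"
        using Cons.prems Inr assms(4) by auto
      obtain ss where "reaches f (Read, [a, [], rev (subst_tokens E z) @ d, concat (map item_tokens its), T, [], []])
          (Suc (2 * (length T + 3) * length (concat (map item_tokens its)))) (Halt, a # ss)"
        using Cons.IH[OF n] by blast
      from reaches_trans[OF run_Read_var[OF True, folded T_def] this le] show ?thesis
        using Inr by (auto simp: item_tokens_def)
    next
      case False
      obtain ss where "reaches f (Read, [a, [], d, var_tokens z @ concat (map item_tokens its), T, [], []])
          ((length T + 3) * (length z + 3)) (Halt, a # ss)"
        using run_Read_conflict[OF False, folded T_def] by blast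
      from reaches_mono[OF this, of ?N] show ?thesis
        using Inr le by (auto simp: item_tokens_def)
    qed
  qed
qed

section \<open>Oracle queries and the weighted sum of the answers\<close>

lemma run_Ask:
  assumes "i < n"
  shows "reaches f (Ask i acc, [a, o', d, e, t, w, v]) (Suc (length d))
    (Query, [Inr (Register i acc) # a, map Inl (concat (map (h i) (rev d))) @ o', [], rev d @ e, t, w, v])"
proof (induction d arbitrary: o' e)
  case Nil
  show ?case by (rule reaches_step[OF _ reaches_refl]) (use assms in \<open>simp add: sstep_control\<close>)
next
  case (Cons c d)
  have "sstep f (Ask i acc, [a, o', c # d, e, t, w, v]) =
      (Ask i acc, [a, map Inl (h i c) @ o', d, c # e, t, w, v])"
    using assms by (simp add: sstep_control)
  from reaches_step[OF this Cons.IH] show ?case by simp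
qed

text \<open>Numerals start with the least significant bit, so it suffices to double the weight
  modulo \<open>p\<close> after each bit; the sum of \<open>acc\<close> and \<open>wt\<close> times
  the value of the remaining bits is invariant modulo \<open>p\<close>.\<close>

lemma run_Answer_Bits:
  assumes "acc < p"
  shows "reaches f (Answer_Bits i acc wt, [a, map Inl (bits bs), d, e, t, w, v]) (Suc (length bs))
    (Put_Back i ((acc + wt * bit_value bs) mod p), [a, [], d, e, t, w, v])"
  using assms
proof (induction bs arbitrary: acc wt)
  case Nil
  then show ?case by (intro reaches_step[OF _ reaches_refl]) (simp add: sstep_control bits_def)
next
  case (Cons b bs)
  let ?acc = "if b then (acc + wt) mod p else acc"
  have "sstep f (Answer_Bits i acc wt, [a, map Inl (bits (b # bs)), d, e, t, w, v]) =
      (Answer_Bits i ?acc (2 * wt mod p), [a, map Inl (bits bs), d, e, t, w, v])"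
    by (simp add: sstep_control bits_def)
  moreover have "?acc < p" using Cons.prems p_pos by simp
  moreover have "(?acc + (2 * wt mod p) * bit_value bs) mod p = (acc + wt * bit_value (b # bs)) mod p"
  proof -
    have "(?acc + (2 * wt mod p) * bit_value bs) mod p = (?acc + (2 * wt) * bit_value bs) mod p"
      by (metis mod_add_right_eq mod_mult_left_eq)
    also have "\<dots> = ((acc + (if b then wt else 0)) + (2 * wt) * bit_value bs) mod p"
      by (simp add: mod_add_left_eq)
    also have "\<dots> = (acc + wt * bit_value (b # bs)) mod p"
      by (simp add: algebra_simps)
    finally show ?thesis .
  qed
  ultimately show ?case using reaches_step[OF _ Cons.IH[of ?acc "2 * wt mod p"]] by simp
qed

lemma run_Put_Back:
  "reaches f (Put_Back i acc, [a, o', d, e, t, w, v]) (Suc (length e))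
    (Ask (Suc i) acc, [a, o', rev e @ d, [], t, w, v])"
proof (induction e arbitrary: d)
  case Nil
  show ?case by (rule reaches_step[OF _ reaches_refl]) (simp add: sstep_control)
next
  case (Cons c e)
  have "sstep f (Put_Back i acc, [a, o', d, c # e, t, w, v]) = (Put_Back i acc, [a, o', c # d, e, t, w, v])"
    by (simp add: sstep_control)
  from reaches_step[OF this Cons.IH] show ?case by simp
qed

text \<open>The answer is a residue below \<open>p\<close>, so it has fewer than \<open>p\<close>
  bits and is read within \<open>p\<close> steps, the final one included. Stack 2 is restored for
  the next query.\<close>

lemma run_round:
  assumes "i < n" "acc < p" "f (concat (map (h i) (rev d))) = bits (binary N)" "N < p"
  shows "reaches f (Ask i acc, [[], [], d, [], t, [], []]) (2 * length d + p + 5)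
    (Ask (Suc i) ((acc + coef i * N) mod p), [[], [], d, [], t, [], []])"
proof -
  have 1: "reaches f (Ask i acc, [[], [], d, [], t, [], []]) (Suc (length d))
      (Query, [[Inr (Register i acc)], map Inl (concat (map (h i) (rev d))), [], rev d, t, [], []])"
    using run_Ask[OF assms(1), of f acc "[]" "[]" d "[]" t "[]" "[]"] by simp
  have 2: "sstep f (Query, [[Inr (Register i acc)], map Inl (concat (map (h i) (rev d))), [], rev d, t, [], []])
      = (Answer, [[Inr (Register i acc)], map Inl (bits (binary N)), [], rev d, t, [], []])"
    using assms(3) by (simp add: stack_step_def)
  have 3: "sstep f (Answer, [[Inr (Register i acc)], map Inl (bits (binary N)), [], rev d, t, [], []]) =
      (Answer_Bits i acc (coef i mod p), [[], map Inl (bits (binary N)), [], rev d, t, [], []])"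
    by (simp add: sstep_control)
  have "(acc + (coef i mod p) * N) mod p = (acc + coef i * N) mod p"
    by (metis mod_add_right_eq mod_mult_left_eq)
  then have 4: "reaches f (Answer_Bits i acc (coef i mod p), [[], map Inl (bits (binary N)), [], rev d, t, [], []])
      p (Put_Back i ((acc + coef i * N) mod p), [[], [], [], rev d, t, [], []])"
    using reaches_mono[OF run_Answer_Bits[OF assms(2), of f i "coef i mod p" "[]" "binary N"], of p]
      length_binary[of N] assms(4) by (simp add: bit_value_binary)
  have 5: "reaches f (Put_Back i ((acc + coef i * N) mod p), [[], [], [], rev d, t, [], []]) (Suc (length d))
      (Ask (Suc i) ((acc + coef i * N) mod p), [[], [], d, [], t, [], []])"
    using run_Put_Back[of f i _ "[]" "[]" "[]" "rev d"] by simp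
  show ?thesis
    by (rule reaches_trans[OF 1 reaches_step[OF 2 reaches_step[OF 3 reaches_trans[OF 4 5 order_refl]]]]) simp
qed

lemma run_rounds:
  assumes "\<And>j. j < n \<Longrightarrow> f (concat (map (h j) (rev d))) = bits (binary (N j)) \<and> N j < p"
    and "i \<le> n" "acc < p"
  shows "reaches f (Ask i acc, [[], [], d, [], t, [], []]) ((n - i) * (2 * length d + p + 5) + 1)
    (Halt, [map Inl (bits (binary ((acc + (\<Sum>j = i..<n. coef j * N j)) mod p))), [], d, [], t, [], []])"
  using assms(2,3)
proof (induction "n - i" arbitrary: i acc)
  case 0
  then have i: "n \<le> i" and acc: "(acc + (\<Sum>j = i..<n. coef j * N j)) mod p = acc" by simp_all
  have "sstep f (Ask i acc, [[], [], d, [], t, [], []]) =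
      (Halt, [map Inl (bits (binary acc)), [], d, [], t, [], []])"
    using i by (simp add: sstep_control)
  from reaches_step[OF this reaches_refl[of _ _ 0]] show ?case
    unfolding acc by (rule reaches_mono) simp
next
  case (Suc m)
  then have i: "i < n" "m = n - Suc i" by auto
  let ?acc = "(acc + coef i * N i) mod p"
  have r: "reaches f (Ask i acc, [[], [], d, [], t, [], []]) (2 * length d + p + 5)
      (Ask (Suc i) ?acc, [[], [], d, [], t, [], []])"
    using assms(1)[OF i(1)] Suc.prems(2) by (intro run_round[OF i(1)]) auto
  have "(?acc + (\<Sum>j = Suc i..<n. coef j * N j)) mod p = (acc + (\<Sum>j = i..<n. coef j * N j)) mod p"
    using i(1) by (simp add: mod_add_left_eq sum.atLeast_Suc_lessThan add.assoc)
  moreover have "reaches f (Ask (Suc i) ?acc, [[], [], d, [], t, [], []]) ((n - Suc i) * (2 * length d + p + 5) + 1)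
    (Halt, [map Inl (bits (binary ((?acc + (\<Sum>j = Suc i..<n. coef j * N j)) mod p))), [], d, [], t, [], []])"
    using i p_pos by (intro Suc.hyps(1)) auto
  moreover have "(2 * length d + p + 5) + ((n - Suc i) * (2 * length d + p + 5) + 1) \<le>
      (n - i) * (2 * length d + p + 5) + 1"
    using i by (simp add: Suc_diff_Suc[symmetric])
  ultimately show ?case using reaches_trans[OF r] by simp
qed

end

lemma encode_constraint_simp:
  "encode_constraint nm (s, ts) =
    encode_list encode_string s @ encode_list (encode_list (\<lambda>a. encode_string (nm a))) ts"
  by (simp add: encode_constraint_def)

context reduction_machine
begin

section \<open>The token string of an encoded instance\<close>

lemma parses_append:
  "parses s (x @ y) = (fst (parses (fst (parses s x)) y), snd (parses s x) @ snd (parses (fst (parses s x)) y))"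
  by (induction x arbitrary: s) simp_all

lemma length_parses: "length (snd (parses s x)) \<le> 2 * length x"
proof (induction x arbitrary: s)
  case Nil
  then show ?case by simp
next
  case (Cons c x)
  have "length (snd (parse s c)) \<le> 2"
    by (cases "(s, c)" rule: parse.cases) auto
  then show ?case using Cons[of "fst (parse s c)"] by simp
qed

lemma parses_Var_String: "parses Var_String (bits w) = (Var_String, var_bits w)"
  by (induction w) (auto simp: bits_def)

lemma parses_Vars: "parses Vars (concat (map encode_string vs)) = (Vars, concat (map var_tokens vs))"
  by (induction vs) (auto simp: encode_string_def parses_append parses_Var_String var_tokens_def)

lemma parses_Scope_String: "parses (Scope_String k) (bits w) = (Scope_String k, var_bits w)"
  by (induction w) (auto simp: bits_def)

text \<open>Counting up to 2 separates scopes of length 1 from all others and keeps the control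
  finite.\<close>

lemma parses_Scope:
  "k \<le> 2 \<Longrightarrow> parses (Scope k) (concat (map encode_string s)) =
    (Scope (min 2 (k + length s)), concat (map var_tokens s))"
proof (induction s arbitrary: k)
  case Nil
  then show ?case by simp
next
  case (Cons w s)
  have "min 2 (min 2 (Suc k) + length s) = min 2 (Suc (k + length s))" by simp
  then show ?case using Cons
    by (simp add: encode_string_def parses_append parses_Scope_String var_tokens_def)
qed

text \<open>The truncation to \<open>M\<close> bits keeps the control finite on arbitrary words; on
  names of elements it never takes effect.\<close>

lemma parses_Name:
  "length (u @ w) \<le> M \<Longrightarrow> parses (Name b S u) (bits w) = (Name b S (u @ w), map Inl (bits w))"
proof (induction w arbitrary: u)
  case Nil
  then show ?case by (simp add: bits_def)
next
  case (Cons c w)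
  then show ?case using Cons.IH[of "u @ [c]"] by (cases c) (simp_all add: bits_def)
qed

abbreviation "name_word \<equiv> \<lambda>x. encode_string (nm x)"

lemma parses_Tuple:
  "set x \<subseteq> H \<Longrightarrow> parses (Tuple b S) (concat (map name_word x)) =
    (Tuple b (S \<union> set x), map Inl (concat (map name_word x)))"
proof (induction x arbitrary: S)
  case Nil
  then show ?case by simp
next
  case (Cons y x)
  \<comment> \<open>As \<open>nm\<close> is injective, closing a name adds exactly one element to
    the collected set.\<close>
  have y: "{z \<in> H. nm z = nm y} = {y}" using Cons.prems inj_nm by (auto simp: inj_on_def)
  have "length ([] @ nm y) \<le> M" using name_length Cons.prems by simp
  from parses_Name[OF this] Cons y show ?case
    by (simp add: encode_string_def parses_append)
qed

lemma parses_Rel: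
  "\<forall>x \<in> set ts. set x \<subseteq> H \<Longrightarrow> parses (Rel b S) (concat (map (encode_list name_word) ts)) =
    (Rel b (S \<union> \<Union> (set ` set ts)), map Inl (concat (map (encode_list name_word) ts)))"
proof (induction ts arbitrary: S)
  case Nil
  then show ?case by simp
next
  case (Cons x ts)
  then show ?case
    using parses_Tuple[of x b S] by (simp add: encode_list_def parses_append Un_assoc)
qed

definition const_of :: "bool list list \<times> 'a list list \<Rightarrow> 'a option" where
  "const_of = (\<lambda>(s, ts). mark (length s = 1) (\<Union> (set ` set ts)))"

definition constraint_tokens :: "bool list list \<times> 'a list list \<Rightarrow> 'a sym list" where
  "constraint_tokens = (\<lambda>(s, ts). Inr ScopeOpen # concat (map var_tokens s) @ Inl Rpar #
     map Inl (encode_list (encode_list name_word) ts) @ [Inr (Mark (const_of (s, ts)))])"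

definition over_H :: "bool list list \<times> 'a list list \<Rightarrow> bool" where
  "over_H = (\<lambda>(s, ts). \<forall>x \<in> set ts. set x \<subseteq> H)"

lemma parses_constraint:
  "over_H c \<Longrightarrow> parses Cons_List (encode_constraint nm c) = (Cons_List, constraint_tokens c)"
proof (cases c)
  case (Pair s ts)
  assume "over_H c"
  then have ts: "\<forall>x \<in> set ts. set x \<subseteq> H" using Pair by (simp add: over_H_def)
  have "(min 2 (0 + length s) = 1) = (length s = 1)" by auto
  then show ?thesis using parses_Scope[of 0 s] parses_Rel[OF ts, of "length s = 1" "{}"] Pair
    by (simp add: encode_constraint_simp encode_list_def parses_append constraint_tokens_def const_of_def)
qed

lemma parses_constraints:
  "\<forall>c \<in> set cs. over_H c \<Longrightarrow> parses Cons_List (concat (map (encode_constraint nm) cs)) =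
    (Cons_List, concat (map constraint_tokens cs))"
  by (induction cs) (simp_all add: parses_append parses_constraint)

definition instance_tokens :: "'a presentation \<Rightarrow> 'a sym list" where
  "instance_tokens = (\<lambda>(vs, cs). [Inl Lpar, Inr FixedVars] @ concat (map var_tokens vs) @
     [Inl Rpar, Inl Lpar, Inr FixedConstraints] @ concat (map constraint_tokens cs) @ [Inl Rpar])"

lemma parses_instance:
  "\<forall>c \<in> set cs. over_H c \<Longrightarrow> snd (parses Vars_Start (encode nm (vs, cs))) = instance_tokens (vs, cs)"
  by (simp add: encode_def encode_list_def parses_append parses_Vars parses_constraints instance_tokens_def)

section \<open>Separating the pins from the other constraints\<close>

lemma unmarks_append:
  "unmarks m (x @ y) = (case unmarks m x of (m', es, ts) \<Rightarrow>
     case unmarks m' y of (m'', es', ts') \<Rightarrow> (m'', es' @ es, ts' @ ts))"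
proof (induction x arbitrary: m)
  case Nil
  then show ?case by (simp split: prod.splits)
next
  case (Cons c x)
  then show ?case by (simp split: prod.splits)
qed

lemma length_unmarks:
  "unmarks m x = (m', es, ts) \<Longrightarrow> length es + length ts \<le> length x"
proof (induction x arbitrary: m m' es ts)
  case Nil
  then show ?case by simp
next
  case (Cons c x)
  obtain m1 es1 ts1 where 1: "unmark m c = (m1, es1, ts1)" by (cases "unmark m c")
  obtain m2 es2 ts2 where 2: "unmarks m1 x = (m2, es2, ts2)" by (cases "unmarks m1 x")
  have "length es1 + length ts1 \<le> 1"
    by (cases "(m, c)" rule: unmark.cases) (use 1 in auto)
  moreover have "es = es2 @ es1" "ts = ts2 @ ts1" using Cons.prems 1 2 by simp_all
  ultimately show ?case using Cons.IH[OF 2] by simp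
qed

lemma unmarks_copy:
  assumes "Inr ScopeOpen \<notin> set x" "\<And>m. Inr (Mark m) \<notin> set x"
  shows "unmarks None (rev x) = (None, x, [])"
  using assms
proof (induction x)
  case Nil
  then show ?case by simp
next
  case (Cons c x)
  have "unmark None c = (None, [c], [])"
    by (cases "(None :: 'a option, c)" rule: unmark.cases) (use Cons.prems in auto)
  then show ?case using Cons by (simp add: unmarks_append)
qed

fun table_token :: "'a \<Rightarrow> 'a sym \<Rightarrow> 'a sym list" where
  "table_token x (Inr VarOpen) = [Inr (Key x)]"
| "table_token x (Inr (VarBit b)) = [Inr (VarBit b)]"
| "table_token x c = []"

lemma unmarks_skip:
  assumes "Inr ScopeOpen \<notin> set y"
  shows "unmarks (Some x) (rev y) = (Some x, [], concat (map (table_token x) y))"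
  using assms
proof (induction y)
  case Nil
  then show ?case by simp
next
  case (Cons c y)
  have "unmark (Some x) c = (Some x, [], table_token x c)"
    by (cases "(x, c)" rule: table_token.cases) (use Cons.prems in auto)
  then show ?case using Cons by (simp add: unmarks_append)
qed

text \<open>\<open>hd\<close> is harmless, since \<open>const_of\<close> recognizes a constant only
  if the scope has length 1.\<close>

definition entries :: "(bool list list \<times> 'a list list) list \<Rightarrow> ('a \<times> bool list) list" where
  "entries cs = concat (map (\<lambda>c. case const_of c of None \<Rightarrow> [] | Some x \<Rightarrow> [(x, hd (fst c))]) cs)"

definition constraint_items :: "bool list list \<times> 'a list list \<Rightarrow> ('a sym + bool list) list" where
  "constraint_items = (\<lambda>(s, ts). Inl (Inl Lpar) # map Inr s @ Inl (Inl Rpar) #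
     map (\<lambda>l. Inl (Inl l)) (encode_list (encode_list name_word) ts))"

definition proper :: "(bool list list \<times> 'a list list) list \<Rightarrow> (bool list list \<times> 'a list list) list" where
  "proper cs = filter (\<lambda>c. const_of c = None) cs"

definition instance_items :: "'a presentation \<Rightarrow> ('a sym + bool list) list" where
  "instance_items = (\<lambda>(vs, cs). [Inl (Inl Lpar), Inl (Inr FixedVars)] @ map Inr vs @
     [Inl (Inl Rpar), Inl (Inl Lpar), Inl (Inr FixedConstraints)] @
     concat (map constraint_items (proper cs)) @ [Inl (Inl Rpar)])"

lemma item_tokens_simps:
  "concat (map item_tokens (map Inr vs)) = concat (map var_tokens vs)"
  "concat (map item_tokens (map (\<lambda>l. Inl (Inl l)) x)) = map Inl x"
  "item_tokens (Inl c) = [c]"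
  by (induction vs; simp add: item_tokens_def) (induction x; simp add: item_tokens_def)+

lemma var_tokens_plain: "Inr ScopeOpen \<notin> set (var_tokens w)" "Inr (Mark m) \<notin> set (var_tokens w)"
  by (auto simp: var_tokens_def)

lemma table_tokens_var: "concat (map (table_token x) (var_tokens w)) = Inr (Key x) # var_bits w"
proof -
  have "concat (map (table_token x) (var_bits w)) = var_bits w" by (induction w) auto
  then show ?thesis by (simp add: var_tokens_def)
qed

lemma table_tokens_letters: "concat (map (table_token x) (map Inl y)) = []"
  by (induction y) auto

lemma unmarks_constraint:
  "unmarks None (rev (constraint_tokens c)) = (None,
    (if const_of c = None then concat (map item_tokens (constraint_items c)) else []),
    concat (map entry_tokens (entries [c])))"
proof -
  obtain s ts where c: "c = (s, ts)" by (cases c)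
  let ?y = "concat (map var_tokens s) @ Inl Rpar # map Inl (encode_list (encode_list name_word) ts)"
  have y: "Inr ScopeOpen \<notin> set ?y" "\<And>m. Inr (Mark m) \<notin> set ?y"
    using var_tokens_plain by auto
  have tok: "rev (constraint_tokens c) = [Inr (Mark (const_of c))] @ rev ?y @ [Inr ScopeOpen]"
    by (simp add: constraint_tokens_def c)
  show ?thesis
  proof (cases "const_of c")
    case None
    have "unmarks None (rev ?y @ [Inr ScopeOpen]) = (None, Inl Lpar # ?y, [])"
      using unmarks_copy[OF y] by (simp only: unmarks_append) simp
    moreover have "concat (map item_tokens (constraint_items c)) = Inl Lpar # ?y"
      by (simp add: constraint_items_def c item_tokens_simps del: map_map)
    ultimately show ?thesis unfolding tok using None by (simp add: entries_def)
  next
    case (Some x)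
    \<comment> \<open>The unary scope provides the single variable of which the entry
      consists.\<close>
    then obtain w where s: "s = [w]"
      by (cases s) (auto simp: const_of_def c mark_def split: if_splits)
    have "concat (map (table_token x) ?y) = entry_tokens (x, w)"
      using table_tokens_letters[of x "encode_list (encode_list name_word) ts"]
      by (simp add: s table_tokens_var entry_tokens_def del: map_map)
    then have "unmarks (Some x) (rev ?y @ [Inr ScopeOpen]) = (None, [], entry_tokens (x, w))"
      using unmarks_skip[OF y(1), of x] by (simp only: unmarks_append) simp
    then show ?thesis unfolding tok using Some by (simp add: entries_def c s)
  qed
qed

lemma unmarks_constraints:
  "unmarks None (rev (concat (map constraint_tokens cs))) = (None,
    concat (map item_tokens (concat (map constraint_items (proper cs)))),
    concat (map entry_tokens (entries cs)))"
proof (induction cs)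
  case Nil
  then show ?case by (simp add: proper_def entries_def)
next
  case (Cons c cs)
  have "entries (c # cs) = entries [c] @ entries cs" by (simp add: entries_def)
  then show ?case using Cons by (simp add: unmarks_append unmarks_constraint proper_def)
qed

lemma unmarks_instance:
  "unmarks None (rev (instance_tokens (vs, cs))) = (None,
    concat (map item_tokens (instance_items (vs, cs))), concat (map entry_tokens (entries cs)))"
proof -
  define A :: "'a sym list" where "A = [Inl Lpar, Inr FixedVars] @ concat (map var_tokens vs) @
    [Inl Rpar, Inl Lpar, Inr FixedConstraints]"
  have 1: "unmarks None (rev A) = (None, A, [])"
    by (rule unmarks_copy) (use var_tokens_plain in \<open>auto simp: A_def\<close>)
  have 2: "rev (instance_tokens (vs, cs)) = Inl Rpar # rev (concat (map constraint_tokens cs)) @ rev A"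
    by (simp add: instance_tokens_def A_def)
  have "unmarks None (rev (concat (map constraint_tokens cs)) @ rev A) =
      (None, A @ concat (map item_tokens (concat (map constraint_items (proper cs)))),
        concat (map entry_tokens (entries cs)))"
    unfolding unmarks_append unmarks_constraints 1 prod.case by simp
  then show ?thesis
    unfolding 2 by (simp add: instance_items_def item_tokens_simps A_def del: map_map)
qed

lemma no_VarOpen_item: "Inl (Inr VarOpen) \<notin> set (instance_items P)"
  by (cases P) (auto simp: instance_items_def constraint_items_def)

lemma Inr_item: "Inr u \<in> set (instance_items (vs, cs)) \<longleftrightarrow>
    u \<in> set vs \<or> (\<exists>(s, ts) \<in> set (proper cs). u \<in> set s)"
  by (fastforce simp: instance_items_def constraint_items_def)

definition query_word :: "nat \<Rightarrow> 'a presentation \<Rightarrow> word" where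
  "query_word i = (\<lambda>(vs, cs).
     concat (map (h i) (concat (map (out_tokens (entries cs)) (instance_items (vs, cs))))))"

text \<open>On an input of length L the phases add up to at most 8 L^2 + (8 n + 15) L + n p + 5 n +
  4 steps; the coefficients are rounded up generously.\<close>

definition time_poly :: "nat poly" where
  "time_poly = [:p * n + 5 * n + 10, 8 * n + 40, 16:]"

lemma length_out_tokens:
  "length (concat (map (out_tokens E) its)) \<le> 2 * length (concat (map item_tokens its))"
proof (induction its)
  case Nil
  then show ?case by simp
next
  case (Cons it its)
  have "length (out_tokens E it) \<le> 2 * length (item_tokens it)"
    by (cases it) (auto simp: out_tokens_def item_tokens_def subst_tokens_def var_tokens_def
        encode_string_def bits_def)
  then show ?case using Cons by simp
qed

text \<open>Correct answers are assumed only in the absence of conflicting pins, because otherwise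
  the machine stops before its first query.\<close>

theorem machine_run:
  assumes H: "\<forall>c \<in> set cs. over_H c"
    and used: "\<And>s ts. (s, ts) \<in> set cs \<Longrightarrow> set s \<subseteq> set vs"
    and f: "\<And>j. (\<And>u. u \<in> set vs \<Longrightarrow> functional_at (entries cs) u) \<Longrightarrow> j < n \<Longrightarrow>
      f (query_word j (vs, cs)) = bits (binary (N j)) \<and> N j < p"
  defines "x \<equiv> encode nm (vs, cs)"
  shows "\<exists>m \<le> poly time_poly (length x). \<exists>ss.
    (sstep f ^^ m) (Parse Vars_Start, map Inl x # replicate (7 - 1) []) = (Halt, ss) \<and>
    stack_word (ss ! 0) = (if \<forall>u \<in> set vs. functional_at (entries cs) u
      then bits (binary ((\<Sum>j<n. coef j * N j) mod p)) else [])"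
proof -
  define E where "E = entries cs"
  define its where "its = instance_items (vs, cs)"
  define T where "T = concat (map entry_tokens E)"
  define I where "I = concat (map item_tokens its)"
  define d where "d = rev (concat (map (out_tokens E) its))"
  let ?toks = "instance_tokens (vs, cs)"
  let ?start = "(Parse Vars_Start, map Inl x # replicate (7 - 1) [])"
  have start: "?start = (Parse Vars_Start, [map Inl x, [], [], [], [], [], []])"
    by (simp add: eval_nat_numeral)
  have parse: "reaches f ?start (Suc (length x)) (Unmark None, [[], [], rev ?toks, [], [], [], []])"
    unfolding start using run_Parse[of f Vars_Start x "[]" "[]" "[]" "[]" "[]" "[]"]
      parses_instance[OF H, of vs] by (simp add: x_def)
  have toks: "length ?toks \<le> 2 * length x"
    using length_parses[of Vars_Start x] parses_instance[OF H, of vs] by (simp add: x_def)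
  have um: "unmarks None (rev ?toks) = (None, I, T)"
    by (simp only: unmarks_instance I_def T_def E_def its_def)
  have len: "length I + length T \<le> 2 * length x"
    using length_unmarks[OF um] toks by simp
  have unmark: "reaches f (Unmark None, [[], [], rev ?toks, [], [], [], []]) (Suc (2 * length x))
      (Read, [[], [], [], I, T, [], []])"
    using reaches_mono[OF run_Unmark[OF um, of f "[]" "[]" "[]" "[]" "[]" "[]"]] toks by simp
  have before: "reaches f ?start (3 * length x + 2) (Read, [[], [], [], I, T, [], []])"
    by (rule reaches_trans[OF parse unmark]) simp
  \<comment> \<open>The only quadratic phase: each variable of the instance requires a pass through
    the table of pins.\<close>
  have read_time: "Suc (2 * (length T + 3) * length I) \<le> 8 * length x * length x + 12 * length x + 1"
  proof -
    have "(length T + 3) * length I \<le> (2 * length x + 3) * (2 * length x)"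
      using len by (intro mult_le_mono) auto
    then show ?thesis by (simp add: algebra_simps)
  qed
  have no: "Inl (Inr VarOpen) \<notin> set its" by (simp add: its_def no_VarOpen_item)
  have vars: "Inr u \<in> set its \<longleftrightarrow> u \<in> set vs" for u
    using used by (auto simp: its_def Inr_item proper_def)
  show ?thesis
  proof (cases "\<forall>u \<in> set vs. functional_at E u")
    case True
    have "reaches f (Read, [[], [], [], I, T, [], []]) (Suc (2 * (length T + 3) * length I))
        (Ask 0 0, [[], [], d, [], T, [], []])"
      using run_Read[OF no, of E f "[]" "[]"] True vars by (simp add: I_def T_def d_def)
    note read = reaches_mono[OF this read_time]
    have "f (concat (map (h j) (rev d))) = bits (binary (N j)) \<and> N j < p" if "j < n" for j
      using f[OF _ that] True by (simp add: query_word_def d_def E_def its_def)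
    from run_rounds[where f = f and d = d and N = N and i = 0 and acc = 0 and t = T, OF this] p_pos
    have rounds: "reaches f (Ask 0 0, [[], [], d, [], T, [], []]) (n * (2 * length d + p + 5) + 1)
      (Halt, [map Inl (bits (binary ((\<Sum>j<n. coef j * N j) mod p))), [], d, [], T, [], []])"
      by (simp add: lessThan_atLeast0)
    have "length d \<le> 4 * length x"
      using length_out_tokens[of E its] len by (simp add: d_def I_def)
    then have "n * (2 * length d + p + 5) \<le> n * (8 * length x + p + 5)"
      by (intro mult_le_mono2) simp
    moreover have "3 * length x + 2 + (8 * length x * length x + 12 * length x + 1 + (n * (8 * length x + p + 5) + 1))
        \<le> poly time_poly (length x)"
      by (simp add: time_poly_def algebra_simps)
    ultimately have "3 * length x + 2 + (8 * length x * length x + 12 * length x + 1 + (n * (2 * length d + p + 5) + 1))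
        \<le> poly time_poly (length x)"
      by linarith
    from reaches_trans[OF before reaches_trans[OF read rounds order_refl] this]
    show ?thesis using True unfolding reaches_def E_def by auto
  next
    case False
    then obtain u where u: "u \<in> set vs" "\<not> functional_at E u" by blast
    obtain ss where "reaches f (Read, [[], [], [], I, T, [], []]) (Suc (2 * (length T + 3) * length I)) (Halt, [] # ss)"
      using run_Read_fail[OF no _ u(2), of f "[]" "[]"] u(1) vars by (auto simp: I_def T_def)
    from reaches_trans[OF before reaches_mono[OF this read_time], of "poly time_poly (length x)"]
    have "reaches f ?start (poly time_poly (length x)) (Halt, [] # ss)"
      by (simp add: time_poly_def algebra_simps)
    moreover have "stack_word ([] :: 'a sym list) = []" by (simp add: stack_word_def)
    ultimately show ?thesis using False unfolding reaches_def E_def by auto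
  qed
qed

end

section \<open>Correctness of the reduction\<close>

text \<open>The queries differ only in \<open>\<theta>\<close>, which affects nothing but the
  element variables. Each query word is therefore the image of the same token string under a
  homomorphism that a finite control can apply symbol by symbol.\<close>

fun query_hom ::
    "('a \<Rightarrow> bool list) \<Rightarrow> 'a list \<Rightarrow> 'a list list list \<Rightarrow> ('a \<Rightarrow> 'a) \<Rightarrow> 'a sym \<Rightarrow> word" where
  "query_hom nm hs rels \<theta> (Inl l) = [l]"
| "query_hom nm hs rels \<theta> (Inr (Const x)) = encode_string (elem_var nm (\<theta> x))"
| "query_hom nm hs rels \<theta> (Inr FixedVars) = concat (map (\<lambda>x. encode_string (elem_var nm (\<theta> x))) hs)"
| "query_hom nm hs rels \<theta> (Inr FixedConstraints) =
     concat (map (encode_constraint nm) (copy_constraints nm rels \<theta>))"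
| "query_hom nm hs rels \<theta> _ = []"

abbreviation (input) star :: "'a set \<Rightarrow> 'a relation set \<Rightarrow> 'a relation set" where
  "star H \<Gamma> \<equiv> \<Gamma> \<union> {constant_relation a | a. a \<in> H}"

lemma constraint_language_star:
  assumes "constraint_language H \<Gamma>"
  shows "constraint_language H (star H \<Gamma>)"
proof -
  have "\<forall>(m, R) \<in> {constant_relation a | a. a \<in> H}. R \<subseteq> tuples H m"
    by (auto simp: constant_relation_def tuples_def)
  then show ?thesis using assms unfolding constraint_language_def by blast
qed

context reduction_machine
begin

section \<open>Constant constraints as pins\<close>

definition pin :: "('a \<times> bool list) list \<Rightarrow> bool list \<Rightarrow> 'a option" where
  "pin E w = (if keys E w = {} then None else Some (the_elem (keys E w)))"

lemma pin_eq_Some: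
  assumes "functional_at E w"
  shows "pin E w = Some x \<longleftrightarrow> (x, w) \<in> set E"
proof -
  have mem: "(x, w) \<in> set E \<longleftrightarrow> x \<in> keys E w" by (simp add: keys_def)
  show ?thesis
  proof (cases "keys E w = {}")
    case True
    then show ?thesis unfolding mem by (simp add: pin_def)
  next
    case False
    then obtain a where "keys E w = {a}"
      using assms by (auto simp: functional_at_def elim: is_singletonE)
    then show ?thesis unfolding mem by (auto simp: pin_def)
  qed
qed

text \<open>Encodings are concatenations between brackets, so the homomorphism acts on each item
  separately; the placeholders stand right after the opening brackets, where
  \<open>collapsed\<close> puts the additional variables and constraints.\<close>

lemma query_word_collapsed:
  assumes "h i = query_hom nm hs rels \<theta>"
  shows "query_word i (vs, cs) = encode nm (collapsed nm hs rels (pin (entries cs)) (vs, proper cs) \<theta>)"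
proof -
  let ?E = "entries cs" and ?sub = "subst_var nm (pin (entries cs)) \<theta>"
  define g where "g it = concat (map (h i) (out_tokens ?E it))" for it
  have g: "concat (map (h i) (concat (map (out_tokens ?E) its))) = concat (map g its)" for its
    by (induction its) (simp_all add: g_def)
  have g_Inl: "g (Inl c) = query_hom nm hs rels \<theta> c" for c
    by (simp add: g_def out_tokens_def assms)
  have letters: "concat (map (query_hom nm hs rels \<theta>) (map Inl x)) = x" for x
    by (induction x) simp_all
  have g_Inr: "g (Inr w) = encode_string (?sub w)" for w
    using letters by (simp add: g_def out_tokens_def subst_tokens_def subst_var_def pin_def assms)
  have vars: "concat (map g (map Inr s)) = concat (map encode_string (map ?sub s))" for s
    by (induction s) (simp_all add: g_Inr)
  have lets: "concat (map g (map (\<lambda>l. Inl (Inl l)) x)) = x" for x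
    by (induction x) (simp_all add: g_Inl)
  have con: "concat (map g (constraint_items c)) = encode_constraint nm (case c of (s, ts) \<Rightarrow> (map ?sub s, ts))" for c
  proof (cases c)
    case (Pair s ts)
    then show ?thesis
      by (simp add: constraint_items_def vars lets g_Inl encode_constraint_simp
          encode_list_def[of encode_string] del: map_map)
  qed
  have cons: "concat (map g (concat (map constraint_items ds))) =
      concat (map (encode_constraint nm) (map (\<lambda>(s, ts). (map ?sub s, ts)) ds))" for ds
    by (induction ds) (simp_all add: con del: map_map)
  have elems: "concat (map (\<lambda>x. encode_string (elem_var nm (\<theta> x))) hs) =
      concat (map encode_string (map (\<lambda>x. elem_var nm (\<theta> x)) hs))"
    by (simp add: comp_def)
  show ?thesis
    unfolding query_word_def prod.case g
    by (simp add: instance_items_def vars cons g_Inl collapsed_def encode_def encode_list_def elems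
        del: map_map)
qed

lemma star_constraint:
  assumes "constraint_language H \<Gamma>" "csp_instance (star H \<Gamma>) (presented (vs, cs))" "(s, ts) \<in> set cs"
  shows "(length s, set ts) \<in> star H \<Gamma>" "set s \<subseteq> set vs" "set ts \<subseteq> tuples H (length s)"
proof -
  show 1: "(length s, set ts) \<in> star H \<Gamma>" and "set s \<subseteq> set vs"
    using assms(2,3) by (force simp: csp_instance_def presented_def)+
  show "set ts \<subseteq> tuples H (length s)"
    using constraint_language_star[OF assms(1)] 1 unfolding constraint_language_def by blast
qed

text \<open>The machine inspects only the arity and the occurring elements. In a well-formed
  instance all tuples of this constraint have length 1, and there is one because an element occurs,
  so the relation is exactly the constant.\<close>

lemma const_of_Some:
  assumes "constraint_language H \<Gamma>" "csp_instance (star H \<Gamma>) (presented (vs, cs))" "(s, ts) \<in> set cs"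
    "const_of (s, ts) = Some x"
  shows "x \<in> H" "s = [hd s]" "set ts = {[x]}"
proof -
  have s: "length s = 1" and x: "\<Union> (set ` set ts) = {x}"
    using assms(4) by (auto simp: const_of_def mark_def is_singleton_def split: if_splits)
  have t: "t = [x]" if "t \<in> set ts" for t
  proof -
    have "length t = 1" using star_constraint(3)[OF assms(1-3)] that s by (auto simp: tuples_def)
    then obtain y where "t = [y]" by (auto simp: length_Suc_conv)
    moreover have "set t \<subseteq> {x}" using x that by blast
    ultimately show ?thesis by simp
  qed
  moreover have "ts \<noteq> []" using x by auto
  ultimately show ts: "set ts = {[x]}" by (cases ts) auto
  show "s = [hd s]" using s by (cases s) auto
  show "x \<in> H" using star_constraint(3)[OF assms(1-3)] ts by (auto simp: tuples_def)
qed

text \<open>The extended language adds only constants to \<open>\<Gamma>\<close>, and constants are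
  always recognized. Hence the constraints that are kept may be passed to the oracle.\<close>

lemma const_of_None:
  assumes "constraint_language H \<Gamma>" "csp_instance (star H \<Gamma>) (presented (vs, cs))" "(s, ts) \<in> set cs"
    "const_of (s, ts) = None"
  shows "(length s, set ts) \<in> \<Gamma>"
proof (rule ccontr)
  assume "(length s, set ts) \<notin> \<Gamma>"
  then obtain a where a: "length s = 1" "set ts = {[a]}"
    using star_constraint(1)[OF assms(1-3)] by (auto simp: constant_relation_def)
  then show False using assms(4) by (simp add: const_of_def mark_def is_singleton_def)
qed

lemma entries_iff:
  "(x, w) \<in> set (entries cs) \<longleftrightarrow> (\<exists>c \<in> set cs. const_of c = Some x \<and> w = hd (fst c))"
proof -
  have "(x, w) \<in> set (case const_of c of None \<Rightarrow> [] | Some x \<Rightarrow> [(x, hd (fst c))]) \<longleftrightarrow>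
      const_of c = Some x \<and> w = hd (fst c)" for c
    by (cases "const_of c") auto
  then show ?thesis by (simp add: entries_def del: split_paired_Ex)
qed

text \<open>A constraint that is recognized as a constant imposes the same condition as its entry in
  the table; the others are kept unchanged.\<close>

lemma satisfies_split:
  assumes "constraint_language H \<Gamma>" "csp_instance (star H \<Gamma>) (presented (vs, cs))"
  shows "(\<forall>(s, ts) \<in> set cs. map \<phi> s \<in> set ts) \<longleftrightarrow>
    (\<forall>(s, ts) \<in> set (proper cs). map \<phi> s \<in> set ts) \<and> (\<forall>(x, w) \<in> set (entries cs). \<phi> w = x)"
proof -
  have pinned: "map \<phi> s \<in> set ts \<longleftrightarrow> \<phi> (hd s) = x" if c: "(s, ts) \<in> set cs" "const_of (s, ts) = Some x" for s ts x
  proof -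
    obtain w where "s = [w]" using const_of_Some(2)[OF assms c] by blast
    then show ?thesis using const_of_Some(3)[OF assms c] by simp
  qed
  show ?thesis
  proof
    assume all: "\<forall>(s, ts) \<in> set cs. map \<phi> s \<in> set ts"
    have "\<phi> w = x" if xw: "(x, w) \<in> set (entries cs)" for x w
    proof -
      obtain c where c: "c \<in> set cs" "const_of c = Some x" "w = hd (fst c)"
        using xw unfolding entries_iff by blast
      obtain s ts where st: "c = (s, ts)" by (cases c)
      have "map \<phi> s \<in> set ts" using all c(1) st by blast
      then show ?thesis using pinned[of s ts x] c st by simp
    qed
    moreover have "set (proper cs) \<subseteq> set cs" by (simp add: proper_def)
    ultimately show "(\<forall>(s, ts) \<in> set (proper cs). map \<phi> s \<in> set ts) \<and> (\<forall>(x, w) \<in> set (entries cs). \<phi> w = x)"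
      using all by blast
  next
    assume r: "(\<forall>(s, ts) \<in> set (proper cs). map \<phi> s \<in> set ts) \<and> (\<forall>(x, w) \<in> set (entries cs). \<phi> w = x)"
    have "map \<phi> s \<in> set ts" if c: "(s, ts) \<in> set cs" for s ts
    proof (cases "const_of (s, ts)")
      case None
      then have "(s, ts) \<in> set (proper cs)" using c by (simp add: proper_def)
      then show ?thesis using r by blast
    next
      case (Some x)
      have "(x, hd s) \<in> set (entries cs)"
        unfolding entries_iff using c Some by (intro bexI[of _ "(s, ts)"]) simp_all
      then have "\<phi> (hd s) = x" using r by blast
      then show ?thesis using pinned[OF c Some] by simp
    qed
    then show "\<forall>(s, ts) \<in> set cs. map \<phi> s \<in> set ts" by blast
  qed
qed

lemma entries_mem:
  assumes "constraint_language H \<Gamma>" "csp_instance (star H \<Gamma>) (presented (vs, cs))" "(x, w) \<in> set (entries cs)"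
  shows "x \<in> H" "w \<in> set vs"
proof -
  obtain c where c': "c \<in> set cs" "const_of c = Some x" "w = hd (fst c)"
    using assms(3) unfolding entries_iff by blast
  obtain s ts where st: "c = (s, ts)" by (cases c)
  have c: "(s, ts) \<in> set cs" "const_of (s, ts) = Some x" "w = hd s"
    using c' st by simp_all
  show "x \<in> H" by (rule const_of_Some(1)[OF assms(1,2) c(1,2)])
  have "hd s \<in> set s" using const_of_Some(2)[OF assms(1,2) c(1,2)] by (metis list.set_intros(1))
  then show "w \<in> set vs" using star_constraint(2)[OF assms(1,2) c(1)] c(3) by blast
qed

end

lemma solvesD: "solves f A \<Longrightarrow> (x, y) \<in> A \<Longrightarrow> f x = y"
  by (auto simp: solves_def)

section \<open>Division modulo the prime\<close>

lemma mod_inverse_int: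
  assumes "prime p" "\<not> p dvd k"
  shows "\<exists>u. (u * int k) mod int p = 1"
proof -
  have "coprime p k" by (rule prime_imp_coprime[OF assms])
  then have "gcd (int p) (int k) = 1" by (intro coprime_imp_gcd_eq_1) simp
  moreover obtain v u where "v * int p + u * int k = gcd (int p) (int k)"
    using bezout_int by blast
  ultimately have "(v * int p + u * int k) mod int p = 1 mod int p" by (simp only:)
  moreover have "(v * int p + u * int k) mod int p = (u * int k) mod int p" by simp
  moreover have "1 mod int p = 1" using prime_gt_1_nat[OF assms(1)] by simp
  ultimately have "(u * int k) mod int p = 1" by (simp only:)
  then show ?thesis by blast
qed

text \<open>The inverse \<open>u\<close> of \<open>k\<close> is absorbed into the coefficients.
  Signs disappear by passing to residues, because the machine adds natural numbers, and it sees each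
  \<open>N j\<close> only modulo \<open>p\<close>.\<close>

lemma sum_coefficients_mod:
  fixes c :: "nat \<Rightarrow> int" and N :: "nat \<Rightarrow> nat"
  assumes "0 < p" "(\<Sum>j<n. c j * int (N j)) = int k * int m" "(u * int k) mod int p = 1"
  shows "(\<Sum>j<n. nat (u * c j mod int p) * (N j mod p)) mod p = m mod p"
proof -
  have nn: "int (nat (u * c j mod int p)) = u * c j mod int p" for j
    using assms(1) by simp
  have "int ((\<Sum>j<n. nat (u * c j mod int p) * (N j mod p)) mod p) =
      (\<Sum>j<n. (u * c j mod int p) * (int (N j) mod int p)) mod int p"
    by (simp only: zmod_int of_nat_sum of_nat_mult nn)
  also have "\<dots> = (\<Sum>j<n. ((u * c j mod int p) * (int (N j) mod int p)) mod int p) mod int p"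
    by (simp only: mod_sum_eq)
  also have "\<dots> = (\<Sum>j<n. ((u * c j) * int (N j)) mod int p) mod int p"
    by (simp only: mod_mult_eq)
  also have "\<dots> = (\<Sum>j<n. (u * c j) * int (N j)) mod int p"
    by (simp only: mod_sum_eq)
  also have "(\<Sum>j<n. (u * c j) * int (N j)) = u * int k * int m"
    by (simp only: mult.assoc sum_distrib_left[symmetric] assms(2))
  also have "(u * int k * int m) mod int p = ((u * int k) mod int p * int m) mod int p"
    by (simp add: mod_mult_left_eq)
  also have "\<dots> = int (m mod p)" using assms(3) by (simp add: zmod_int)
  finally show ?thesis by linarith
qed

theorem theorem4p5:
  fixes p :: nat and H :: "'a set" and \<Gamma> :: "'a relation set" and nm :: "'a \<Rightarrow> bool list"
  assumes "prime p"
    and "finite H"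
    and "constraint_language H \<Gamma>"
    and "p_rigid p H \<Gamma>"
    and "inj_on nm H"
  shows "poly_time_reducible
    (count_csp_mod p nm H (\<Gamma> \<union> {constant_relation a | a. a \<in> H}))
    (count_csp_mod p nm H \<Gamma>)"
proof -
  have p0: "0 < p" using prime_gt_0_nat[OF assms(1)] .
  obtain hs where hs: "set hs = H" using finite_list[OF assms(2)] by blast
  obtain \<Delta> where \<Delta>: "\<Delta> \<subseteq> \<Gamma>" "finite \<Delta>" "automorphisms H \<Delta> = automorphisms H \<Gamma>"
    using ex_finite_sublanguage[OF assms(2), of \<Gamma>] by blast
  obtain ds where ds: "set ds = \<Delta>" using finite_list[OF \<Delta>(2)] by blast
  \<comment> \<open>Relations on a finite set are finite, so such a list exists; repetitions in it
    merely repeat constraints.\<close>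
  define lst where "lst c = (SOME l. set l = snd c)" for c :: "'a relation"
  have lst: "set (lst (m, R)) = R" if "(m, R) \<in> \<Delta>" for m R
  proof -
    have "R \<subseteq> tuples H m" using that \<Delta>(1) assms(3) unfolding constraint_language_def by blast
    then have "finite R" using finite_subset[OF _ finite_tuples[OF assms(2)]] by blast
    then have "\<exists>l. set l = snd (m, R)" by (simp add: finite_list)
    then have "set (lst (m, R)) = snd (m, R)" unfolding lst_def by (rule someI_ex)
    then show ?thesis by simp
  qed
  define rels where "rels = map lst ds"
  have rels: "\<exists>m. (m, set r) \<in> \<Gamma>" if r: "r \<in> set rels" for r
  proof -
    obtain m R where "(m, R) \<in> \<Delta>" "r = lst (m, R)" using r ds by (auto simp: rels_def)
    then show ?thesis using lst \<Delta>(1) by auto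
  qed
  have rels_auto: "f \<in> automorphisms H \<Gamma>"
    if f: "f \<in> H \<rightarrow>\<^sub>E H" "inj_on f H" "\<And>r t. r \<in> set rels \<Longrightarrow> t \<in> set r \<Longrightarrow> map f t \<in> set r" for f
  proof -
    have "constraint_language H \<Delta>" using assms(3) \<Delta>(1) unfolding constraint_language_def by blast
    moreover have "map f t \<in> R" if mR: "(m, R) \<in> \<Delta>" and t: "t \<in> R" for m R t
    proof -
      have "lst (m, R) \<in> set rels" using mR ds by (simp add: rels_def)
      then show ?thesis using f(3)[of "lst (m, R)" t] lst[OF mR] t by simp
    qed
    ultimately have "f \<in> automorphisms H \<Delta>"
      by (intro injective_endomorphism_automorphism[OF assms(2) _ f(1,2)])
    then show ?thesis using \<Delta>(3) by simp
  qed
  let ?P = "Pow (distinct_pairs H)"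
  have finP: "finite ?P" using finite_distinct_pairs[OF assms(2)] by simp
  have "\<exists>\<theta>. collapses H S \<theta>" if "S \<in> ?P" for S
  proof (rule ex_collapse)
    show "S \<subseteq> H \<times> H" using that by (auto simp: distinct_pairs_def)
    then show "finite S" using assms(2) finite_subset by blast
  qed
  then obtain \<theta> where \<theta>: "\<And>S. S \<in> ?P \<Longrightarrow> collapses H S (\<theta> S)" by metis
  obtain Ss where Ss: "set Ss = ?P" "distinct Ss" using finite_distinct_list[OF finP] by blast
  \<comment> \<open>Rigidity enters here: \<open>p\<close> does not divide the number of
    automorphisms.\<close>
  obtain u where u: "(u * int (card (automorphisms H \<Gamma>))) mod int p = 1"
    using mod_inverse_int[OF assms(1) p_rigid_not_dvd[OF assms(1,2,4)]] by blast
  define n where "n = length Ss"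
  define h where "h i = query_hom nm hs rels (\<theta> (Ss ! i))" for i
  \<comment> \<open>The sign from inclusion and exclusion times the inverse of the number of
    automorphisms, as a natural residue.\<close>
  define coef where "coef i = nat (u * (- 1) ^ card (Ss ! i) mod int p)" for i
  define M where "M = (\<Sum>a \<in> H. length (nm a))"
  have M: "length (nm a) \<le> M" if "a \<in> H" for a
    unfolding M_def using assms(2) that by (intro member_le_sum) auto
  interpret reduction_machine H nm M p n h coef
    by unfold_locales (use assms p0 M in auto)
  show ?thesis
  proof (rule poly_time_reducible_stack[where P = time_poly])
    fix f x y
    assume f: "solves f (count_csp_mod p nm H \<Gamma>)" and "(x, y) \<in> count_csp_mod p nm H (star H \<Gamma>)"
    then obtain P where P: "x = encode nm P" "y = bits (binary (card (solutions H (presented P)) mod p))"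
      "csp_instance (star H \<Gamma>) (presented P)"
      unfolding count_csp_mod_def by blast
    obtain vs cs where "P = (vs, cs)" by (cases P)
    with P have x: "x = encode nm (vs, cs)"
      and y: "y = bits (binary (card (solutions H (presented (vs, cs))) mod p))"
      and inst: "csp_instance (star H \<Gamma>) (presented (vs, cs))"
      by simp_all
    note star = star_constraint[OF assms(3) inst]
    let ?E = "entries cs"
    let ?K = "pin ?E"
    let ?Q = "\<lambda>S. collapsed nm hs rels ?K (vs, proper cs) (\<theta> S)"
    let ?N = "\<lambda>j. card (solutions H (presented (?Q (Ss ! j))))"
    have over: "\<forall>c \<in> set cs. over_H c"
    proof
      fix c assume c: "c \<in> set cs"
      obtain s ts where st: "c = (s, ts)" by (cases c)
      show "over_H c" using star(3)[of s ts] c st by (auto simp: over_H_def tuples_def)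
    qed
    have pinned: "pinned_instance H nm \<Gamma> hs rels ?K vs (proper cs)"
      if fn: "\<And>w. w \<in> set vs \<Longrightarrow> functional_at ?E w"
    proof (unfold_locales)
      show "finite H" "inj_on nm H" "constraint_language H \<Gamma>" "set hs = H" by fact+
      show "\<exists>m. (m, set r) \<in> \<Gamma>" if "r \<in> set rels" for r using rels[OF that] .
      show "f \<in> automorphisms H \<Gamma>" if "f \<in> H \<rightarrow>\<^sub>E H" "inj_on f H"
        "\<And>r t. r \<in> set rels \<Longrightarrow> t \<in> set r \<Longrightarrow> map f t \<in> set r" for f
        by (rule rels_auto[OF that])
      show "(length s, set ts) \<in> \<Gamma> \<and> set s \<subseteq> set vs" if "(s, ts) \<in> set (proper cs)" for s ts
        using that const_of_None[OF assms(3) inst, of s ts] star(2)[of s ts] by (auto simp: proper_def)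
      show "a \<in> H" if "w \<in> set vs" "?K w = Some a" for w a
      proof (rule entries_mem(1)[OF assms(3) inst])
        show "(a, w) \<in> set ?E" using that pin_eq_Some[OF fn[OF that(1)]] by simp
      qed
    qed
    have ask: "f (query_word j (vs, cs)) = bits (binary (?N j mod p)) \<and> ?N j mod p < p"
      if fn: "\<And>w. w \<in> set vs \<Longrightarrow> functional_at ?E w" and j: "j < n" for j
    proof -
      have "Ss ! j \<in> ?P" using j Ss(1) nth_mem unfolding n_def by blast
      then have "\<theta> (Ss ! j) \<in> H \<rightarrow> H" using \<theta>[of "Ss ! j"] by (simp only: collapses_def)
      moreover have "pinned_instance H nm \<Gamma> hs rels ?K vs (proper cs)" by (rule pinned) (rule fn)
      ultimately have "csp_instance \<Gamma> (presented (?Q (Ss ! j)))"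
        by (intro pinned_instance.collapsed_instance)
      then have "(encode nm (?Q (Ss ! j)), bits (binary (?N j mod p))) \<in> count_csp_mod p nm H \<Gamma>"
        unfolding count_csp_mod_def by blast
      then have "f (encode nm (?Q (Ss ! j))) = bits (binary (?N j mod p))"
        by (rule solvesD[OF f])
      then show ?thesis using query_word_collapsed[of j hs rels "\<theta> (Ss ! j)" vs cs] p0 by (simp add: h_def)
    qed
    have result: "(if \<forall>w \<in> set vs. functional_at ?E w
        then bits (binary ((\<Sum>j<n. coef j * (?N j mod p)) mod p)) else []) = y"
    proof (cases "\<forall>w \<in> set vs. functional_at ?E w")
      case True
      then have fn: "\<And>w. w \<in> set vs \<Longrightarrow> functional_at ?E w" by blast
      interpret P: pinned_instance H nm \<Gamma> hs rels ?K vs "proper cs" by (rule pinned) (rule fn)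
      \<comment> \<open>Without conflicts, the table as a relation and the pins as a partial
        function impose the same condition.\<close>
      have "(\<forall>(a, w) \<in> set ?E. \<phi> w = a) \<longleftrightarrow> (\<forall>w \<in> set vs. \<forall>a. ?K w = Some a \<longrightarrow> \<phi> w = a)" for \<phi>
      proof -
        have "(a, w) \<in> set ?E \<longleftrightarrow> w \<in> set vs \<and> ?K w = Some a" for a w
          using pin_eq_Some[OF fn, of w a] entries_mem(2)[OF assms(3) inst, of a w] by metis
        then show ?thesis by blast
      qed
      then have sol: "solutions H (presented (vs, cs)) = P.pinned_solutions"
        unfolding solutions_presented P.pinned_solutions_def satisfies_split[OF assms(3) inst] by simp
      have "(\<Sum>j<n. (- 1) ^ card (Ss ! j) * int (?N j)) =
          (\<Sum>S \<in> ?P. (- 1) ^ card S * int (card (solutions H (presented (?Q S)))))"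
        by (rule sum.reindex_bij_betw) (use bij_betw_nth[OF Ss(2)] Ss(1) n_def in blast)
      also have "\<dots> = int (card (automorphisms H \<Gamma>)) * int (card P.pinned_solutions)"
        by (rule P.sum_collapsed[OF \<theta>])
      finally have "(\<Sum>j<n. coef j * (?N j mod p)) mod p = card P.pinned_solutions mod p"
        unfolding coef_def by (rule sum_coefficients_mod[OF p0 _ u])
      then show ?thesis using True y sol by simp
    next
      case False
      then obtain w where w: "w \<in> set vs" "\<not> functional_at ?E w" by blast
      then have "keys ?E w \<noteq> {}" "\<nexists>a. keys ?E w = {a}"
        by (auto simp: functional_at_def is_singleton_def)
      then obtain a b where ab: "(a, w) \<in> set ?E" "(b, w) \<in> set ?E" "a \<noteq> b"
        unfolding keys_def by blast
      have "\<not> (\<forall>(x, w) \<in> set ?E. \<phi> w = x)" for \<phi>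
      proof
        assume "\<forall>(x, w) \<in> set ?E. \<phi> w = x"
        then have "\<phi> w = a" "\<phi> w = b" using ab(1,2) by blast+
        then show False using ab(3) by simp
      qed
      then have "solutions H (presented (vs, cs)) = {}"
        unfolding solutions_presented satisfies_split[OF assms(3) inst] by simp
      \<comment> \<open>The empty output of the aborted run is correct because the numeral of 0 is
        the empty word.\<close>
      then show ?thesis using False y by (simp add: binary.simps bits_def)
    qed
    show "\<exists>m \<le> poly time_poly (length x). \<exists>ss.
        (sstep f ^^ m) (Parse Vars_Start, map Inl x # replicate (7 - 1) []) = (Halt, ss) \<and> stack_word (ss ! 0) = y"
      unfolding x result[symmetric]
    proof (rule machine_run[where N = "\<lambda>j. ?N j mod p", OF over])
      show "set s \<subseteq> set vs" if "(s, ts) \<in> set cs" for s ts by (rule star(2)[OF that])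
      show "f (query_word j (vs, cs)) = bits (binary (?N j mod p)) \<and> ?N j mod p < p"
        if "\<And>w. w \<in> set vs \<Longrightarrow> functional_at ?E w" "j < n" for j
        using that by (rule ask)
    qed
  qed
qed

end
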